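(* Let $t\in(0,T]$ be the fixed sampling time step. Fix an arbitrary $r\in\mathbb N$ and assume that the first $r+1$ eigenvalues $\lambda_j$ of $C_{\mathcal X}$ (arranged in non-increasing order) are simple, i.e., $\lambda_{j+1}<\lambda_j$ for all $j=1,\ldots,r$. Let $$\delta_r=\min_{j=1,\ldots,r}\frac{\lambda_j-\lambda_{j+1}}{2}\qquad\text{and}\qquad c_r=\frac{1}{\sqrt{\lambda_r}}+\frac{r+1}{\delta_r\lambda_r}\,\bigl(1+\|\varphi\|_{1,\mathcal Y}\bigr)\,\|\varphi\|_{1,\mathcal X}^{1/2}.$$ Further, let $\varepsilon\in(0,\delta_r)$ and $\delta\in(0,1)$ be arbitrary, fix some $m\ge\max\bigl\{r,\frac{8\|k\|_\infty^2\ln(4/\delta)}{\varepsilon^2}\bigr\}$ and let $$\widehat K_r^{m,t}:=[\widehat C_{\mathcal X}^m]_r^\dagger\,\widehat C_{\mathcal X\mathcal Y}^{m,t}.$$ Then with probability at least $1-\delta$, $$\|P_rK^t-\widehat K_r^{m,t}\|_{\mathbb H_{\mathcal Y}\to L^2(\mathcal X;\mu)}\le c_r\varepsilon.$$ If, furthermore, $K^t\mathbb H_{\mathcal Y}\subset\mathbb H_{\mathcal X}$, then, with probability at least $1-\delta$, $$\|K^t-\widehat K_r^{m,t}\|_{\mathbb H_{\mathcal Y}\to L^2(\mathcal X;\mu)}\le\sqrt{\lambda_{r+1}}\,\|K^t\|_{\mathbb H_{\mathcal Y}\to\mathbb H_{\mathcal X}}+c_r\varepsilon.$$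
   Context: **Dynamics.** Let $b:\mathbb R^d\to\mathbb R^d$ and $\sigma:\mathbb R^d\to\mathbb R^{d\times d}$ be Lipschitz continuous ($\sigma\equiv0$ is allowed), and consider the SDE $dX_t=b(X_t)\,dt+\sigma(X_t)\,dW_t$ with $d$-dimensional Brownian motion $W_t$. Its solution is a continuous time-homogeneous Markov process with transition kernel $\rho_t(x,A)=\mathbb P(X_t\in A\mid X_0=x)$, $x\in\mathbb R^d$, $A\subset\mathbb R^d$ Borel. **Sets and measure.** $\mathcal X=\overline\Omega$ with $\Omega\subset\mathbb R^d$ bounded, connected and open; $T>0$; $\mathcal Y\subset\mathbb R^d$ is closed with $\mathcal X\subset\mathcal Y$ and $\rho_t(x,\mathcal Y)=1$ for all $t\ge0$, $x\in\mathcal X$; $\mu$ is a finite Borel measure on $\mathcal Y$ with $\mu(\mathcal X)=1$, and there is $L>0$ with $\int_{\mathcal X}\rho_t(x,A)\,d\mu(x)\le L\,\mu(A)$ for all Borel $A\subset\mathcal Y$ and $t\in[0,T]$. For $\mathcal Z\in\{\mathcal X,\mathcal Y\}$, $\|\cdot\|_{p,\mathcal Z}$ denotes the norm of $L^p(\mathcal Z;\mu)$. **Koopman operator.** For $t\in[0,T]$, $(K^t\psi)(x)=\int_{\mathcal Y}\psi(y)\,\rho_t(x,dy)$, $x\in\mathcal X$; this gives a bounded operator $K^t:L^2(\mathcal Y;\mu)\to L^2(\mathcal X;\mu)$. **Kernel and RKHS.** $k:\mathcal Y\times\mathcal Y\to\mathbb R$ is a continuous, bounded, symmetric positive definite kernel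 (i.e. $k(x,y)=k(y,x)$ and $\sum_{i,j}k(x_i,x_j)c_ic_j\ge0$ for all finite choices of points and real coefficients). $\mathbb H_{\mathcal Y}$ is its reproducing kernel Hilbert space on $\mathcal Y$ and $\mathbb H_{\mathcal X}$ is the reproducing kernel Hilbert space of the restriction of $k$ to $\mathcal X\times\mathcal X$. Write $\Phi(x)=k(x,\cdot)$ (considered as an element of $\mathbb H_{\mathcal Y}$ or, for $x\in\mathcal X$, also of $\mathbb H_{\mathcal X}$ by restricting to $\mathcal X$), $\varphi(x)=k(x,x)$, and $\|k\|_\infty=\sup|k|=\sup\varphi$. Standing assumptions: (i) if $\psi\in L^2(\mathcal Y;\mu)$ and $\int_{\mathcal Y}\int_{\mathcal Y}k(x,y)\psi(x)\psi(y)\,d\mu(x)\,d\mu(y)=0$, then $\psi=0$ $\mu$-a.e.; (ii) if $\psi\in\mathbb H_{\mathcal Y}$ vanishes $\mu$-a.e. on $\mathcal Y$, then $\psi=0$; (iii) if $\psi\in\mathbb H_{\mathcal X}$ vanishes $\mu$-a.e. on $\mathcal X$, then $\psi=0$ on $\mathcal X$. Hence $\mathbb H_{\mathcal Y}$ and $\mathbb H_{\mathcal X}$ are regarded as (continuously and densely embedded) subspaces of $L^2(\mathcal Y;\mu)$ and $L^2(\mathcal X;\mu)$; let $S_{\mathcal X}:\mathbb H_{\mathcal X}\to L^2(\mathcal X;\mu)$ denote the inclusion. **Covariance operator and Mercer basis.** $C_{\mathcal X}=S_{\mathcal X}^*S_{\mathcal X}=\int_{\mathcal X}\Phi(x)\otimes\Phi(x)\,d\mu(x)$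 is a trace-class operator on $\mathbb H_{\mathcal X}$. By Mercer's theorem there is an orthonormal basis $(e_j)_{j\ge1}$ of $L^2(\mathcal X;\mu)$ of eigenfunctions of $S_{\mathcal X}S_{\mathcal X}^*$ with eigenvalues $\lambda_j>0$, arranged as $\lambda_1\ge\lambda_2\ge\cdots$ (these are also the eigenvalues of $C_{\mathcal X}$, with multiplicity). $P_r$ is the orthogonal projection in $L^2(\mathcal X;\mu)$ onto $\operatorname{span}\{e_1,\ldots,e_r\}$. **Data and estimators.** For $x\in\mathcal X$, $y\in\mathcal Y$, the rank-one operator $\Phi(x)\otimes\Phi(y):\mathbb H_{\mathcal Y}\to\mathbb H_{\mathcal X}$ is $\psi\mapsto\psi(y)\Phi(x)$ (and $\Phi(x)\otimes\Phi(x):\mathbb H_{\mathcal X}\to\mathbb H_{\mathcal X}$, $\psi\mapsto\psi(x)\Phi(x)$). The data $(x_k,y_k)$, $k=0,\ldots,m-1$, are drawn i.i.d. from the distribution $\rho_t(x,dy)\,d\mu(x)$ on $\mathcal X\times\mathcal Y$. Set $$\widehat C_{\mathcal X}^m=\frac1m\sum_{k=0}^{m-1}\Phi(x_k)\otimes\Phi(x_k):\mathbb H_{\mathcal X}\to\mathbb H_{\mathcal X},\qquad\widehat C_{\mathcal X\mathcal Y}^{m,t}=\frac1m\sum_{k=0}^{m-1}\Phi(x_k)\otimes\Phi(y_k):\mathbb H_{\mathcal Y}\to\mathbb H_{\mathcal X}.$$ $[\widehat C_{\mathcal X}^m]_r^\dagger$ denotes the pseudo-inverse of the rank-$r$ truncation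 of the eigendecomposition of $\widehat C_{\mathcal X}^m$: with $\widehat\lambda_1\ge\ldots\ge\widehat\lambda_r$ the $r$ largest eigenvalues of $\widehat C_{\mathcal X}^m$ and $\widehat f_1,\ldots,\widehat f_r$ corresponding $\mathbb H_{\mathcal X}$-orthonormal eigenvectors, $[\widehat C_{\mathcal X}^m]_r^\dagger\eta=\sum_{j=1}^r\widehat\lambda_j^{-1}\langle\eta,\widehat f_j\rangle_{\mathbb H_{\mathcal X}}\widehat f_j$. Probabilities refer to the draw of the data, and $\|\cdot\|_{\mathbb H\to\mathbb K}$ denotes the operator norm. *)

theory Defs
  imports "HOL-Probability.Probability"
begin

section \<open>The stochastic differential equation and its transition kernel\<close>

definition brownian_motion ::
  "'w measure \<Rightarrow> (real \<Rightarrow> 'w measure) \<Rightarrow> (real \<Rightarrow> 'w \<Rightarrow> real^'d) \<Rightarrow> bool" where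
  "brownian_motion N F W \<longleftrightarrow>
     (AE \<omega> in N. W 0 \<omega> = 0) \<and>
     (AE \<omega> in N. continuous_on {0..} (\<lambda>t. W t \<omega>)) \<and>
     (\<forall>t\<ge>0. W t \<in> borel_measurable (F t)) \<and>
     (\<forall>s t. 0 \<le> s \<and> s < t \<longrightarrow>
        prob_space.indep_set N (sets (F s))
          {(\<lambda>\<omega>. W t \<omega> - W s \<omega>) -` A \<inter> space N | A. A \<in> sets borel} \<and>
        distributed N lborel (\<lambda>\<omega>. W t \<omega> - W s \<omega>)
          (\<lambda>x. ennreal (\<Prod>i\<in>UNIV. normal_density 0 (sqrt (t - s)) (x $ i))))"

definition converges_in_probability ::
  "'w measure \<Rightarrow> (nat \<Rightarrow> 'w \<Rightarrow> 'a::metric_space) \<Rightarrow> ('w \<Rightarrow> 'a) \<Rightarrow> bool" where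
  "converges_in_probability N Z I \<longleftrightarrow>
     (\<forall>\<eta>>0. (\<lambda>n. measure N {\<omega> \<in> space N. dist (Z n \<omega>) (I \<omega>) > \<eta>}) \<longlonglongrightarrow> 0)"

text \<open>
  The Ito integral over [0,t] of a matrix-valued integrand with continuous adapted paths (the
  only kind needed below) is the limit in probability of its left-endpoint Riemann sums.
\<close>

definition is_ito_integral ::
  "'w measure \<Rightarrow> (real \<Rightarrow> 'w \<Rightarrow> real^'d) \<Rightarrow> (real \<Rightarrow> 'w \<Rightarrow> real^'d^'d) \<Rightarrow> real \<Rightarrow>
   ('w \<Rightarrow> real^'d) \<Rightarrow> bool" where
  "is_ito_integral N W H t I \<longleftrightarrow>
     I \<in> borel_measurable N \<and>
     converges_in_probability N
       (\<lambda>n \<omega>. \<Sum>i<n. H (t * real i / real n) \<omega> *v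
                  (W (t * real (Suc i) / real n) \<omega> - W (t * real i / real n) \<omega>)) I"

definition sde_solution ::
  "'w measure \<Rightarrow> (real \<Rightarrow> 'w measure) \<Rightarrow> (real \<Rightarrow> 'w \<Rightarrow> real^'d) \<Rightarrow>
   (real^'d \<Rightarrow> real^'d) \<Rightarrow> (real^'d \<Rightarrow> real^'d^'d) \<Rightarrow> (real \<Rightarrow> 'w \<Rightarrow> real^'d) \<Rightarrow> bool" where
  "sde_solution N F W b \<sigma> X \<longleftrightarrow>
     (\<forall>t\<ge>0. X t \<in> borel_measurable (F t)) \<and>
     (AE \<omega> in N. continuous_on {0..} (\<lambda>t. X t \<omega>)) \<and>
     (\<forall>t\<ge>0. \<exists>I. is_ito_integral N W (\<lambda>s \<omega>. \<sigma> (X s \<omega>)) t I \<and>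
        (AE \<omega> in N. X t \<omega> = X 0 \<omega> + integral {0..t} (\<lambda>s. b (X s \<omega>)) + I \<omega>))"

text \<open>
  Conditioning on the initial value being \<open>x\<close> means starting the solution in \<open>x\<close>; by uniqueness in
  law it is immaterial which solution is taken. Measurability in \<open>x\<close> is part of the
  notion of a kernel.
\<close>

definition sde_transition_kernel ::
  "'w measure \<Rightarrow> (real \<Rightarrow> 'w measure) \<Rightarrow> (real \<Rightarrow> 'w \<Rightarrow> real^'d) \<Rightarrow>
   (real^'d \<Rightarrow> real^'d) \<Rightarrow> (real^'d \<Rightarrow> real^'d^'d) \<Rightarrow>
   (real \<Rightarrow> real^'d \<Rightarrow> (real^'d) measure) \<Rightarrow> bool" where
  "sde_transition_kernel N F W b \<sigma> \<rho> \<longleftrightarrow>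
     (\<forall>t\<ge>0. \<rho> t \<in> measurable borel (prob_algebra borel)) \<and>
     (\<forall>x. \<exists>X. sde_solution N F W b \<sigma> X \<and> (AE \<omega> in N. X 0 \<omega> = x) \<and>
              (\<forall>t\<ge>0. \<rho> t x = distr N borel (X t)))"

section \<open>Square integrable functions and operator norms\<close>

text \<open>
  Elements of \<open>L\<^sup>2\<close> are represented by functions; equality in \<open>L\<^sup>2\<close> is equality almost everywhere.
\<close>

definition L2 :: "'a measure \<Rightarrow> ('a \<Rightarrow> real) set" where
  "L2 M = {f \<in> borel_measurable M. integrable M (\<lambda>x. (f x)\<^sup>2)}"

definition l2_inner :: "'a measure \<Rightarrow> ('a \<Rightarrow> real) \<Rightarrow> ('a \<Rightarrow> real) \<Rightarrow> real" where
  "l2_inner M f g = (\<integral>x. f x * g x \<partial>M)"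

definition l2_norm :: "'a measure \<Rightarrow> ('a \<Rightarrow> real) \<Rightarrow> real" where
  "l2_norm M f = sqrt (l2_inner M f f)"

definition l1_norm :: "'a measure \<Rightarrow> ('a \<Rightarrow> real) \<Rightarrow> real" where
  "l1_norm M f = (\<integral>x. \<bar>f x\<bar> \<partial>M)"

definition l2_orthonormal_basis :: "'a measure \<Rightarrow> nat set \<Rightarrow> (nat \<Rightarrow> 'a \<Rightarrow> real) \<Rightarrow> bool" where
  "l2_orthonormal_basis M J e \<longleftrightarrow>
     (\<forall>j\<in>J. e j \<in> L2 M) \<and>
     (\<forall>i\<in>J. \<forall>j\<in>J. l2_inner M (e i) (e j) = (if i = j then 1 else 0)) \<and>
     (\<forall>f\<in>L2 M. (\<forall>j\<in>J. l2_inner M f (e j) = 0) \<longrightarrow> (AE x in M. f x = 0))"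

definition fun_span :: "(nat \<Rightarrow> 'a \<Rightarrow> real) \<Rightarrow> nat \<Rightarrow> ('a \<Rightarrow> real) set" where
  "fun_span e r = {\<lambda>x. \<Sum>j=1..r. a j * e j x | a. True}"

definition l2_proj ::
  "'a measure \<Rightarrow> (nat \<Rightarrow> 'a \<Rightarrow> real) \<Rightarrow> nat \<Rightarrow> ('a \<Rightarrow> real) \<Rightarrow> 'a \<Rightarrow> real" where
  "l2_proj M e r f =
     (SOME g. g \<in> fun_span e r \<and> (\<forall>h\<in>fun_span e r. l2_inner M (\<lambda>x. f x - g x) h = 0))"

text \<open>
  The operator norm of \<open>A : D \<rightarrow> C\<close>, where \<open>nD\<close> and \<open>nC\<close> are the norms on \<open>D\<close> and \<open>C\<close>. It is
  infinite for an unbounded operator, and also if \<open>A\<close> does not map \<open>D\<close> into \<open>C\<close>.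
\<close>

definition op_norm ::
  "'a set \<Rightarrow> ('a \<Rightarrow> real) \<Rightarrow> 'b set \<Rightarrow> ('b \<Rightarrow> real) \<Rightarrow> ('a \<Rightarrow> 'b) \<Rightarrow> ennreal" where
  "op_norm D nD C nC A =
     Inf {ennreal c | c. 0 \<le> c \<and> (\<forall>\<psi>\<in>D. A \<psi> \<in> C \<and> nC (A \<psi>) \<le> c * nD \<psi>)}"

section \<open>Kernels and reproducing kernel Hilbert spaces\<close>

definition pd_kernel :: "'a set \<Rightarrow> ('a \<Rightarrow> 'a \<Rightarrow> real) \<Rightarrow> bool" where
  "pd_kernel S k \<longleftrightarrow>
     (\<forall>x\<in>S. \<forall>y\<in>S. k x y = k y x) \<and>
     (\<forall>(n::nat) x c. (\<forall>i<n. x i \<in> S) \<longrightarrow> 0 \<le> (\<Sum>i<n. \<Sum>j<n. k (x i) (x j) * c i * c j))"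

text \<open>
  Real functions on \<open>S\<close> are represented by functions on the whole type that vanish outside \<open>S\<close>.
\<close>

definition feature :: "'a set \<Rightarrow> ('a \<Rightarrow> 'a \<Rightarrow> real) \<Rightarrow> 'a \<Rightarrow> 'a \<Rightarrow> real" where
  "feature S k x = (\<lambda>y. if y \<in> S then k x y else 0)"

locale rkhs =
  fixes S :: "'a set" and k :: "'a \<Rightarrow> 'a \<Rightarrow> real"
    and H :: "('a \<Rightarrow> real) set" and ip :: "('a \<Rightarrow> real) \<Rightarrow> ('a \<Rightarrow> real) \<Rightarrow> real"
  assumes zero_outside: "\<lbrakk>f \<in> H; x \<notin> S\<rbrakk> \<Longrightarrow> f x = 0"
    and zero_mem: "(\<lambda>x. 0) \<in> H"
    and add_mem: "\<lbrakk>f \<in> H; g \<in> H\<rbrakk> \<Longrightarrow> (\<lambda>x. f x + g x) \<in> H"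
    and scale_mem: "f \<in> H \<Longrightarrow> (\<lambda>x. c * f x) \<in> H"
    and ip_sym: "\<lbrakk>f \<in> H; g \<in> H\<rbrakk> \<Longrightarrow> ip f g = ip g f"
    and ip_add: "\<lbrakk>f \<in> H; g \<in> H; h \<in> H\<rbrakk> \<Longrightarrow> ip (\<lambda>x. f x + g x) h = ip f h + ip g h"
    and ip_scale: "\<lbrakk>f \<in> H; g \<in> H\<rbrakk> \<Longrightarrow> ip (\<lambda>x. c * f x) g = c * ip f g"
    and ip_nonneg: "f \<in> H \<Longrightarrow> 0 \<le> ip f f"
    and ip_definite: "\<lbrakk>f \<in> H; ip f f = 0\<rbrakk> \<Longrightarrow> f = (\<lambda>x. 0)"
    and complete:
      "\<lbrakk>\<And>n::nat. u n \<in> H;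
        \<And>\<eta>. \<eta> > 0 \<Longrightarrow> \<exists>M. \<forall>m\<ge>M. \<forall>n\<ge>M. sqrt (ip (\<lambda>x. u m x - u n x) (\<lambda>x. u m x - u n x)) < \<eta>\<rbrakk>
       \<Longrightarrow> \<exists>f\<in>H. (\<lambda>n. sqrt (ip (\<lambda>x. u n x - f x) (\<lambda>x. u n x - f x))) \<longlonglongrightarrow> 0"
    and feature_mem: "x \<in> S \<Longrightarrow> feature S k x \<in> H"
    and reproducing: "\<lbrakk>f \<in> H; x \<in> S\<rbrakk> \<Longrightarrow> ip f (feature S k x) = f x"

definition h_norm :: "(('a \<Rightarrow> real) \<Rightarrow> ('a \<Rightarrow> real) \<Rightarrow> real) \<Rightarrow> ('a \<Rightarrow> real) \<Rightarrow> real" where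
  "h_norm ip f = sqrt (ip f f)"

text \<open>
  \<open>g = S\<^sup>* f\<close>, where \<open>S\<close> is the inclusion of the RKHS \<open>(H, ip)\<close> into \<open>L\<^sup>2\<close>.
\<close>

definition is_incl_adjoint ::
  "('a \<Rightarrow> real) set \<Rightarrow> (('a \<Rightarrow> real) \<Rightarrow> ('a \<Rightarrow> real) \<Rightarrow> real) \<Rightarrow> 'a measure \<Rightarrow>
   ('a \<Rightarrow> real) \<Rightarrow> ('a \<Rightarrow> real) \<Rightarrow> bool" where
  "is_incl_adjoint H ip M f g \<longleftrightarrow> g \<in> H \<and> (\<forall>\<eta>\<in>H. ip \<eta> g = l2_inner M \<eta> f)"

text \<open>
  An orthonormal basis \<open>(e\<^sub>j)\<close> of \<open>L\<^sup>2\<close> of eigenfunctions of \<open>S S\<^sup>*\<close>, with positive eigenvalues in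
  non-increasing order. The index set consists of all \<open>j \<ge> 1\<close>, or of the indices
  \<open>1, \<dots>, n\<close> if \<open>L\<^sup>2\<close> has finite dimension \<open>n\<close>.
\<close>

definition mercer_basis ::
  "('a \<Rightarrow> real) set \<Rightarrow> (('a \<Rightarrow> real) \<Rightarrow> ('a \<Rightarrow> real) \<Rightarrow> real) \<Rightarrow> 'a measure \<Rightarrow>
   nat set \<Rightarrow> (nat \<Rightarrow> 'a \<Rightarrow> real) \<Rightarrow> (nat \<Rightarrow> real) \<Rightarrow> bool" where
  "mercer_basis H ip M J e lam \<longleftrightarrow>
     (J = {1..} \<or> (\<exists>n. J = {1..n})) \<and>
     l2_orthonormal_basis M J e \<and>
     (\<forall>j\<in>J. \<exists>g. is_incl_adjoint H ip M (e j) g \<and> (AE x in M. g x = lam j * e j x)) \<and>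
     (\<forall>j\<in>J. lam j > 0) \<and>
     (\<forall>i\<in>J. \<forall>j\<in>J. i \<le> j \<longrightarrow> lam j \<le> lam i)"

section \<open>The Koopman operator and its estimator\<close>

definition koopman ::
  "'a set \<Rightarrow> ('a \<Rightarrow> 'a measure) \<Rightarrow> ('a \<Rightarrow> real) \<Rightarrow> 'a \<Rightarrow> real" where
  "koopman Y \<kappa> \<psi> x = (LINT y:Y|\<kappa> x. \<psi> y)"

text \<open>
  The element of \<open>H\<close> that represents the \<open>L\<^sup>2\<close>-class of \<open>f\<close>; it is unique if only the zero
  function in \<open>H\<close> vanishes almost everywhere.
\<close>

definition rep_in :: "('a \<Rightarrow> real) set \<Rightarrow> 'a measure \<Rightarrow> ('a \<Rightarrow> real) \<Rightarrow> 'a \<Rightarrow> real" where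
  "rep_in H M f = (THE h. h \<in> H \<and> (AE x in M. h x = f x))"

text \<open>The distribution \<open>\<kappa>(x,dy) d\<nu>(x)\<close>.\<close>

definition joint_law ::
  "'a::euclidean_space measure \<Rightarrow> ('a \<Rightarrow> 'a measure) \<Rightarrow> ('a \<times> 'a) measure" where
  "joint_law \<nu> \<kappa> = Giry_Monad.bind \<nu> (\<lambda>x. distr (\<kappa> x) (borel \<Otimes>\<^sub>M borel) (\<lambda>y. (x, y)))"

text \<open>
  \<open>(1/m) \<Sum> \<Phi>(x\<^sub>i) \<otimes> \<Phi>(y\<^sub>i)\<close> with values in the RKHS on \<open>S\<close>. The empirical covariance operator
  is the case \<open>y = x\<close>.
\<close>

definition emp_cov ::
  "'a set \<Rightarrow> ('a \<Rightarrow> 'a \<Rightarrow> real) \<Rightarrow> nat \<Rightarrow> (nat \<Rightarrow> 'a) \<Rightarrow> (nat \<Rightarrow> 'a) \<Rightarrow>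
   ('a \<Rightarrow> real) \<Rightarrow> 'a \<Rightarrow> real" where
  "emp_cov S k m x y \<psi> = (\<lambda>z. (1 / real m) * (\<Sum>i<m. \<psi> (y i) * feature S k (x i) z))"

text \<open>
  \<open>lh 1 \<ge> \<dots> \<ge> lh r\<close> are the \<open>r\<close> largest eigenvalues, counted with multiplicity, of the symmetric
  finite-rank operator \<open>A\<close> on \<open>H\<close>, and \<open>fh 1, \<dots>, fh r\<close> are orthonormal eigenvectors: every
  remaining eigenvector has an eigenvalue of at most \<open>lh r\<close>.
\<close>

definition top_eigensystem ::
  "('a \<Rightarrow> real) set \<Rightarrow> (('a \<Rightarrow> real) \<Rightarrow> ('a \<Rightarrow> real) \<Rightarrow> real) \<Rightarrow>
   (('a \<Rightarrow> real) \<Rightarrow> 'a \<Rightarrow> real) \<Rightarrow> nat \<Rightarrow> (nat \<Rightarrow> real) \<Rightarrow> (nat \<Rightarrow> 'a \<Rightarrow> real) \<Rightarrow> bool" where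
  "top_eigensystem H ip A r lh fh \<longleftrightarrow>
     (\<forall>j\<in>{1..r}. fh j \<in> H \<and> A (fh j) = (\<lambda>z. lh j * fh j z)) \<and>
     (\<forall>i\<in>{1..r}. \<forall>j\<in>{1..r}. ip (fh i) (fh j) = (if i = j then 1 else 0)) \<and>
     (\<forall>i\<in>{1..r}. \<forall>j\<in>{1..r}. i \<le> j \<longrightarrow> lh j \<le> lh i) \<and>
     (\<forall>g\<in>H. \<forall>c. g \<noteq> (\<lambda>z. 0) \<and> A g = (\<lambda>z. c * g z) \<and> (\<forall>j\<in>{1..r}. ip g (fh j) = 0)
        \<longrightarrow> c \<le> lh r)"

definition trunc_pinv ::
  "(('a \<Rightarrow> real) \<Rightarrow> ('a \<Rightarrow> real) \<Rightarrow> real) \<Rightarrow> nat \<Rightarrow> (nat \<Rightarrow> real) \<Rightarrow> (nat \<Rightarrow> 'a \<Rightarrow> real) \<Rightarrow>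
   ('a \<Rightarrow> real) \<Rightarrow> 'a \<Rightarrow> real" where
  "trunc_pinv ip r lh fh \<eta> = (\<lambda>z. \<Sum>j=1..r. inverse (lh j) * ip \<eta> (fh j) * fh j z)"

text \<open>
  \<open>K\<close> is the composition of the rank-\<open>r\<close> truncated pseudo-inverse of the empirical covariance
  operator with the empirical cross-covariance operator, for the sample \<open>(x\<^sub>i, y\<^sub>i)\<close>, \<open>i < m\<close>.
  It may depend on the eigenvectors chosen if the \<open>r\<close>-th largest empirical eigenvalue is multiple
  or zero (with \<open>inverse 0 = 0\<close> in the latter case).
\<close>

definition is_koopman_estimator ::
  "'a set \<Rightarrow> ('a \<Rightarrow> 'a \<Rightarrow> real) \<Rightarrow> ('a \<Rightarrow> real) set \<Rightarrow> (('a \<Rightarrow> real) \<Rightarrow> ('a \<Rightarrow> real) \<Rightarrow> real) \<Rightarrow>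
   nat \<Rightarrow> nat \<Rightarrow> (nat \<Rightarrow> 'a) \<Rightarrow> (nat \<Rightarrow> 'a) \<Rightarrow> (('a \<Rightarrow> real) \<Rightarrow> 'a \<Rightarrow> real) \<Rightarrow> bool" where
  "is_koopman_estimator S k H ip r m x y K \<longleftrightarrow>
     (\<exists>lh fh. top_eigensystem H ip (emp_cov S k m x x) r lh fh \<and>
              K = (\<lambda>\<psi>. trunc_pinv ip r lh fh (emp_cov S k m x y \<psi>)))"

text \<open>
  An inner-measure formulation, so that \<open>Q\<close> need not be known to be an event.
\<close>

definition with_prob_at_least :: "'w measure \<Rightarrow> real \<Rightarrow> ('w \<Rightarrow> bool) \<Rightarrow> bool" where
  "with_prob_at_least D p Q \<longleftrightarrow> (\<exists>E\<in>sets D. measure D E \<ge> p \<and> (\<forall>\<omega>\<in>E. Q \<omega>))"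

end

theory Submission
  imports Defs
begin

text \<open>
  Let \<open>C\<close> and \<open>C'\<close> be the covariance and the cross-covariance operator. The projected Koopman operator
  is the inverse of \<open>C\<close>, truncated to the first \<open>r\<close> eigenvalues, applied to \<open>C'\<close>; the estimator is the
  same expression in the empirical operators. The error thus has two parts. The deviation of the
  empirical \<open>C'\<close> enters through the truncated inverse of \<open>C\<close>, whose norm into \<open>L\<^sup>2\<close> is
  \<open>1 / sqrt (lam r)\<close>. The deviation of the truncated inverse is estimated by
  \<open>truncated_inverse_perturbation\<close>, with a Davis-Kahan bound for the eigenspaces and Weyl bounds for the
  eigenvalues, and is multiplied by the norm of the empirical \<open>C'\<close>.

  The constant \<open>c\<^sub>r\<close> does not contain the constant \<open>L\<close> that relates the law of the second data component
  to \<open>\<mu>\<close>. So the norm of \<open>C'\<close> cannot be estimated by the \<open>L\<^sup>1\<close> norm of the diagonal of the kernel: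
  it is only bounded by \<open>sqrt (t A)\<close>, where \<open>t\<close> is the trace of \<open>C\<close> and \<open>A\<close> is the supremum of the kernel,
  and \<open>A\<close> may be much larger than \<open>t\<close>. A concentration inequality of Hoeffding type, which bounds the
  deviations by \<open>\<epsilon>\<close>, would leave a factor \<open>sqrt (A / t)\<close>. What saves the estimate is that the
  summands have second moment at most \<open>t A\<close> instead of \<open>A\<^sup>2\<close>. A Bernstein inequality in Hilbert space
  (\<open>product_feature_concentration\<close>) therefore gives deviations below \<open>3/5 * \<epsilon> sqrt (t / A)\<close> for the
  same sample size, and the product with \<open>sqrt (t A)\<close> is \<open>3/5 * \<epsilon> t\<close>. As \<open>\<epsilon>\<close> is less than half the gap
  at \<open>lam r\<close>, the numerical constants then fit into \<open>c\<^sub>r\<close> (\<open>estimator_constant_le\<close>).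

  All operators are treated in coordinates. The Mercer eigenfunctions give an isometry of the
  space over \<open>X\<close> into the space of square summable sequences, and the space over \<open>Y\<close> has a total
  orthonormal sequence by the Gram-Schmidt process. Hilbert-Schmidt norms are then limits of sums
  over finite sections of matrices, to which the scalar concentration argument applies.

  For the second claim, \<open>projection_error\<close> bounds the distance between the Koopman operator and its projection.
\<close>

section \<open>A Bernstein inequality for sums of independent vectors\<close>

lemma cosh_sqrt_sums:
  assumes "0 \<le> (v::real)"
  shows "(\<lambda>n. v ^ n / fact (2 * n)) sums cosh (sqrt v)"
proof -
  let ?f = "\<lambda>n. if even n then sqrt v ^ n /\<^sub>R fact n else 0"
  have "(\<lambda>n. ?f (2 * n)) sums cosh (sqrt v) \<longleftrightarrow> ?f sums cosh (sqrt v)"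
    by (rule sums_mono_reindex) (auto simp: strict_mono_def elim!: oddE evenE)
  moreover have "?f (2 * n) = v ^ n / fact (2 * n)" for n :: nat
  proof -
    have "sqrt v ^ (2 * n) = v ^ n" using assms by (simp add: power_mult)
    then show ?thesis by (simp add: divide_inverse mult.commute)
  qed
  ultimately show ?thesis
    using cosh_converges[of "sqrt v"] by simp
qed

lemma convex_power_nonneg: "convex_on {0::real..} (\<lambda>x. x ^ n)"
  by (cases "even n") (auto intro: convex_power_odd convex_on_subset[OF convex_power_even])

text \<open>
  If \<open>S\<close> and \<open>z\<close> are the norms of two vectors with inner product \<open>u\<close>, the left-hand side is the
  hyperbolic cosine of the norm of their sum. Since \<open>cosh (sqrt v)\<close> is convex in \<open>v\<close>, its graph lies
  below the chord over the interval from \<open>(S - z)\<^sup>2\<close> to \<open>(S + z)\<^sup>2\<close>; the chord is affine in \<open>u\<close>.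
\<close>

lemma cosh_sqrt_chord:
  assumes "0 \<le> (S::real)" "0 \<le> z" "\<bar>u\<bar> \<le> S * z"
  shows "cosh (sqrt (S\<^sup>2 + 2 * u + z\<^sup>2)) \<le> cosh S * cosh z + u * (sinh S / S) * (sinh z / z)"
proof (cases "S * z = 0")
  case True
  with assms show ?thesis by auto
next
  case False
  then have pos: "0 < S * z" "S > 0" "z > 0" using assms by (auto simp: less_le)
  define \<tau> where "\<tau> = (u / (S * z) + 1) / 2"
  have "\<bar>u / (S * z)\<bar> \<le> 1" using assms pos by (simp add: abs_mult)
  then have \<tau>: "0 \<le> \<tau>" "\<tau> \<le> 1" unfolding \<tau>_def abs_le_iff by simp_all
  have "2 * ((q + 1) / 2) - 1 = q" for q :: real by (simp add: add_divide_distrib)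
  then have "2 * \<tau> - 1 = u / (S * z)" unfolding \<tau>_def .
  then have u: "u = (2 * \<tau> - 1) * (S * z)" using pos by simp
  define v where "v = S\<^sup>2 + 2 * u + z\<^sup>2"
  have v: "v = (1 - \<tau>) * (S - z)\<^sup>2 + \<tau> * (S + z)\<^sup>2"
    unfolding v_def u by (simp add: power2_eq_square algebra_simps)
  have v0: "0 \<le> v" unfolding v using \<tau> by simp
  have "cosh (sqrt v) \<le> (1 - \<tau>) * cosh (sqrt ((S - z)\<^sup>2)) + \<tau> * cosh (sqrt ((S + z)\<^sup>2))"
  proof (rule sums_le[OF _ cosh_sqrt_sums[OF v0]
        sums_add[OF sums_mult[OF cosh_sqrt_sums] sums_mult[OF cosh_sqrt_sums]]])
    \<comment> \<open>the power series has nonnegative coefficients, so convexity is checked term by term\<close>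
    show "v ^ n / fact (2 * n) \<le> (1 - \<tau>) * (((S - z)\<^sup>2) ^ n / fact (2 * n))
        + \<tau> * (((S + z)\<^sup>2) ^ n / fact (2 * n))" for n
      using convex_onD[OF convex_power_nonneg, of \<tau> "(S - z)\<^sup>2" "(S + z)\<^sup>2" n] \<tau>
      unfolding v by (simp add: field_simps)
  qed auto
  also have "sqrt ((S - z)\<^sup>2) = \<bar>S - z\<bar>" by simp
  also have "sqrt ((S + z)\<^sup>2) = S + z" using pos by simp
  also have "cosh \<bar>S - z\<bar> = cosh (S - z)" by simp
  also have "(1 - \<tau>) * cosh (S - z) + \<tau> * cosh (S + z)
      = cosh S * cosh z + (2 * \<tau> - 1) * (sinh S * sinh z)"
    by (simp add: cosh_add cosh_diff algebra_simps)
  also have "(2 * \<tau> - 1) * (sinh S * sinh z) = u * (sinh S / S) * (sinh z / z)"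
    using pos by (simp add: u)
  finally show ?thesis unfolding v_def .
qed

lemma exp_le_quadratic:
  assumes "0 \<le> (x::real)" "x \<le> 5/12"
  shows "exp x \<le> 1 + x + 18/25 * x\<^sup>2"
proof -
  let ?f = "\<lambda>x. 1 + x + 18/25 * x\<^sup>2 - exp x"
  have "?f 0 \<le> ?f x"
  proof (rule DERIV_nonneg_imp_nondecreasing[OF assms(1)])
    fix y :: real assume y: "0 \<le> y" "y \<le> x"
    have "exp y \<le> 1 + y + y\<^sup>2" using y assms by (intro exp_bound) auto
    also have "y\<^sup>2 \<le> 11/25 * y"
      using y assms unfolding power2_eq_square by (intro mult_right_mono) auto
    finally have "0 \<le> 1 + 36/25 * y - exp y" by simp
    then show "\<exists>D. (?f has_real_derivative D) (at y) \<and> 0 \<le> D"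
      by (intro exI[of _ "1 + 36/25 * y - exp y"]) (auto intro!: derivative_eq_intros)
  qed
  then show ?thesis by simp
qed

lemma sinh_ge_self: "0 \<le> (x::real) \<Longrightarrow> x \<le> sinh x"
proof -
  assume x: "0 \<le> x"
  have "sinh 0 - 0 \<le> sinh x - x"
    by (rule DERIV_nonneg_imp_nondecreasing[OF x])
      (auto intro!: derivative_eq_intros exI cosh_real_ge_1)
  then show ?thesis by simp
qed

text \<open>
  The chord bound with its coefficient of \<open>u\<close> made independent of \<open>z\<close>. When \<open>u\<close> comes from a centred
  random vector, the last term then has mean zero.
\<close>

lemma cosh_norm_step:
  assumes "0 \<le> (S::real)" "0 \<le> z" "z \<le> 5/12" "\<bar>u\<bar> \<le> S * z"
  shows "cosh (sqrt (S\<^sup>2 + 2 * u + z\<^sup>2)) \<le> cosh S * (1 + 18/25 * z\<^sup>2) + (sinh S / S) * u"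
proof (cases "S * z = 0")
  case True
  then have u: "u = 0" using assms by auto
  have "cosh (sqrt (S\<^sup>2 + z\<^sup>2)) \<le> cosh S * cosh z"
    using True assms by auto
  also have "cosh z \<le> cosh z + (sinh z - z)" using sinh_ge_self assms by simp
  also have "\<dots> = exp z - z" by (simp add: cosh_plus_sinh[symmetric])
  also have "\<dots> \<le> 1 + 18/25 * z\<^sup>2" using exp_le_quadratic[of z] assms by simp
  finally show ?thesis using u by simp
next
  case False
  then have pos: "S > 0" "z > 0" using assms by (auto simp: less_le)
  have "u * (sinh S / S) * (sinh z / z) - (sinh S / S) * u = u * ((sinh S / S) * ((sinh z - z) / z))"
    using pos by (simp add: field_simps)
  also have "\<dots> \<le> (S * z) * ((sinh S / S) * ((sinh z - z) / z))"
    using assms pos sinh_ge_self[of z] by (intro mult_right_mono) auto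
  also have "\<dots> = sinh S * (sinh z - z)" using pos by simp
  also have "\<dots> \<le> cosh S * (sinh z - z)"
    using sinh_ge_self[of z] pos
    by (intro mult_right_mono less_imp_le[OF sinh_less_cosh_real]) auto
  finally have "cosh S * cosh z + u * (sinh S / S) * (sinh z / z)
      \<le> cosh S * (cosh z + sinh z - z) + (sinh S / S) * u"
    by (simp add: algebra_simps)
  also have "cosh z + sinh z = exp z" by (rule cosh_plus_sinh)
  also have "cosh S * (exp z - z) \<le> cosh S * (1 + 18/25 * z\<^sup>2)"
    using exp_le_quadratic[of z] assms by (intro mult_left_mono) auto
  finally show ?thesis using cosh_sqrt_chord[OF assms(1,2,4)] by simp
qed

lemma cosh_norm_add_le:
  fixes s z :: "'i \<Rightarrow> real"
  assumes "finite I" "0 \<le> \<kappa>" "\<kappa> * sqrt (\<Sum>i\<in>I. (z i)\<^sup>2) \<le> 5/12"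
  defines "S \<equiv> \<kappa> * sqrt (\<Sum>i\<in>I. (s i)\<^sup>2)"
  shows "cosh (\<kappa> * sqrt (\<Sum>i\<in>I. (s i + z i)\<^sup>2))
    \<le> cosh S * (1 + 18/25 * \<kappa>\<^sup>2 * (\<Sum>i\<in>I. (z i)\<^sup>2)) + (sinh S / S * \<kappa>\<^sup>2) * (\<Sum>i\<in>I. s i * z i)"
proof -
  define \<zeta> where "\<zeta> = \<kappa> * sqrt (\<Sum>i\<in>I. (z i)\<^sup>2)"
  define u where "u = \<kappa>\<^sup>2 * (\<Sum>i\<in>I. s i * z i)"
  have S2: "S\<^sup>2 = \<kappa>\<^sup>2 * (\<Sum>i\<in>I. (s i)\<^sup>2)" and z2: "\<zeta>\<^sup>2 = \<kappa>\<^sup>2 * (\<Sum>i\<in>I. (z i)\<^sup>2)"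
    by (simp_all add: S_def \<zeta>_def power_mult_distrib sum_nonneg)
  have "\<bar>\<Sum>i\<in>I. s i * z i\<bar> \<le> (\<Sum>i\<in>I. \<bar>s i\<bar> * \<bar>z i\<bar>)"
    by (rule order_trans[OF sum_abs]) (simp add: abs_mult)
  also have "\<dots> \<le> L2_set s I * L2_set z I" by (rule L2_set_mult_ineq)
  finally have "\<kappa>\<^sup>2 * \<bar>\<Sum>i\<in>I. s i * z i\<bar> \<le> \<kappa>\<^sup>2 * (L2_set s I * L2_set z I)"
    by (rule mult_left_mono) simp
  then have u: "\<bar>u\<bar> \<le> S * \<zeta>"
    by (simp add: u_def S_def \<zeta>_def abs_mult L2_set_def power2_eq_square mult_ac)
  have "cosh (sqrt (S\<^sup>2 + 2 * u + \<zeta>\<^sup>2)) \<le> cosh S * (1 + 18/25 * \<zeta>\<^sup>2) + (sinh S / S) * u"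
    using assms u by (intro cosh_norm_step) (auto simp: \<zeta>_def S_def sum_nonneg)
  moreover have "S\<^sup>2 + 2 * u + \<zeta>\<^sup>2 = \<kappa>\<^sup>2 * (\<Sum>i\<in>I. (s i + z i)\<^sup>2)"
    unfolding S2 z2 u_def
    by (simp add: power2_sum sum.distrib sum_distrib_left algebra_simps)
  moreover have "sqrt (\<kappa>\<^sup>2 * (\<Sum>i\<in>I. (s i + z i)\<^sup>2)) = \<kappa> * sqrt (\<Sum>i\<in>I. (s i + z i)\<^sup>2)"
    using assms by (simp add: real_sqrt_mult)
  ultimately show ?thesis by (simp add: z2 u_def mult.assoc)
qed

lemma measurable_cosh_sqrt:
  "g \<in> borel_measurable M \<Longrightarrow> (\<lambda>x. ennreal (cosh (c * sqrt (g x :: real)))) \<in> borel_measurable M"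
proof -
  assume g: "g \<in> borel_measurable M"
  have "(\<lambda>x. cosh (c * sqrt (g x))) \<in> borel_measurable M"
    by (rule borel_measurable_continuous_on[OF _ g, where f = "\<lambda>v. cosh (c * sqrt v)"])
      (intro continuous_intros)
  then show ?thesis by (rule measurable_compose[OF _ measurable_ennreal])
qed

text \<open>
  The moment generating bound behind the Bernstein inequality of Pinelis and Sakhanenko: adding one
  more independent centred vector multiplies the expectation of \<open>cosh (\<kappa> \<parallel>S\<^sub>n\<parallel>)\<close> by at most a factor that involves only
  the second moment \<open>V\<close>. The bound does not depend on the number of coordinates.
\<close>

lemma (in prob_space) nn_integral_cosh_norm_sum_le:
  fixes Z :: "'i \<Rightarrow> 'a \<Rightarrow> real"
  assumes I: "finite I" and Z[measurable]: "\<And>i. i \<in> I \<Longrightarrow> Z i \<in> borel_measurable M"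
    and mean: "\<And>i. i \<in> I \<Longrightarrow> expectation (Z i) = 0"
    and bound: "\<And>x. x \<in> space M \<Longrightarrow> (\<Sum>i\<in>I. (Z i x)\<^sup>2) \<le> B\<^sup>2" and B: "0 \<le> B"
    and var: "expectation (\<lambda>x. \<Sum>i\<in>I. (Z i x)\<^sup>2) \<le> V"
    and l: "0 \<le> \<kappa>" "\<kappa> * B \<le> 5/12"
  shows "(\<integral>\<^sup>+x. ennreal (cosh (\<kappa> * sqrt (\<Sum>i\<in>I. (\<Sum>j<n. Z i (x j))\<^sup>2))) \<partial>Pi\<^sub>M {..<n} (\<lambda>_. M))
    \<le> ennreal ((1 + 18/25 * \<kappa>\<^sup>2 * V) ^ n)"
proof (induction n)
  case 0
  interpret E: prob_space "Pi\<^sub>M {..<0::nat} (\<lambda>_. M)"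
    by (intro prob_space_PiM prob_space_axioms)
  show ?case using E.emeasure_space_1 by simp
next
  case (Suc n)
  interpret P: product_prob_space "\<lambda>_::nat. M" UNIV by standard
  let ?N = "\<lambda>x. sqrt (\<Sum>i\<in>I. (\<Sum>j<n. Z i (x j))\<^sup>2)"
  have bZ: "\<bar>Z i x\<bar> \<le> B" if "i \<in> I" "x \<in> space M" for i x
  proof -
    have "(Z i x)\<^sup>2 \<le> (\<Sum>i\<in>I. (Z i x)\<^sup>2)"
      using I that(1) by (intro member_le_sum) auto
    then have "(Z i x)\<^sup>2 \<le> B\<^sup>2" using bound[OF that(2)] by linarith
    then show ?thesis using B by (simp add: abs_le_square_iff[symmetric])
  qed
  have iZ: "integrable M (Z i)" if "i \<in> I" for i
    using that bZ by (intro integrable_const_bound[of _ B]) auto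
  have iQ: "integrable M (\<lambda>x. \<Sum>i\<in>I. (Z i x)\<^sup>2)"
    using bound by (intro integrable_const_bound[of _ "B\<^sup>2"]) (auto simp: sum_nonneg)
  have V0: "0 \<le> V" using order_trans[OF Bochner_Integration.integral_nonneg var] by (simp add: sum_nonneg)
  have inner: "(\<integral>\<^sup>+y. ennreal (cosh (\<kappa> * sqrt (\<Sum>i\<in>I. (\<Sum>j<Suc n. Z i ((x(n := y)) j))\<^sup>2))) \<partial>M)
      \<le> ennreal (1 + 18/25 * \<kappa>\<^sup>2 * V) * ennreal (cosh (\<kappa> * ?N x))"
    if "x \<in> space (Pi\<^sub>M {..<n} (\<lambda>_. M))" for x
  proof -
    define s where "s i = (\<Sum>j<n. Z i (x j))" for i
    define S where "S = \<kappa> * sqrt (\<Sum>i\<in>I. (s i)\<^sup>2)"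
    define R where "R y = cosh S * (1 + 18/25 * \<kappa>\<^sup>2 * (\<Sum>i\<in>I. (Z i y)\<^sup>2))
        + (sinh S / S * \<kappa>\<^sup>2) * (\<Sum>i\<in>I. s i * Z i y)" for y
    have upd: "(\<Sum>j<Suc n. Z i ((x(n := y)) j)) = s i + Z i y" for i y
      by (simp add: s_def)
    have le: "cosh (\<kappa> * sqrt (\<Sum>i\<in>I. (s i + Z i y)\<^sup>2)) \<le> R y" if "y \<in> space M" for y
      unfolding R_def S_def
    proof (rule cosh_norm_add_le[OF I l(1)])
      have "sqrt (\<Sum>i\<in>I. (Z i y)\<^sup>2) \<le> B" using bound[OF that] B by (simp add: real_le_lsqrt)
      then show "\<kappa> * sqrt (\<Sum>i\<in>I. (Z i y)\<^sup>2) \<le> 5/12"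
        using mult_left_mono[of _ B \<kappa>] l by fastforce
    qed
    have iR: "integrable M R" unfolding R_def using iZ iQ by auto
    have "(\<integral>\<^sup>+y. ennreal (cosh (\<kappa> * sqrt (\<Sum>i\<in>I. (s i + Z i y)\<^sup>2))) \<partial>M) \<le> (\<integral>\<^sup>+y. ennreal (R y) \<partial>M)"
      using le by (intro nn_integral_mono ennreal_leI) auto
    also have "\<dots> = ennreal (expectation R)"
      by (intro nn_integral_eq_integral iR AE_I2 order_trans[OF cosh_real_nonneg le])
    also have "ennreal (expectation R) \<le> ennreal (cosh S * (1 + 18/25 * \<kappa>\<^sup>2 * V))"
    proof (rule ennreal_leI)
    have "expectation R = cosh S * (1 + 18/25 * \<kappa>\<^sup>2 * expectation (\<lambda>y. \<Sum>i\<in>I. (Z i y)\<^sup>2))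
        + (sinh S / S * \<kappa>\<^sup>2) * (\<Sum>i\<in>I. s i * expectation (Z i))"
      unfolding R_def using iZ iQ
      by (subst Bochner_Integration.integral_add) (auto simp: prob_space)
    also have "\<dots> \<le> cosh S * (1 + 18/25 * \<kappa>\<^sup>2 * V)"
      using mean var by (auto intro!: mult_left_mono)
    finally show "expectation R \<le> cosh S * (1 + 18/25 * \<kappa>\<^sup>2 * V)" .
    qed
    finally show ?thesis
      unfolding upd S_def[symmetric] s_def[symmetric]
      using V0 by (subst ennreal_mult[symmetric]) (simp_all add: mult.commute)
  qed
  have "(\<integral>\<^sup>+x. ennreal (cosh (\<kappa> * sqrt (\<Sum>i\<in>I. (\<Sum>j<Suc n. Z i (x j))\<^sup>2))) \<partial>Pi\<^sub>M (insert n {..<n}) (\<lambda>_. M))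
    = (\<integral>\<^sup>+x. \<integral>\<^sup>+y. ennreal (cosh (\<kappa> * sqrt (\<Sum>i\<in>I. (\<Sum>j<Suc n. Z i ((x(n := y)) j))\<^sup>2))) \<partial>M
        \<partial>Pi\<^sub>M {..<n} (\<lambda>_. M))"
  proof (rule P.product_nn_integral_insert)
    have meas: "(\<lambda>x. Z i (x j)) \<in> borel_measurable (Pi\<^sub>M (insert n {..<n}) (\<lambda>_. M))"
      if "i \<in> I" "j < Suc n" for i j
      using that by (intro measurable_compose[OF measurable_component_singleton[of j "insert n {..<n}" "\<lambda>_. M"] Z]) auto
    show "(\<lambda>x. ennreal (cosh (\<kappa> * sqrt (\<Sum>i\<in>I. (\<Sum>j<Suc n. Z i (x j))\<^sup>2))))
        \<in> borel_measurable (Pi\<^sub>M (insert n {..<n}) (\<lambda>_. M))"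
      by (intro measurable_cosh_sqrt borel_measurable_sum borel_measurable_power meas) auto
  qed auto
  also have "\<dots> \<le> (\<integral>\<^sup>+x. ennreal (1 + 18/25 * \<kappa>\<^sup>2 * V) * ennreal (cosh (\<kappa> * ?N x)) \<partial>Pi\<^sub>M {..<n} (\<lambda>_. M))"
    by (intro nn_integral_mono inner)
  also have "\<dots> = ennreal (1 + 18/25 * \<kappa>\<^sup>2 * V) * (\<integral>\<^sup>+x. ennreal (cosh (\<kappa> * ?N x)) \<partial>Pi\<^sub>M {..<n} (\<lambda>_. M))"
  proof (rule nn_integral_cmult)
    have meas: "(\<lambda>x. Z i (x j)) \<in> borel_measurable (Pi\<^sub>M {..<n} (\<lambda>_. M))"
      if "i \<in> I" "j < n" for i j
      using that by (intro measurable_compose[OF measurable_component_singleton[of j "{..<n}" "\<lambda>_. M"] Z]) auto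
    show "(\<lambda>x. ennreal (cosh (\<kappa> * ?N x))) \<in> borel_measurable (Pi\<^sub>M {..<n} (\<lambda>_. M))"
      by (intro measurable_cosh_sqrt borel_measurable_sum borel_measurable_power meas) auto
  qed
  also have "\<dots> \<le> ennreal (1 + 18/25 * \<kappa>\<^sup>2 * V) * ennreal ((1 + 18/25 * \<kappa>\<^sup>2 * V) ^ n)"
    by (intro mult_left_mono Suc) auto
  also have "\<dots> = ennreal ((1 + 18/25 * \<kappa>\<^sup>2 * V) ^ Suc n)"
    unfolding power_Suc using V0 by (intro ennreal_mult[symmetric] zero_le_power) auto
  finally show ?case by (simp add: lessThan_Suc)
qed

lemma (in prob_space) iid_sum_norm_tail:
  fixes Z :: "'i \<Rightarrow> 'c \<Rightarrow> real" and V :: "nat \<Rightarrow> 'a \<Rightarrow> 'c"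
  assumes law: "\<And>j. j < m \<Longrightarrow> distr M K (V j) = P" and indep: "indep_vars (\<lambda>_. K) V {..<m}"
    and m: "0 < m"
    and I: "finite I" and Z: "\<And>i. i \<in> I \<Longrightarrow> Z i \<in> borel_measurable P"
    and mean: "\<And>i. i \<in> I \<Longrightarrow> integral\<^sup>L P (Z i) = 0"
    and bound: "\<And>x. x \<in> space P \<Longrightarrow> (\<Sum>i\<in>I. (Z i x)\<^sup>2) \<le> B\<^sup>2" and B: "0 \<le> B"
    and var: "integral\<^sup>L P (\<lambda>x. \<Sum>i\<in>I. (Z i x)\<^sup>2) \<le> v" and v: "0 \<le> v"
    and l: "0 \<le> \<kappa>" "\<kappa> * B \<le> 5/12"
  shows "prob {\<omega> \<in> space M. s \<le> sqrt (\<Sum>i\<in>I. (\<Sum>j<m. Z i (V j \<omega>))\<^sup>2)}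
    \<le> 2 * exp (real m * (18/25 * \<kappa>\<^sup>2 * v) - \<kappa> * s)"
proof -
  have rv: "V j \<in> measurable M K" if "j < m" for j
    using indep that by (auto simp: indep_vars_def)
  interpret P: prob_space P
    using prob_space_distr[OF rv[OF m]] law[OF m] by simp
  have sets_P: "sets P = sets K" using law[OF m] by auto
  let ?S = "\<lambda>x. sqrt (\<Sum>i\<in>I. (\<Sum>j<m. Z i (x j))\<^sup>2)"
  let ?T = "\<lambda>\<omega>. \<lambda>j\<in>{..<m}. V j \<omega>"
  have ZK: "Z i \<in> borel_measurable K" if "i \<in> I" for i
    using Z[OF that] sets_P by (simp cong: measurable_cong_sets)
  have measV: "(\<lambda>\<omega>. Z i (V j \<omega>)) \<in> borel_measurable M" if "i \<in> I" "j < m" for i j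
    using that by (intro measurable_compose[OF rv ZK]) auto
  have eq: "?S (?T \<omega>) = ?S (\<lambda>j. V j \<omega>)" for \<omega> by simp
  have pi: "distr M (\<Pi>\<^sub>M j\<in>{..<m}. K) ?T = (\<Pi>\<^sub>M j\<in>{..<m}. P)"
  proof -
    have "distr M (\<Pi>\<^sub>M j\<in>{..<m}. K) ?T = (\<Pi>\<^sub>M j\<in>{..<m}. distr M K (V j))"
      using indep rv m by (subst indep_vars_iff_distr_eq_PiM'[symmetric]) auto
    also have "\<dots> = (\<Pi>\<^sub>M j\<in>{..<m}. P)" by (intro PiM_cong) (simp_all add: law)
    finally show ?thesis .
  qed
  have "(\<integral>\<^sup>+\<omega>. ennreal (cosh (\<kappa> * ?S (\<lambda>j. V j \<omega>))) \<partial>M)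
      = (\<integral>\<^sup>+x. ennreal (cosh (\<kappa> * ?S x)) \<partial>distr M (\<Pi>\<^sub>M j\<in>{..<m}. K) ?T)"
  proof -
    have T: "?T \<in> measurable M (\<Pi>\<^sub>M j\<in>{..<m}. K)" using rv by (intro measurable_restrict) auto
    have meas: "(\<lambda>x. Z i (x j)) \<in> borel_measurable (\<Pi>\<^sub>M j\<in>{..<m}. K)"
      if "i \<in> I" "j < m" for i j
      using that by (intro measurable_compose[OF measurable_component_singleton[of j "{..<m}" "\<lambda>_. K"] ZK]) auto
    have F: "(\<lambda>x. ennreal (cosh (\<kappa> * ?S x))) \<in> borel_measurable (\<Pi>\<^sub>M j\<in>{..<m}. K)"
      by (intro measurable_cosh_sqrt borel_measurable_sum borel_measurable_power meas) auto
    show ?thesis by (subst nn_integral_distr[OF T]) (use F in simp_all)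
  qed
  also have "\<dots> \<le> ennreal ((1 + 18/25 * \<kappa>\<^sup>2 * v) ^ m)"
    unfolding pi by (rule P.nn_integral_cosh_norm_sum_le[OF I Z mean bound B var l])
  also have "\<dots> \<le> ennreal (exp (18/25 * \<kappa>\<^sup>2 * v) ^ m)"
    using v by (intro ennreal_leI power_mono exp_ge_add_one_self) auto
  finally have mgf: "(\<integral>\<^sup>+\<omega>. ennreal (cosh (\<kappa> * ?S (\<lambda>j. V j \<omega>))) \<partial>M)
      \<le> ennreal (exp (real m * (18/25 * \<kappa>\<^sup>2 * v)))"
    by (simp only: exp_of_nat_mult)
  let ?E = "{\<omega> \<in> space M. s \<le> ?S (\<lambda>j. V j \<omega>)}"
  have [measurable]: "(\<lambda>\<omega>. \<Sum>i\<in>I. (\<Sum>j<m. Z i (V j \<omega>))\<^sup>2) \<in> borel_measurable M"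
    by (intro borel_measurable_sum borel_measurable_power measV) auto
  have "?E \<in> sets M" by measurable
  then have "emeasure M ?E = (\<integral>\<^sup>+\<omega>. indicator ?E \<omega> \<partial>M)" by simp
  also have "\<dots> \<le> (\<integral>\<^sup>+\<omega>. ennreal (2 * exp (- \<kappa> * s)) * ennreal (cosh (\<kappa> * ?S (\<lambda>j. V j \<omega>))) \<partial>M)"
  proof (intro nn_integral_mono)
    fix \<omega>
    have "1 \<le> 2 * exp (- \<kappa> * s) * cosh (\<kappa> * ?S (\<lambda>j. V j \<omega>))" if "s \<le> ?S (\<lambda>j. V j \<omega>)"
    proof -
      have "1 \<le> exp (\<kappa> * ?S (\<lambda>j. V j \<omega>) - \<kappa> * s)"
        using that l by (simp add: mult_left_mono)
      also have "\<dots> = exp (- \<kappa> * s) * exp (\<kappa> * ?S (\<lambda>j. V j \<omega>))"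
        by (simp add: exp_diff exp_minus field_simps)
      also have "\<dots> \<le> exp (- \<kappa> * s) * (2 * cosh (\<kappa> * ?S (\<lambda>j. V j \<omega>)))"
        by (intro mult_left_mono) (auto simp: cosh_def)
      finally show ?thesis by simp
    qed
    then show "indicator ?E \<omega> \<le> ennreal (2 * exp (- \<kappa> * s)) * ennreal (cosh (\<kappa> * ?S (\<lambda>j. V j \<omega>)))"
      by (auto simp: indicator_def ennreal_mult[symmetric] simp del: ennreal_mult)
  qed
  also have "\<dots> = ennreal (2 * exp (- \<kappa> * s)) * (\<integral>\<^sup>+\<omega>. ennreal (cosh (\<kappa> * ?S (\<lambda>j. V j \<omega>))) \<partial>M)"
    by (intro nn_integral_cmult measurable_cosh_sqrt borel_measurable_sum borel_measurable_power measV) auto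
  also have "\<dots> \<le> ennreal (2 * exp (- \<kappa> * s)) * ennreal (exp (real m * (18/25 * \<kappa>\<^sup>2 * v)))"
    by (intro mult_left_mono mgf) simp
  also have "\<dots> = ennreal (2 * exp (real m * (18/25 * \<kappa>\<^sup>2 * v) - \<kappa> * s))"
    by (subst ennreal_mult[symmetric]) (simp_all add: exp_add[symmetric] mult.assoc)
  finally show ?thesis by (simp add: emeasure_eq_measure)
qed

text \<open>
  Concentration of the empirical mean of the infinite matrix \<open>(f\<^sub>j g\<^sub>l)\<close> in the Hilbert-Schmidt norm.
  The second moment of a summand is at most \<open>a A\<close>, while its norm is only bounded by \<open>A\<close>. Therefore
  a sample size that is proportional to \<open>A\<^sup>2 / \<epsilon>\<^sup>2\<close> gives a deviation of order \<open>\<epsilon> sqrt (a / A)\<close>,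
  which can be much smaller than \<open>\<epsilon>\<close>. The infinite matrix is exhausted by its finite truncations, for
  which the bounds are uniform.
\<close>

lemma (in prob_space) product_feature_concentration:
  fixes f g :: "nat \<Rightarrow> 'c \<Rightarrow> real" and G :: "'c \<Rightarrow> real" and V :: "nat \<Rightarrow> 'a \<Rightarrow> 'c"
  assumes law: "\<And>j. j < m \<Longrightarrow> distr M K (V j) = P" and indep: "indep_vars (\<lambda>_. K) V {..<m}"
    and m: "0 < m"
    and f: "\<And>j. f j \<in> borel_measurable P" and g: "\<And>j. g j \<in> borel_measurable P"
    and fG: "\<And>n x. x \<in> space P \<Longrightarrow> (\<Sum>j<n. (f j x)\<^sup>2) \<le> G x"
    and gA: "\<And>n x. x \<in> space P \<Longrightarrow> (\<Sum>j<n. (g j x)\<^sup>2) \<le> A"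
    and GA: "\<And>x. x \<in> space P \<Longrightarrow> G x \<le> A"
    and G: "integrable P G" "integral\<^sup>L P G \<le> a"
    and a: "0 < a" "a \<le> A"
    and \<epsilon>: "0 < \<epsilon>" "2 * \<epsilon> \<le> a" and \<delta>: "0 < \<delta>"
    and mm: "8 * A\<^sup>2 * ln (4 / \<delta>) / \<epsilon>\<^sup>2 \<le> real m"
  defines "\<eta> \<equiv> 3/5 * \<epsilon> * sqrt (a / A)"
  shows "prob {\<omega> \<in> space M. \<exists>n. \<eta>\<^sup>2 \<le> (\<Sum>j<n. \<Sum>l<n.
      ((\<Sum>i<m. f j (V i \<omega>) * g l (V i \<omega>)) / real m - integral\<^sup>L P (\<lambda>x. f j x * g l x))\<^sup>2)} \<le> \<delta> / 2"
proof -
  have rv: "V j \<in> measurable M K" if "j < m" for j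
    using indep that by (auto simp: indep_vars_def)
  interpret P: prob_space P
    using prob_space_distr[OF rv[OF m]] law[OF m] by simp
  have sets_P: "sets P = sets K" using law[OF m] by auto
  have A: "0 < A" using a by simp
  have \<eta>: "0 < \<eta>" using \<epsilon> a A by (simp add: \<eta>_def)
  have \<eta>2: "\<eta>\<^sup>2 = 9/25 * \<epsilon>\<^sup>2 * a / A" using a A unfolding \<eta>_def power_mult_distrib
    by (subst real_sqrt_pow2) (auto simp: power2_eq_square)
  note [measurable] = f g
  have f1: "(f j x)\<^sup>2 \<le> A" if "x \<in> space P" for j x
    using fG[OF that, of "Suc j"] GA[OF that] sum_nonneg[of "{..<j}" "\<lambda>j. (f j x)\<^sup>2"] by simp
  have g1: "(g j x)\<^sup>2 \<le> A" if "x \<in> space P" for j x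
    using gA[OF that, of "Suc j"] sum_nonneg[of "{..<j}" "\<lambda>j. (g j x)\<^sup>2"] by simp
  have fg1: "(f j x * g l x)\<^sup>2 \<le> A\<^sup>2" if "x \<in> space P" for j l x
    using mult_mono[OF f1[OF that, of j] g1[OF that, of l]] A
    by (simp add: power_mult_distrib power2_eq_square[of A])
  have fg1': "\<bar>f j x * g l x\<bar> \<le> A" if "x \<in> space P" for j l x
    using fg1[OF that, of j l] A abs_le_square_iff[of "f j x * g l x" A] by simp
  have ifg: "integrable P (\<lambda>x. f j x * g l x)" for j l
    using fg1' by (intro P.integrable_const_bound[of _ A]) auto
  have ifg2: "integrable P (\<lambda>x. (f j x * g l x)\<^sup>2)" for j l
    using fg1 A by (intro P.integrable_const_bound[of _ "A\<^sup>2"]) auto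
  define \<mu> where "\<mu> j l = integral\<^sup>L P (\<lambda>x. f j x * g l x)" for j l
  have var1: "P.expectation (\<lambda>x. (f j x * g l x - \<mu> j l)\<^sup>2)
      = P.expectation (\<lambda>x. (f j x * g l x)\<^sup>2) - (\<mu> j l)\<^sup>2" for j l
    unfolding \<mu>_def by (rule P.variance_eq[OF ifg ifg2])
  define E where "E n = {\<omega> \<in> space M. \<eta>\<^sup>2 \<le> (\<Sum>j<n. \<Sum>l<n.
      ((\<Sum>i<m. f j (V i \<omega>) * g l (V i \<omega>)) / real m - \<mu> j l)\<^sup>2)}" for n
  have fK: "f j \<in> borel_measurable K" and gK: "g j \<in> borel_measurable K" for j
    using f[of j] g[of j] sets_P by (simp_all cong: measurable_cong_sets)
  have [measurable]: "(\<lambda>\<omega>. f j (V i \<omega>)) \<in> borel_measurable M" 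
     "(\<lambda>\<omega>. g j (V i \<omega>)) \<in> borel_measurable M" if "i < m" for i j
    using fK gK by (auto intro!: measurable_compose[OF rv[OF that]])
  have E_sets: "E n \<in> events" for n unfolding E_def by measurable
  have E_prob: "prob (E n) \<le> \<delta> / 2" for n
  proof -
    define I where "I = {..<n} \<times> {..<n}"
    define Z where "Z = (\<lambda>(j, l) x. f j x * g l x - \<mu> j l)"
    have I: "finite I" by (simp add: I_def)
    have sum2: "(\<Sum>i\<in>I. (case i of (j, l) \<Rightarrow> (f j x * g l x)\<^sup>2)) \<le> G x * A" if "x \<in> space P" for x
    proof -
      have "(\<Sum>i\<in>I. (case i of (j, l) \<Rightarrow> (f j x * g l x)\<^sup>2)) = (\<Sum>j<n. (f j x)\<^sup>2) * (\<Sum>l<n. (g l x)\<^sup>2)"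
        by (simp add: I_def sum.cartesian_product[symmetric] sum_product power_mult_distrib)
      also have "\<dots> \<le> G x * A"
        using fG[OF that] gA[OF that] order_trans[OF sum_nonneg fG[OF that, of 0]]
        by (intro mult_mono) (auto intro: sum_nonneg)
      finally show ?thesis .
    qed
    have mom2: "(\<Sum>(j, l)\<in>I. P.expectation (\<lambda>x. (f j x * g l x)\<^sup>2)) \<le> a * A"
    proof -
      have "(\<Sum>(j, l)\<in>I. P.expectation (\<lambda>x. (f j x * g l x)\<^sup>2))
          = P.expectation (\<lambda>x. \<Sum>i\<in>I. (case i of (j, l) \<Rightarrow> (f j x * g l x)\<^sup>2))"
        by (subst Bochner_Integration.integral_sum) (auto simp: ifg2 split_beta)
      also have "\<dots> \<le> P.expectation (\<lambda>x. G x * A)"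
        using sum2 G by (intro integral_mono) (auto simp: ifg2 split_beta)
      also have "\<dots> \<le> a * A" using G A by simp
      finally show ?thesis .
    qed
    have var_nonneg: "0 \<le> P.expectation (\<lambda>x. (f j x * g l x)\<^sup>2) - (\<mu> j l)\<^sup>2" for j l
      unfolding var1[symmetric] by simp
    have m2: "(\<Sum>(j, l)\<in>I. (\<mu> j l)\<^sup>2) \<le> A * A"
    proof -
      have "(\<Sum>(j, l)\<in>I. (\<mu> j l)\<^sup>2) \<le> (\<Sum>(j, l)\<in>I. P.expectation (\<lambda>x. (f j x * g l x)\<^sup>2))"
        using var_nonneg by (intro sum_mono) auto
      also have "\<dots> \<le> A * A" using mom2 a A by (meson mult_right_mono less_imp_le order_trans)
      finally show ?thesis .
    qed
    \<comment> \<open>the minimizer of the exponent in the tail bound for the second moment \<open>a A\<close>\<close>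
    define \<kappa> where "\<kappa> = \<eta> / (36/25 * (a * A))"
    have "prob {\<omega> \<in> space M. real m * \<eta> \<le> sqrt (\<Sum>i\<in>I. (\<Sum>j<m. Z i (V j \<omega>))\<^sup>2)}
      \<le> 2 * exp (real m * (18/25 * \<kappa>\<^sup>2 * (a * A)) - \<kappa> * (real m * \<eta>))"
    proof (rule iid_sum_norm_tail[OF law indep m I])
      show "Z i \<in> borel_measurable P" for i by (auto simp: Z_def split_beta)
      show "integral\<^sup>L P (Z i) = 0" for i
        by (simp add: Z_def split_beta ifg \<mu>_def P.prob_space)
      show "(\<Sum>i\<in>I. (Z i x)\<^sup>2) \<le> (2 * A)\<^sup>2" if "x \<in> space P" for x
      proof -
        have "(\<Sum>i\<in>I. (Z i x)\<^sup>2) \<le> (\<Sum>i\<in>I. 2 * (case i of (j, l) \<Rightarrow> (f j x * g l x)\<^sup>2)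
            + 2 * (case i of (j, l) \<Rightarrow> (\<mu> j l)\<^sup>2))"
        proof (intro sum_mono)
          have *: "(p - q)\<^sup>2 \<le> 2 * p\<^sup>2 + 2 * q\<^sup>2" for p q :: real
            using zero_le_power2[of "p + q"] by (simp add: power2_eq_square algebra_simps)
          fix i show "(Z i x)\<^sup>2 \<le> 2 * (case i of (j, l) \<Rightarrow> (f j x * g l x)\<^sup>2)
            + 2 * (case i of (j, l) \<Rightarrow> (\<mu> j l)\<^sup>2)" by (auto simp: Z_def split_beta *)
        qed
        also have "\<dots> \<le> 2 * (A * A) + 2 * (A * A)"
          unfolding sum.distrib sum_distrib_left[symmetric]
          using order_trans[OF sum2[OF that] mult_right_mono[OF GA[OF that], of A]] m2 A
          by (intro add_mono mult_left_mono) auto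
        finally show ?thesis by (simp add: power2_eq_square)
      qed
      have "P.expectation (\<lambda>x. \<Sum>i\<in>I. (Z i x)\<^sup>2)
          = (\<Sum>(j, l)\<in>I. P.expectation (\<lambda>x. (f j x * g l x - \<mu> j l)\<^sup>2))"
        by (subst Bochner_Integration.integral_sum)
          (auto simp: Z_def split_beta power2_diff intro!: ifg ifg2 sum.cong Bochner_Integration.integrable_add Bochner_Integration.integrable_diff)
      also have "\<dots> \<le> (\<Sum>(j, l)\<in>I. P.expectation (\<lambda>x. (f j x * g l x)\<^sup>2))"
        by (intro sum_mono) (auto simp: var1)
      finally show "P.expectation (\<lambda>x. \<Sum>i\<in>I. (Z i x)\<^sup>2) \<le> a * A" using mom2 by linarith
      show "0 \<le> \<kappa>" using \<eta> a A by (simp add: \<kappa>_def)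
      have "sqrt (a / A) \<le> 1" using a A by simp
      then have "\<eta> \<le> 3/5 * \<epsilon>" unfolding \<eta>_def using \<epsilon> by (simp add: mult_left_le)
      then have "\<eta> \<le> 3/10 * a" using \<epsilon> by simp
      then have "\<eta> / a \<le> 3/10" using a by (simp add: divide_le_eq)
      moreover have "\<kappa> * (2 * A) = 25/18 * (\<eta> / a)"
        using A by (simp add: \<kappa>_def)
      ultimately show "\<kappa> * (2 * A) \<le> 5/12" by linarith
    qed (use a A in auto)
    also have "real m * (18/25 * \<kappa>\<^sup>2 * (a * A)) - \<kappa> * (real m * \<eta>) = - (real m * \<epsilon>\<^sup>2 / (8 * A\<^sup>2))"
    proof -
      have k: "\<kappa> * (a * A) = 25/36 * \<eta>" using a A by (simp add: \<kappa>_def)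
      have "real m * (18/25 * \<kappa>\<^sup>2 * (a * A)) - \<kappa> * (real m * \<eta>)
          = real m * \<kappa> * (18/25 * (\<kappa> * (a * A)) - \<eta>)"
        by (simp add: power2_eq_square algebra_simps)
      also have "\<dots> = - (25/72) * real m * (\<eta>\<^sup>2 / (a * A))"
        unfolding k by (simp add: \<kappa>_def power2_eq_square)
      also have "\<dots> = - (real m * \<epsilon>\<^sup>2 / (8 * A\<^sup>2))"
        unfolding \<eta>2 using a A by (simp add: power2_eq_square)
      finally show ?thesis .
    qed
    also have "2 * exp (- (real m * \<epsilon>\<^sup>2 / (8 * A\<^sup>2))) \<le> 2 * exp (- ln (4 / \<delta>))"
    proof -
      have "ln (4 / \<delta>) \<le> real m * \<epsilon>\<^sup>2 / (8 * A\<^sup>2)"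
        using mm \<epsilon> A by (simp add: field_simps)
      then show ?thesis by simp
    qed
    also have "2 * exp (- ln (4 / \<delta>)) = \<delta> / 2" using \<delta> by (simp add: exp_minus)
    also have "{\<omega> \<in> space M. real m * \<eta> \<le> sqrt (\<Sum>i\<in>I. (\<Sum>j<m. Z i (V j \<omega>))\<^sup>2)} = E n"
    proof -
      have Zs: "(\<Sum>j<m. Z (p, q) (V j \<omega>)) = real m * ((\<Sum>i<m. f p (V i \<omega>) * g q (V i \<omega>)) / real m - \<mu> p q)"
        for p q \<omega> using m by (simp add: Z_def sum_subtractf field_simps)
      have "(\<Sum>i\<in>I. (\<Sum>j<m. Z i (V j \<omega>))\<^sup>2) = (real m)\<^sup>2 * (\<Sum>j<n. \<Sum>l<n.
          ((\<Sum>i<m. f j (V i \<omega>) * g l (V i \<omega>)) / real m - \<mu> j l)\<^sup>2)" for \<omega>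
        unfolding I_def sum_distrib_left sum.cartesian_product
        by (intro sum.cong refl) (auto simp: Zs power_mult_distrib)
      then have "real m * \<eta> \<le> sqrt (\<Sum>i\<in>I. (\<Sum>j<m. Z i (V j \<omega>))\<^sup>2) \<longleftrightarrow>
          \<eta> \<le> sqrt (\<Sum>j<n. \<Sum>l<n. ((\<Sum>i<m. f j (V i \<omega>) * g l (V i \<omega>)) / real m - \<mu> j l)\<^sup>2)" for \<omega>
        using m by (simp add: real_sqrt_mult)
      moreover have "\<eta> \<le> sqrt y \<longleftrightarrow> \<eta>\<^sup>2 \<le> y" for y
      proof
        assume *: "\<eta> \<le> sqrt y"
        then have "0 < sqrt y" using \<eta> by linarith
        then have "0 < y" by simp
        then show "\<eta>\<^sup>2 \<le> y" using power_mono[OF *, of 2] \<eta> by simp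
      qed (auto intro: real_le_rsqrt)
      ultimately show ?thesis unfolding E_def by auto
    qed
    finally show ?thesis .
  qed
  \<comment> \<open>continuity from below along the truncations\<close>
  have "incseq E"
  proof (rule incseq_SucI, unfold E_def, safe)
    fix n \<omega>
    let ?h = "\<lambda>j l. ((\<Sum>i<m. f j (V i \<omega>) * g l (V i \<omega>)) / real m - \<mu> j l)\<^sup>2"
    assume *: "\<eta>\<^sup>2 \<le> (\<Sum>j<n. \<Sum>l<n. ?h j l)"
    have "(\<Sum>j<n. \<Sum>l<n. ?h j l) \<le> (\<Sum>j<Suc n. \<Sum>l<Suc n. ?h j l)"
      by (simp add: sum.distrib sum_nonneg add_nonneg_nonneg)
    with * show "\<eta>\<^sup>2 \<le> (\<Sum>j<Suc n. \<Sum>l<Suc n. ?h j l)" by linarith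
  qed
  then have "(\<lambda>n. prob (E n)) \<longlonglongrightarrow> prob (\<Union>n. E n)"
    using E_sets by (intro finite_Lim_measure_incseq) auto
  then have "prob (\<Union>n. E n) \<le> \<delta> / 2"
    by (rule LIMSEQ_le_const2) (use E_prob in auto)
  moreover have "(\<Union>n. E n) = {\<omega> \<in> space M. \<exists>n. \<eta>\<^sup>2 \<le> (\<Sum>j<n. \<Sum>l<n.
      ((\<Sum>i<m. f j (V i \<omega>) * g l (V i \<omega>)) / real m - integral\<^sup>L P (\<lambda>x. f j x * g l x))\<^sup>2)}"
    unfolding E_def \<mu>_def by auto
  ultimately show ?thesis by simp
qed

section \<open>Perturbation of truncated inverses\<close>

text \<open>
  Orthonormality of a family on an index set.
\<close>

definition orthonormal_on :: "'i set \<Rightarrow> ('i \<Rightarrow> 'a::real_inner) \<Rightarrow> bool" where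
  "orthonormal_on J f \<longleftrightarrow> (\<forall>i\<in>J. \<forall>j\<in>J. f i \<bullet> f j = (if i = j then 1 else 0))"

text \<open>
  The orthogonal projection onto the span of a family that is orthonormal on a finite index set.
\<close>

definition proj_on :: "'i set \<Rightarrow> ('i \<Rightarrow> 'a::real_inner) \<Rightarrow> 'a \<Rightarrow> 'a" where
  "proj_on J f x = (\<Sum>j\<in>J. (x \<bullet> f j) *\<^sub>R f j)"

context
  fixes J :: "'i set" and f :: "'i \<Rightarrow> 'a::real_inner"
  assumes J: "finite J" and on: "orthonormal_on J f"
begin

lemma inner_sum_orthonormal:
  assumes "i \<in> J" shows "(\<Sum>j\<in>J. c j *\<^sub>R f j) \<bullet> f i = c i"
proof -
  have "(\<Sum>j\<in>J. c j *\<^sub>R f j) \<bullet> f i = (\<Sum>j\<in>J. if j = i then c j else 0)"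
    unfolding inner_sum_left using on assms
    by (intro sum.cong) (auto simp: orthonormal_on_def)
  then show ?thesis using J assms by simp
qed

lemma norm_sum_orthonormal: "(norm (\<Sum>j\<in>J. c j *\<^sub>R f j))\<^sup>2 = (\<Sum>j\<in>J. (c j)\<^sup>2)"
  unfolding power2_norm_eq_inner
  by (subst inner_sum_right) (simp add: inner_sum_orthonormal power2_eq_square)

lemma inner_proj_on: "i \<in> J \<Longrightarrow> proj_on J f x \<bullet> f i = x \<bullet> f i"
  unfolding proj_on_def by (rule inner_sum_orthonormal)

lemma proj_on_sum: "proj_on J f (\<Sum>j\<in>J. c j *\<^sub>R f j) = (\<Sum>j\<in>J. c j *\<^sub>R f j)"
  unfolding proj_on_def by (intro sum.cong) (simp_all add: inner_sum_orthonormal)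

lemma proj_on_idem: "proj_on J f (proj_on J f x) = proj_on J f x"
  by (subst (2) proj_on_def, subst proj_on_sum) (simp add: proj_on_def)

lemma proj_on_sym: "proj_on J f x \<bullet> y = x \<bullet> proj_on J f y"
  unfolding proj_on_def inner_sum_left inner_sum_right
  by (intro sum.cong) (simp_all add: inner_commute)

lemma norm_proj_on: "(norm (proj_on J f x))\<^sup>2 = (\<Sum>j\<in>J. (x \<bullet> f j)\<^sup>2)"
  unfolding proj_on_def by (rule norm_sum_orthonormal)

lemma norm_proj_on_pythagoras: "(norm x)\<^sup>2 = (norm (proj_on J f x))\<^sup>2 + (norm (x - proj_on J f x))\<^sup>2"
proof -
  have "proj_on J f x \<bullet> (x - proj_on J f x) = 0"
    using proj_on_sym[of "proj_on J f x" x] inner_commute[of x "proj_on J f x"]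
    unfolding inner_diff_right proj_on_idem by linarith
  then have "(norm (proj_on J f x + (x - proj_on J f x)))\<^sup>2
      = (norm (proj_on J f x))\<^sup>2 + (norm (x - proj_on J f x))\<^sup>2"
    by (intro norm_add_Pythagorean) (simp add: orthogonal_def)
  then show ?thesis by simp
qed

lemma norm_proj_on_le: "norm (proj_on J f x) \<le> norm x"
  using norm_proj_on_pythagoras[of x] by (simp add: power2_le_imp_le)

lemma norm_diff_proj_on_le: "norm (x - proj_on J f x) \<le> norm x"
  using norm_proj_on_pythagoras[of x] by (simp add: power2_le_imp_le)

lemma inner_diff_proj_on: "i \<in> J \<Longrightarrow> (x - proj_on J f x) \<bullet> f i = 0"
  by (simp add: inner_diff_left inner_proj_on)

end

lemma proj_on_diff: "proj_on J f (x - y) = proj_on J f x - proj_on J f y"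
  by (simp add: proj_on_def inner_diff_left scaleR_diff_left sum_subtractf)

lemma proj_on_add: "proj_on J f (x + y) = proj_on J f x + proj_on J f y"
  by (simp add: proj_on_def inner_add_left scaleR_add_left sum.distrib)

lemma linear_diff_proj_on: "linear (\<lambda>x. x - proj_on J f x)"
proof (rule linearI)
  show "x + y - proj_on J f (x + y) = x - proj_on J f x + (y - proj_on J f y)" for x y
    by (simp add: proj_on_add)
  show "c *\<^sub>R x - proj_on J f (c *\<^sub>R x) = c *\<^sub>R (x - proj_on J f x)" for c x
    by (simp add: proj_on_def scaleR_diff_right scaleR_sum_right)
qed

lemma proj_on_commute:
  fixes A :: "'a::real_inner \<Rightarrow> 'a"
  assumes "linear A" and sym: "\<And>x y. A x \<bullet> y = x \<bullet> A y"
    and eig: "\<And>j. j \<in> J \<Longrightarrow> A (f j) = a j *\<^sub>R f j"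
  shows "proj_on J f (A x) = A (proj_on J f x)"
  unfolding proj_on_def linear_sum[OF assms(1)]
  by (intro sum.cong refl) (simp add: sym eig linear_scale[OF assms(1)])

lemma eigen_sum_inner:
  fixes A :: "'a::real_inner \<Rightarrow> 'a"
  assumes "finite J" "orthonormal_on J f" "linear A"
    and eig: "\<And>j. j \<in> J \<Longrightarrow> A (f j) = a j *\<^sub>R f j"
  shows "(\<Sum>j\<in>J. c j *\<^sub>R f j) \<bullet> A (\<Sum>j\<in>J. c j *\<^sub>R f j) = (\<Sum>j\<in>J. a j * (c j)\<^sup>2)"
proof -
  have "A (\<Sum>j\<in>J. c j *\<^sub>R f j) = (\<Sum>j\<in>J. (c j * a j) *\<^sub>R f j)"
    unfolding linear_sum[OF assms(3)] by (intro sum.cong) (simp_all add: eig linear_scale[OF assms(3)])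
  then show ?thesis
    by (simp add: inner_sum_right inner_sum_orthonormal[OF assms(1,2)] power2_eq_square mult_ac)
qed

text \<open>
  A one-sided version of the Davis-Kahan theorem. The spectral subspace of \<open>A\<close> for the eigenvalues
  \<open>\<ge> \<alpha>\<close> is nearly annihilated by a contraction \<open>Q\<close> that commutes with \<open>B\<close> and on whose range
  \<open>B\<close> is bounded by \<open>\<beta> < \<alpha>\<close>.
\<close>

lemma sin_theta_bound:
  fixes A B Q :: "'a::real_inner \<Rightarrow> 'a"
  assumes J: "finite J" and on: "orthonormal_on J f" and A: "linear A"
    and eig: "\<And>j. j \<in> J \<Longrightarrow> A (f j) = a j *\<^sub>R f j" and a: "\<And>j. j \<in> J \<Longrightarrow> \<alpha> \<le> a j"
    and B: "\<And>x. Q (B x) = B (Q x)" "\<And>x. norm (B (Q x)) \<le> \<beta> * norm (Q x)"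
    and Q: "linear Q" "\<And>x. norm (Q x) \<le> norm x"
    and AB: "\<And>x. norm (A x - B x) \<le> \<epsilon> * norm x"
    and \<beta>: "0 \<le> \<beta>" "\<beta> < \<alpha>" and \<epsilon>: "0 \<le> \<epsilon>"
    and x: "proj_on J f x = x"
  shows "norm (Q x) \<le> \<epsilon> / (\<alpha> - \<beta>) * norm x"
proof -
  have \<alpha>: "0 < \<alpha>" using \<beta> by simp
  \<comment> \<open>writing \<open>x = A g\<close> turns a bound \<open>s\<close> for \<open>Q\<close> on the subspace into the bound \<open>(\<beta> s + \<epsilon>) / \<alpha>\<close>, starting from \<open>s = 1\<close>\<close>
  have step: "norm (Q x) \<le> ((\<beta> / \<alpha>) ^ n + \<epsilon> / (\<alpha> - \<beta>)) * norm x" if "proj_on J f x = x" for x n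
    using that
  proof (induction n arbitrary: x)
    case 0
    have "norm (Q x) \<le> 1 * norm x" using Q by simp
    also have "\<dots> \<le> (1 + \<epsilon> / (\<alpha> - \<beta>)) * norm x" using \<epsilon> \<beta> by (intro mult_right_mono) auto
    finally show ?case by simp
  next
    case (Suc n)
    define g where "g = (\<Sum>j\<in>J. ((x \<bullet> f j) / a j) *\<^sub>R f j)"
    have Pg: "proj_on J f g = g" unfolding g_def by (rule proj_on_sum[OF J on])
    have a0: "0 < a j" if "j \<in> J" for j using a[OF that] \<alpha> by simp
    have "A g = (\<Sum>j\<in>J. (x \<bullet> f j) *\<^sub>R f j)"
      unfolding g_def linear_sum[OF A]
    proof (rule sum.cong[OF refl])
      fix j assume "j \<in> J"
      then show "A (((x \<bullet> f j) / a j) *\<^sub>R f j) = (x \<bullet> f j) *\<^sub>R f j"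
        using a0[of j] by (simp add: linear_scale[OF A] eig)
    qed
    then have Ag: "A g = x" using Suc.prems by (simp add: proj_on_def)
    have "(norm g)\<^sup>2 = (\<Sum>j\<in>J. ((x \<bullet> f j) / a j)\<^sup>2)"
      unfolding g_def by (rule norm_sum_orthonormal[OF J on])
    also have "\<dots> \<le> (\<Sum>j\<in>J. (x \<bullet> f j)\<^sup>2 / \<alpha>\<^sup>2)"
    proof (rule sum_mono)
      fix j assume "j \<in> J"
      then have "0 < a j" "\<alpha>\<^sup>2 \<le> (a j)\<^sup>2" using a0 a \<alpha> by (auto intro: power_mono)
      then show "((x \<bullet> f j) / a j)\<^sup>2 \<le> (x \<bullet> f j)\<^sup>2 / \<alpha>\<^sup>2"
        unfolding power_divide using \<alpha> by (intro divide_left_mono) auto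
    qed
    also have "\<dots> = (norm x / \<alpha>)\<^sup>2"
    proof -
      have "(norm x)\<^sup>2 = (\<Sum>j\<in>J. (x \<bullet> f j)\<^sup>2)"
        using norm_proj_on[OF J on, of x] unfolding Suc.prems .
      then show ?thesis unfolding sum_divide_distrib[symmetric] power_divide by (simp only:)
    qed
    finally have ng: "norm g \<le> norm x / \<alpha>" by (rule power2_le_imp_le) (use \<alpha> in simp)
    have "Q x = B (Q g) + Q (A g - B g)"
      using Ag by (simp add: linear_diff[OF Q(1)] B(1))
    then have "norm (Q x) \<le> norm (B (Q g)) + norm (Q (A g - B g))"
      by (simp only: norm_triangle_ineq)
    also have "\<dots> \<le> \<beta> * norm (Q g) + \<epsilon> * norm g"
      by (intro add_mono B(2) order_trans[OF Q(2) AB])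
    also have "\<dots> \<le> \<beta> * (((\<beta> / \<alpha>) ^ n + \<epsilon> / (\<alpha> - \<beta>)) * norm g) + \<epsilon> * norm g"
      using Suc.IH[OF Pg] \<beta> by (intro add_right_mono mult_left_mono) auto
    also have "\<dots> = (\<beta> * ((\<beta> / \<alpha>) ^ n + \<epsilon> / (\<alpha> - \<beta>)) + \<epsilon>) * norm g"
      by (simp add: algebra_simps)
    also have "\<dots> \<le> (\<beta> * ((\<beta> / \<alpha>) ^ n + \<epsilon> / (\<alpha> - \<beta>)) + \<epsilon>) * (norm x / \<alpha>)"
      using ng \<beta> \<epsilon> \<alpha> by (intro mult_left_mono) auto
    also have "\<dots> = ((\<beta> / \<alpha>) ^ Suc n + \<epsilon> / (\<alpha> - \<beta>)) * norm x"
    proof -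
      have "(\<beta> * (\<epsilon> / (\<alpha> - \<beta>)) + \<epsilon>) / \<alpha> = \<epsilon> / (\<alpha> - \<beta>)"
      proof -
        define c where "c = \<epsilon> / (\<alpha> - \<beta>)"
        have "\<epsilon> = c * (\<alpha> - \<beta>)" using \<beta> by (simp add: c_def)
        then have "\<beta> * c + \<epsilon> = \<alpha> * c" by (simp add: algebra_simps)
        then show ?thesis unfolding c_def[symmetric] using \<alpha> by simp
      qed
      moreover have "(\<beta> * ((\<beta> / \<alpha>) ^ n + \<epsilon> / (\<alpha> - \<beta>)) + \<epsilon>) * (norm x / \<alpha>)
          = (\<beta> / \<alpha> * (\<beta> / \<alpha>) ^ n + (\<beta> * (\<epsilon> / (\<alpha> - \<beta>)) + \<epsilon>) / \<alpha>) * norm x"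
        by (simp add: add_divide_distrib distrib_left distrib_right)
      ultimately show ?thesis by simp
    qed
    finally show ?case .
  qed
  have "(\<lambda>n. ((\<beta> / \<alpha>) ^ n + \<epsilon> / (\<alpha> - \<beta>)) * norm x) \<longlonglongrightarrow> (0 + \<epsilon> / (\<alpha> - \<beta>)) * norm x"
    using \<beta> \<alpha> by (intro tendsto_intros LIMSEQ_power_zero) auto
  then show ?thesis
    using step[OF x] by (intro LIMSEQ_le_const) auto
qed

text \<open>
  A homogeneous system of \<open>n\<close> linear equations in \<open>n + 1\<close> unknowns has a nontrivial solution.
\<close>

lemma exists_nontrivial_solution:
  fixes a :: "nat \<Rightarrow> nat \<Rightarrow> real"
  shows "\<exists>c. (\<exists>j\<le>n. c j \<noteq> 0) \<and> (\<forall>i<n. (\<Sum>j\<le>n. c j * a i j) = 0)"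
proof (induction n arbitrary: a)
  case 0
  show ?case by (intro exI[of _ "\<lambda>_. 1"]) auto
next
  case (Suc n)
  show ?case
  proof (cases "\<forall>i\<le>n. a i (Suc n) = 0")
    case True
    have "(\<Sum>j\<le>Suc n. (if j = Suc n then 1 else 0) * a i j) = 0" if "i < Suc n" for i
      using True that by (simp add: if_distrib[of "\<lambda>x. x * _"] cong: if_cong)
    then show ?thesis by (intro exI[of _ "\<lambda>j. if j = Suc n then 1 else 0"]) auto
  next
    case False
    then obtain p where p: "p \<le> n" "a p (Suc n) \<noteq> 0" by auto
    \<comment> \<open>equation \<open>p\<close> is used to eliminate the last unknown; \<open>s\<close> enumerates the other equations\<close>
    define s where "s i = (if i < p then i else Suc i)" for i
    define b where "b i j = a (s i) j - a (s i) (Suc n) / a p (Suc n) * a p j" for i j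
    obtain c where c: "\<exists>j\<le>n. c j \<noteq> 0" "\<forall>i<n. (\<Sum>j\<le>n. c j * b i j) = 0"
      using Suc.IH[of b] by blast
    define d where "d j = (if j = Suc n then - (\<Sum>j\<le>n. c j * a p j) / a p (Suc n) else c j)" for j
    have sum_d: "(\<Sum>j\<le>Suc n. d j * a i j)
        = (\<Sum>j\<le>n. c j * a i j) - (\<Sum>j\<le>n. c j * a p j) / a p (Suc n) * a i (Suc n)" for i
    proof -
      have "(\<Sum>j\<le>n. d j * a i j) = (\<Sum>j\<le>n. c j * a i j)" by (intro sum.cong) (auto simp: d_def)
      then show ?thesis by (simp add: d_def)
    qed
    have "(\<Sum>j\<le>Suc n. d j * a i j) = 0" if i: "i < Suc n" for i
    proof (cases "i = p")
      case True then show ?thesis unfolding sum_d using p by simp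
    next
      case False
      define i' where "i' = (if i < p then i else i - 1)"
      have "i' < n" "s i' = i" using False i p by (auto simp: i'_def s_def)
      then have "0 = (\<Sum>j\<le>n. c j * (a i j - a i (Suc n) / a p (Suc n) * a p j))"
        using c(2) by (auto simp: b_def)
      also have "\<dots> = (\<Sum>j\<le>n. c j * a i j) - (\<Sum>j\<le>n. a i (Suc n) / a p (Suc n) * (c j * a p j))"
        unfolding sum_subtractf[symmetric] by (intro sum.cong) (auto simp: algebra_simps)
      also have "\<dots> = (\<Sum>j\<le>Suc n. d j * a i j)"
        unfolding sum_d sum_distrib_left[symmetric] by simp
      finally show ?thesis by simp
    qed
    moreover have "\<exists>j\<le>Suc n. d j \<noteq> 0"
    proof -
      obtain j where "j \<le> n" "c j \<noteq> 0" using c(1) by blast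
      then show ?thesis by (intro exI[of _ j]) (auto simp: d_def)
    qed
    ultimately show ?thesis by blast
  qed
qed

lemma common_convergent_subsequence:
  fixes x :: "nat \<Rightarrow> nat \<Rightarrow> real"
  assumes "\<And>i. i < m \<Longrightarrow> bounded (range (x i))"
  shows "\<exists>s. strict_mono s \<and> (\<forall>i<m. \<exists>c. (\<lambda>n. x i (s n)) \<longlonglongrightarrow> c)"
  using assms
proof (induction m)
  case 0
  show ?case by (intro exI[of _ id]) (auto simp: strict_mono_def)
next
  case (Suc m)
  then obtain s where s: "strict_mono s" "\<forall>i<m. \<exists>c. (\<lambda>n. x i (s n)) \<longlonglongrightarrow> c" by auto
  have "bounded (range (\<lambda>n. x m (s n)))"
    by (rule bounded_subset[OF Suc.prems[of m]]) auto
  then obtain l t where t: "strict_mono t" "((\<lambda>n. x m (s n)) \<circ> t) \<longlonglongrightarrow> l"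
    using bounded_imp_convergent_subsequence by blast
  have "\<exists>c. (\<lambda>n. x i ((s \<circ> t) n)) \<longlonglongrightarrow> c" if "i < Suc m" for i
  proof (cases "i = m")
    case True then show ?thesis using t by (auto simp: o_def)
  next
    case False
    then have "i < m" using that by simp
    then obtain c where "(\<lambda>n. x i (s n)) \<longlonglongrightarrow> c" using s(2) by blast
    from LIMSEQ_subseq_LIMSEQ[OF this t(1)] show ?thesis by (auto simp: o_def)
  qed
  with strict_mono_o[OF s(1) t(1)] show ?case by blast
qed

text \<open>
  The operator \<open>(1/m) \<Sum> w\<^sub>i \<otimes> w\<^sub>i\<close>, summed over \<open>i < m\<close>.
\<close>

definition emp_op :: "nat \<Rightarrow> (nat \<Rightarrow> 'a) \<Rightarrow> 'a \<Rightarrow> 'a::real_inner" where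
  "emp_op m w x = (1 / real m) *\<^sub>R (\<Sum>i<m. (x \<bullet> w i) *\<^sub>R w i)"

lemma linear_emp_op: "linear (emp_op m w)"
  by (intro linearI) (simp_all add: emp_op_def inner_add_left scaleR_add_left sum.distrib scaleR_add_right
      scaleR_sum_right mult_ac)

lemma inner_emp_op: "emp_op m w x \<bullet> y = (1 / real m) * (\<Sum>i<m. (x \<bullet> w i) * (y \<bullet> w i))"
  by (simp add: emp_op_def inner_sum_left inner_commute[of "w _" y])

lemma emp_op_sym: "emp_op m w x \<bullet> y = x \<bullet> emp_op m w y"
  unfolding inner_commute[of x] inner_emp_op by (simp add: mult.commute)

lemma emp_op_nonneg: "0 \<le> emp_op m w x \<bullet> x"
  by (simp add: inner_emp_op sum_nonneg)

lemma emp_op_Cauchy_Schwarz: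
  "(emp_op m w x \<bullet> y)\<^sup>2 \<le> (emp_op m w x \<bullet> x) * (emp_op m w y \<bullet> y)"
proof -
  have "(\<Sum>i<m. (x \<bullet> w i) * (y \<bullet> w i))\<^sup>2 \<le> (\<Sum>i<m. (x \<bullet> w i)\<^sup>2) * (\<Sum>i<m. (y \<bullet> w i)\<^sup>2)"
    by (rule Cauchy_Schwarz_ineq_sum)
  then have "(1 / real m)\<^sup>2 * (\<Sum>i<m. (x \<bullet> w i) * (y \<bullet> w i))\<^sup>2
     \<le> (1 / real m)\<^sup>2 * ((\<Sum>i<m. (x \<bullet> w i)\<^sup>2) * (\<Sum>i<m. (y \<bullet> w i)\<^sup>2))"
    by (intro mult_left_mono) auto
  then show ?thesis unfolding inner_emp_op by (simp add: power2_eq_square mult_ac)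
qed

text \<open>
  On an invariant set, a bound for the quadratic form of this positive operator bounds its norm.
\<close>

lemma emp_op_norm_le:
  assumes V: "\<And>x. x \<in> V \<Longrightarrow> emp_op m w x \<bullet> x \<le> \<kappa> * (norm x)\<^sup>2"
    and x: "x \<in> V" "emp_op m w x \<in> V" and "0 \<le> \<kappa>"
  shows "norm (emp_op m w x) \<le> \<kappa> * norm x"
proof (cases "emp_op m w x = 0")
  case True then show ?thesis using assms by simp
next
  case False
  define z where "z = emp_op m w x"
  have "((norm z)\<^sup>2)\<^sup>2 \<le> (emp_op m w x \<bullet> x) * (emp_op m w z \<bullet> z)"
    using emp_op_Cauchy_Schwarz[of m w x z] by (simp add: z_def power2_norm_eq_inner)
  also have "\<dots> \<le> (\<kappa> * (norm x)\<^sup>2) * (\<kappa> * (norm z)\<^sup>2)"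
    using V x assms emp_op_nonneg by (intro mult_mono) (auto simp: z_def)
  finally have "(norm z)\<^sup>2 * (norm z)\<^sup>2 \<le> (\<kappa> * norm x)\<^sup>2 * (norm z)\<^sup>2"
    by (simp add: power2_eq_square mult_ac)
  then have "(norm z)\<^sup>2 \<le> (\<kappa> * norm x)\<^sup>2"
    by (rule mult_right_le_imp_le) (use False in \<open>simp add: z_def\<close>)
  then have "norm z \<le> \<kappa> * norm x" by (rule power2_le_imp_le) (use assms in simp)
  then show ?thesis by (simp add: z_def)
qed


lemma continuous_emp_op: "(f \<longlongrightarrow> x) F \<Longrightarrow> ((\<lambda>n. emp_op m w (f n)) \<longlongrightarrow> emp_op m w x) F"
  unfolding emp_op_def by (intro tendsto_intros)

text \<open>
  The supremum of the quadratic form over the unit ball of a closed invariant subspace is an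
  eigenvalue, unless it is zero. The space need not be complete: as the operator has finite rank, the
  images of a maximizing sequence have a convergent subsequence.
\<close>

lemma emp_op_max_eigenvector:
  fixes w :: "nat \<Rightarrow> 'a::real_inner"
  assumes sym: "\<And>x. x \<in> V \<Longrightarrow> emp_op m w x \<in> V" and zero: "0 \<in> V"
    and scale: "\<And>c x. x \<in> V \<Longrightarrow> c *\<^sub>R x \<in> V"
    and closed: "closed V"
  obtains \<kappa> where "0 \<le> \<kappa>" "\<And>x. x \<in> V \<Longrightarrow> emp_op m w x \<bullet> x \<le> \<kappa> * (norm x)\<^sup>2"
    "\<kappa> = 0 \<or> (\<exists>u\<in>V. u \<noteq> 0 \<and> emp_op m w u = \<kappa> *\<^sub>R u)"
proof -
  let ?A = "emp_op m w"
  define q where "q x = ?A x \<bullet> x" for x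
  define R where "R = q ` {x \<in> V. norm x \<le> 1}"
  have q_le: "q x \<le> (1 / real m) * (\<Sum>i<m. (norm (w i))\<^sup>2)" if "norm x \<le> 1" for x
  proof -
    have "(x \<bullet> w i) * (x \<bullet> w i) \<le> (norm (w i))\<^sup>2" for i
    proof -
      have "\<bar>x \<bullet> w i\<bar> \<le> norm x * norm (w i)" by (rule Cauchy_Schwarz_ineq2)
      also have "\<dots> \<le> norm (w i)" using that by (simp add: mult_left_le_one_le)
      finally show ?thesis
        by (metis abs_norm_cancel power2_eq_square abs_le_square_iff)
    qed
    then show ?thesis unfolding q_def inner_emp_op by (intro mult_left_mono sum_mono) auto
  qed
  then have bdd: "bdd_above R" unfolding R_def by (intro bdd_aboveI2) auto
  have R0: "0 \<in> R" unfolding R_def q_def using zero by (auto intro!: image_eqI[of _ _ 0])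
  define \<kappa> where "\<kappa> = Sup R"
  have \<kappa>0: "0 \<le> \<kappa>" unfolding \<kappa>_def using R0 bdd by (rule cSup_upper)
  have \<kappa>: "q x \<le> \<kappa> * (norm x)\<^sup>2" if "x \<in> V" for x
  proof (cases "x = 0")
    case True then show ?thesis by (simp add: q_def)
  next
    case False
    have "q ((1 / norm x) *\<^sub>R x) \<le> \<kappa>" unfolding \<kappa>_def
      using False that scale by (intro cSup_upper[OF _ bdd]) (auto simp: R_def)
    moreover have "q ((1 / norm x) *\<^sub>R x) = q x / (norm x)\<^sup>2"
      by (simp add: q_def linear_scale[OF linear_emp_op] power2_eq_square)
    ultimately show ?thesis using False by (simp add: field_simps)
  qed
  have "\<kappa> = 0 \<or> (\<exists>u\<in>V. u \<noteq> 0 \<and> ?A u = \<kappa> *\<^sub>R u)"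
  proof (rule disjCI)
    assume no_eigenvector: "\<not> (\<exists>u\<in>V. u \<noteq> 0 \<and> ?A u = \<kappa> *\<^sub>R u)"
    show "\<kappa> = 0"
    proof (rule ccontr)
      assume "\<kappa> \<noteq> 0"
      then have pos: "0 < \<kappa>" using \<kappa>0 by simp
      have "\<exists>x. x \<in> V \<and> norm x \<le> 1 \<and> \<kappa> - 1 / real (Suc n) < q x" for n
        using less_cSup_iff[of R "\<kappa> - 1 / real (Suc n)"] R0 bdd unfolding \<kappa>_def R_def by auto
      then obtain x where x: "x n \<in> V" "norm (x n) \<le> 1" "\<kappa> - 1 / real (Suc n) < q (x n)" for n
        by metis
      have qx: "q (x n) \<le> \<kappa>" for n
        unfolding \<kappa>_def using x by (intro cSup_upper[OF _ bdd]) (auto simp: R_def)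
      have "(\<lambda>n. 1 / real (Suc n)) \<longlonglongrightarrow> 0" by (rule LIMSEQ_Suc[OF lim_1_over_n])
      from tendsto_diff[OF tendsto_const[of \<kappa>] this]
      have low: "(\<lambda>n. \<kappa> - 1 / real (Suc n)) \<longlonglongrightarrow> \<kappa>" by simp
      have q_lim: "(\<lambda>n. q (x n)) \<longlonglongrightarrow> \<kappa>"
      proof (rule tendsto_sandwich[OF _ _ low tendsto_const])
        show "\<forall>\<^sub>F n in sequentially. \<kappa> - 1 / real (Suc n) \<le> q (x n)"
          using less_imp_le[OF x(3)] by (rule always_eventually[OF allI])
        show "\<forall>\<^sub>F n in sequentially. q (x n) \<le> \<kappa>"
          using qx by (rule always_eventually[OF allI])
      qed
      have "bounded (range (\<lambda>n. x n \<bullet> w i))" for i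
      proof (rule boundedI)
        fix y assume "y \<in> range (\<lambda>n. x n \<bullet> w i)"
        then obtain n where "y = x n \<bullet> w i" by auto
        then have "norm y \<le> norm (x n) * norm (w i)" by (simp add: Cauchy_Schwarz_ineq2)
        also have "\<dots> \<le> norm (w i)" using x(2) by (simp add: mult_left_le_one_le)
        finally show "norm y \<le> norm (w i)" .
      qed
      then obtain s where s: "strict_mono s" "\<forall>i<m. \<exists>c. (\<lambda>n. x (s n) \<bullet> w i) \<longlonglongrightarrow> c"
        using common_convergent_subsequence[of m "\<lambda>i n. x n \<bullet> w i"] by blast
      then obtain c where c: "i < m \<Longrightarrow> (\<lambda>n. x (s n) \<bullet> w i) \<longlonglongrightarrow> c i" for i by metis
      define u where "u = (1 / real m) *\<^sub>R (\<Sum>i<m. c i *\<^sub>R w i)"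
      have Alim: "(\<lambda>n. ?A (x (s n))) \<longlonglongrightarrow> u"
        unfolding emp_op_def u_def by (intro tendsto_intros c) auto
      have q_lim': "(\<lambda>n. q (x (s n))) \<longlonglongrightarrow> \<kappa>"
        using LIMSEQ_subseq_LIMSEQ[OF q_lim s(1)] by (simp add: o_def)
      have "(norm (?A (x n) - \<kappa> *\<^sub>R x n))\<^sup>2 \<le> 2 * \<kappa>\<^sup>2 - 2 * \<kappa> * q (x n)" for n
      proof -
        have "norm (?A (x n)) \<le> \<kappa> * norm (x n)"
          using emp_op_norm_le[of V m w \<kappa> "x n"] \<kappa> sym x(1) \<kappa>0 by (auto simp: q_def)
        also have "\<dots> \<le> \<kappa>" using x(2) \<kappa>0 by (simp add: mult_left_le)
        finally have 1: "(norm (?A (x n)))\<^sup>2 \<le> \<kappa>\<^sup>2" by (intro power_mono) auto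
        have "(norm (x n))\<^sup>2 \<le> 1" using x(2) by (simp add: power_le_one)
        then have 2: "\<kappa>\<^sup>2 * (norm (x n))\<^sup>2 \<le> \<kappa>\<^sup>2" by (simp add: mult_left_le)
        have "(norm (?A (x n) - \<kappa> *\<^sub>R x n))\<^sup>2
            = (norm (?A (x n)))\<^sup>2 - 2 * \<kappa> * q (x n) + \<kappa>\<^sup>2 * (norm (x n))\<^sup>2"
          unfolding power2_norm_eq_inner q_def
          by (simp add: inner_diff_left inner_diff_right inner_commute power2_eq_square algebra_simps)
        then show ?thesis using 1 2 by linarith
      qed
      then have le: "norm (?A (x n) - \<kappa> *\<^sub>R x n) \<le> sqrt (2 * \<kappa>\<^sup>2 - 2 * \<kappa> * q (x n))" for n
        by (rule real_le_rsqrt)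
      have "(\<lambda>n. sqrt (2 * \<kappa>\<^sup>2 - 2 * \<kappa> * q (x (s n)))) \<longlonglongrightarrow> sqrt (2 * \<kappa>\<^sup>2 - 2 * \<kappa> * \<kappa>)"
        by (rule tendsto_real_sqrt[OF tendsto_diff[OF tendsto_const tendsto_mult[OF tendsto_const q_lim']]])
      then have "(\<lambda>n. sqrt (2 * \<kappa>\<^sup>2 - 2 * \<kappa> * q (x (s n)))) \<longlonglongrightarrow> 0"
        by (simp add: power2_eq_square)
      then have "(\<lambda>n. ?A (x (s n)) - \<kappa> *\<^sub>R x (s n)) \<longlonglongrightarrow> 0"
        by (rule Lim_null_comparison[OF always_eventually[OF allI], rotated]) (rule le)
      from tendsto_diff[OF Alim this] have xlim: "(\<lambda>n. \<kappa> *\<^sub>R x (s n)) \<longlonglongrightarrow> u" by simp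
      have "u \<in> V"
        using closed_sequentially[OF closed _ xlim] x(1) scale by simp
      have "(\<lambda>n. \<kappa> *\<^sub>R ?A (x (s n))) \<longlonglongrightarrow> ?A u"
        using continuous_emp_op[OF xlim, of m w] by (simp add: linear_scale[OF linear_emp_op])
      moreover have "(\<lambda>n. \<kappa> *\<^sub>R ?A (x (s n))) \<longlonglongrightarrow> \<kappa> *\<^sub>R u"
        by (rule tendsto_scaleR[OF tendsto_const Alim])
      ultimately have Au: "?A u = \<kappa> *\<^sub>R u" by (rule LIMSEQ_unique)
      have "(\<lambda>n. \<kappa> * q (x (s n))) \<longlonglongrightarrow> u \<bullet> u"
        using tendsto_inner[OF Alim xlim] by (simp add: q_def)
      moreover have "(\<lambda>n. \<kappa> * q (x (s n))) \<longlonglongrightarrow> \<kappa> * \<kappa>" by (rule tendsto_mult[OF tendsto_const q_lim'])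
      ultimately have "u \<bullet> u = \<kappa> * \<kappa>" by (rule LIMSEQ_unique)
      then have "u \<noteq> 0" using pos by auto
      with \<open>u \<in> V\<close> Au no_eigenvector show False by blast
    qed
  qed
  then show ?thesis using that \<kappa>0 \<kappa> unfolding q_def by blast
qed

text \<open>
  Perturbation of the truncated inverse. \<open>C\<close> is a positive operator with square root \<open>D\<close> (only
  \<open>\<parallel>D x\<parallel>\<^sup>2 = x \<bullet> C x\<close> is needed), \<open>f\<close> are its leading eigenvectors, and \<open>fh\<close> are leading eigenvectors of the
  empirical operator. The norm \<open>\<parallel>D _\<parallel>\<close> plays the role of the \<open>L\<^sup>2\<close> norm; measuring the error in it gains a
  factor \<open>sqrt \<alpha>\<close> over the norm of the Hilbert space. Only the gap between \<open>\<alpha>\<close> and \<open>\<beta>\<close> matters, so the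
  leading eigenvalues may be multiple. If \<open>u\<close> and \<open>y\<close> are the two truncated inverses of \<open>v\<close>, then the
  error \<open>y - u\<close> is split by the eigenspaces of \<open>C\<close>: its leading part is determined by
  \<open>C (y - u)\<close>, and its remaining part by the angle between the leading eigenspaces.
\<close>

lemma truncated_inverse_perturbation:
  fixes C D :: "'a::real_inner \<Rightarrow> 'a" and w :: "nat \<Rightarrow> 'a" and f fh :: "nat \<Rightarrow> 'a"
  assumes linC: "linear C" and symC: "\<And>x y. C x \<bullet> y = x \<bullet> C y"
    and linD: "linear D" and D: "\<And>x. (norm (D x))\<^sup>2 = x \<bullet> C x"
    and onf: "orthonormal_on {1..r} f" and eigf: "\<And>j. j \<in> {1..r} \<Longrightarrow> C (f j) = l j *\<^sub>R f j"
    and l: "\<And>j. j \<in> {1..r} \<Longrightarrow> \<alpha> \<le> l j"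
    and C_rest: "\<And>x. (\<And>j. j \<in> {1..r} \<Longrightarrow> x \<bullet> f j = 0) \<Longrightarrow> norm (C x) \<le> \<beta> * norm x"
    and onh: "orthonormal_on {1..r} fh"
    and eigh: "\<And>j. j \<in> {1..r} \<Longrightarrow> emp_op m w (fh j) = lh j *\<^sub>R fh j"
    and lh: "\<And>j. j \<in> {1..r} \<Longrightarrow> lh r \<le> lh j"
    and top: "\<And>g c. g \<noteq> 0 \<Longrightarrow> 0 < c \<Longrightarrow> emp_op m w g = c *\<^sub>R g \<Longrightarrow>
        (\<And>j. j \<in> {1..r} \<Longrightarrow> g \<bullet> fh j = 0) \<Longrightarrow> c \<le> lh r"
    and close: "\<And>x. norm (emp_op m w x - C x) \<le> \<epsilon> * norm x"
    and r: "1 \<le> r" and \<beta>: "0 \<le> \<beta>" and \<delta>: "0 < \<delta>" "2 * \<delta> \<le> \<alpha> - \<beta>" and \<epsilon>: "0 \<le> \<epsilon>" "5 * \<epsilon> \<le> 3 * \<delta>"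
  shows "norm (D ((\<Sum>j=1..r. ((v \<bullet> f j) / l j) *\<^sub>R f j) - (\<Sum>j=1..r. ((v \<bullet> fh j) / lh j) *\<^sub>R fh j)))
    \<le> 49/20 * \<epsilon> / (\<delta> * sqrt \<alpha>) * norm v"
proof -
  let ?J = "{1..r}" and ?A = "emp_op m w"
  have J: "finite ?J" by simp
  have rJ: "r \<in> ?J" using r by simp
  note linA = linear_emp_op[of m w]
  have \<alpha>: "0 < \<alpha>" "2 * \<delta> \<le> \<alpha>" using \<beta> \<delta> by linarith+
  define V where "V = {x. \<forall>j\<in>?J. x \<bullet> fh j = 0}"
  have AV: "?A x \<in> V" if "x \<in> V" for x
    using that by (auto simp: V_def emp_op_sym eigh)
  have "closed V"
  proof -
    have "V = (\<Inter>j\<in>?J. {x. x \<bullet> fh j = 0})" by (auto simp: V_def)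
    then show ?thesis by (auto intro!: closed_INT closed_Collect_eq continuous_intros)
  qed
  then obtain \<kappa> where \<kappa>: "0 \<le> \<kappa>" "\<And>x. x \<in> V \<Longrightarrow> ?A x \<bullet> x \<le> \<kappa> * (norm x)\<^sup>2"
    "\<kappa> = 0 \<or> (\<exists>u\<in>V. u \<noteq> 0 \<and> ?A u = \<kappa> *\<^sub>R u)"
    by (rule emp_op_max_eigenvector[of V m w, rotated 3]) (use AV in \<open>auto simp: V_def\<close>)
  have onh_r: "fh r \<bullet> fh r = 1" using onh rJ by (simp add: orthonormal_on_def)
  have \<kappa>_lh: "\<kappa> \<le> lh r"
    using \<kappa>(3)
  proof
    assume "\<kappa> = 0"
    have "0 \<le> ?A (fh r) \<bullet> fh r" by (rule emp_op_nonneg)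
    then show ?thesis using eigh[OF rJ] onh_r \<open>\<kappa> = 0\<close> by simp
  next
    assume "\<exists>u\<in>V. u \<noteq> 0 \<and> ?A u = \<kappa> *\<^sub>R u"
    then obtain u where u: "u \<in> V" "u \<noteq> 0" "?A u = \<kappa> *\<^sub>R u" by blast
    show ?thesis
    proof (cases "\<kappa> = 0")
      case True
      then show ?thesis using eigh[OF rJ] onh_r emp_op_nonneg[of m w "fh r"] by simp
    next
      case False
      then show ?thesis using top[OF u(2) _ u(3)] u(1) \<kappa>(1) by (auto simp: V_def)
    qed
  qed
  have AC: "\<bar>?A x \<bullet> x - C x \<bullet> x\<bar> \<le> \<epsilon> * (norm x)\<^sup>2" for x
  proof -
    have "\<bar>(?A x - C x) \<bullet> x\<bar> \<le> norm (?A x - C x) * norm x" by (rule Cauchy_Schwarz_ineq2)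
    also have "\<dots> \<le> (\<epsilon> * norm x) * norm x" by (intro mult_right_mono close) auto
    finally show ?thesis by (simp add: inner_diff_left power2_eq_square mult_ac)
  qed
  have C_rest': "C x \<bullet> x \<le> \<beta> * (norm x)\<^sup>2" if "\<And>j. j \<in> ?J \<Longrightarrow> x \<bullet> f j = 0" for x
  proof -
    have "C x \<bullet> x \<le> norm (C x) * norm x" by (rule norm_cauchy_schwarz)
    also have "\<dots> \<le> (\<beta> * norm x) * norm x" by (intro mult_right_mono C_rest that) auto
    finally show ?thesis by (simp add: power2_eq_square mult_ac)
  qed
  \<comment> \<open>Weyl: a vector in the span of the \<open>f\<^sub>j\<close> that is orthogonal to all but the last of the \<open>fh\<^sub>j\<close>\<close>
  have lh_lower: "\<alpha> - \<epsilon> \<le> lh r"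
  proof -
    obtain c where c: "\<exists>j\<le>r - 1. c j \<noteq> 0"
      "\<forall>i<r - 1. (\<Sum>j\<le>r - 1. c j * (f (Suc j) \<bullet> fh (Suc i))) = 0"
      using exists_nontrivial_solution[of "r - 1" "\<lambda>i j. f (Suc j) \<bullet> fh (Suc i)"] by blast
    define x where "x = (\<Sum>j\<in>?J. c (j - 1) *\<^sub>R f j)"
    have reindex: "(\<Sum>j\<in>?J. c (j - 1) * h j) = (\<Sum>j\<le>r - 1. c j * h (Suc j))" for h :: "nat \<Rightarrow> real"
      using r by (intro sum.reindex_bij_witness[of _ Suc "\<lambda>j. j - 1"]) auto
    have nx: "(norm x)\<^sup>2 = (\<Sum>j\<in>?J. (c (j - 1))\<^sup>2)"
      unfolding x_def by (rule norm_sum_orthonormal[OF J onf])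
    have x0: "norm x \<noteq> 0"
    proof
      assume "norm x = 0"
      then have "(\<Sum>j\<in>?J. (c (j - 1))\<^sup>2) = 0" using nx by simp
      then have "\<forall>j\<in>?J. c (j - 1) = 0" by (simp add: sum_nonneg_eq_0_iff)
      moreover obtain j where "j \<le> r - 1" "c j \<noteq> 0" using c(1) by blast
      ultimately show False using r by (auto dest!: bspec[of _ _ "Suc j"])
    qed
    have xfh: "x \<bullet> fh j = 0" if "j \<in> ?J" "j \<noteq> r" for j
    proof -
      have "x \<bullet> fh j = (\<Sum>i\<in>?J. c (i - 1) * (f i \<bullet> fh j))" by (simp add: x_def inner_sum_left)
      also have "\<dots> = (\<Sum>i\<le>r - 1. c i * (f (Suc i) \<bullet> fh (Suc (j - 1))))"
        using that reindex[of "\<lambda>i. f i \<bullet> fh j"] by simp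
      also have "\<dots> = 0"
      proof -
        have "j - 1 < r - 1" using that by auto
        then show ?thesis using c(2) by blast
      qed
      finally show ?thesis .
    qed
    define t where "t = x \<bullet> fh r"
    define x' where "x' = x - t *\<^sub>R fh r"
    have x'V: "x' \<in> V"
      unfolding V_def x'_def using xfh onh rJ
      by (auto simp: inner_diff_left orthonormal_on_def t_def)
    then have x'r: "x' \<bullet> fh r = 0" using rJ by (auto simp: V_def)
    have xs: "x = t *\<^sub>R fh r + x'" by (simp add: x'_def)
    have nx': "(norm x)\<^sup>2 = t\<^sup>2 + (norm x')\<^sup>2"
      unfolding xs power2_norm_eq_inner using onh_r x'r
      by (simp add: inner_add_left inner_add_right inner_commute power2_eq_square)
    have "?A x' \<bullet> fh r = 0" using AV[OF x'V] rJ unfolding V_def by blast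
    then have "?A x \<bullet> x = lh r * t\<^sup>2 + ?A x' \<bullet> x'"
      unfolding xs linear_add[OF linA] linear_scale[OF linA] eigh[OF rJ]
      using onh_r x'r inner_commute[of "fh r" x']
      by (simp add: inner_add_left inner_add_right power2_eq_square)
    also have "\<dots> \<le> lh r * t\<^sup>2 + lh r * (norm x')\<^sup>2"
      using \<kappa>(2)[OF x'V] mult_right_mono[OF \<kappa>_lh, of "(norm x')\<^sup>2"] by simp
    also have "\<dots> = lh r * (norm x)\<^sup>2" by (simp add: nx' distrib_left)
    finally have up: "?A x \<bullet> x \<le> lh r * (norm x)\<^sup>2" .
    have "\<alpha> * (norm x)\<^sup>2 \<le> (\<Sum>j\<in>?J. l j * (c (j - 1))\<^sup>2)"
      unfolding nx sum_distrib_left using l by (intro sum_mono mult_right_mono) auto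
    also have "\<dots> = C x \<bullet> x"
      using eigen_sum_inner[OF J onf linC eigf, of "\<lambda>j. c (j - 1)"] by (simp add: x_def inner_commute)
    finally have "(\<alpha> - \<epsilon>) * (norm x)\<^sup>2 \<le> ?A x \<bullet> x" using AC[of x] by (simp add: algebra_simps abs_le_iff)
    with up have "(\<alpha> - \<epsilon>) * (norm x)\<^sup>2 \<le> lh r * (norm x)\<^sup>2" by linarith
    then show ?thesis using x0 by simp
  qed
  \<comment> \<open>Weyl: a vector in the span of the \<open>fh\<^sub>j\<close> and of the maximal eigenvector, orthogonal to all \<open>f\<^sub>j\<close>\<close>
  have \<kappa>_upper: "\<kappa> \<le> \<beta> + \<epsilon>"
    using \<kappa>(3)
  proof
    assume "\<kappa> = 0" then show ?thesis using \<beta> \<epsilon> by simp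
  next
    assume "\<exists>u\<in>V. u \<noteq> 0 \<and> ?A u = \<kappa> *\<^sub>R u"
    then obtain u where u: "u \<in> V" "u \<noteq> 0" "?A u = \<kappa> *\<^sub>R u" by blast
    define z where "z j = (if j = 0 then (1 / norm u) *\<^sub>R u else fh j)" for j :: nat
    define k where "k j = (if j = 0 then \<kappa> else lh j)" for j :: nat
    have uu: "u \<bullet> u / (norm u * norm u) = 1"
      using u(2) by (simp add: power2_norm_eq_inner[symmetric] power2_eq_square)
    have onz: "orthonormal_on {..r} z"
    proof -
      have "u \<bullet> fh j = 0" "fh j \<bullet> u = 0" if "j \<in> ?J" for j
        using u(1) that inner_commute[of u "fh j"] unfolding V_def by auto
      then show ?thesis using uu onh unfolding orthonormal_on_def z_def by auto
    qed
    have eigz: "?A (z j) = k j *\<^sub>R z j" if "j \<in> {..r}" for j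
      using that eigh u(3) by (auto simp: z_def k_def linear_scale[OF linA])
    have k: "\<kappa> \<le> k j" if "j \<in> {..r}" for j
      using that lh[of j] \<kappa>_lh by (auto simp: k_def)
    obtain c where c: "\<exists>j\<le>r. c j \<noteq> 0" "\<forall>i<r. (\<Sum>j\<le>r. c j * (z j \<bullet> f (Suc i))) = 0"
      using exists_nontrivial_solution[of r "\<lambda>i j. z j \<bullet> f (Suc i)"] by blast
    define x where "x = (\<Sum>j\<in>{..r}. c j *\<^sub>R z j)"
    have nx: "(norm x)\<^sup>2 = (\<Sum>j\<in>{..r}. (c j)\<^sup>2)"
      unfolding x_def by (rule norm_sum_orthonormal[OF _ onz]) simp
    have x0: "norm x \<noteq> 0"
    proof
      assume "norm x = 0"
      then have "(\<Sum>j\<in>{..r}. (c j)\<^sup>2) = 0" using nx by simp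
      then show False using c(1) by (auto simp: sum_nonneg_eq_0_iff)
    qed
    have xf: "x \<bullet> f j = 0" if "j \<in> ?J" for j
    proof -
      have "j - 1 < r" using that by auto
      then have "(\<Sum>i\<le>r. c i * (z i \<bullet> f (Suc (j - 1)))) = 0" using c(2) by blast
      then show ?thesis using that by (simp add: x_def inner_sum_left)
    qed
    have "\<kappa> * (norm x)\<^sup>2 \<le> (\<Sum>j\<in>{..r}. k j * (c j)\<^sup>2)"
      unfolding nx sum_distrib_left using k by (intro sum_mono mult_right_mono) auto
    also have "\<dots> = ?A x \<bullet> x"
      using eigen_sum_inner[OF _ onz linA eigz, of c] by (simp add: x_def inner_commute)
    also have "\<dots> \<le> (\<beta> + \<epsilon>) * (norm x)\<^sup>2"
      using AC[of x] C_rest'[OF xf] by (simp add: algebra_simps abs_le_iff)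
    finally show ?thesis using x0 by simp
  qed
  have lh7: "7/10 * \<alpha> \<le> lh r" using lh_lower \<epsilon> \<alpha> by linarith
  have g1: "7/5 * \<delta> \<le> \<alpha> - \<kappa>" using \<kappa>_upper \<delta> \<epsilon> by linarith
  have g2: "7/5 * \<delta> \<le> lh r - \<beta>" using lh_lower \<delta> \<epsilon> by linarith
  define y where "y = (\<Sum>j\<in>?J. ((v \<bullet> f j) / l j) *\<^sub>R f j)"
  define u where "u = (\<Sum>j\<in>?J. ((v \<bullet> fh j) / lh j) *\<^sub>R fh j)"
  let ?P = "proj_on ?J f" and ?Ph = "proj_on ?J fh"
  have lpos: "0 < l j" if "j \<in> ?J" for j using l[OF that] \<alpha> by simp
  have lhpos: "0 < lh j" if "j \<in> ?J" for j using lh[OF that] lh7 \<alpha> by simp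
  note linQ = linear_diff_proj_on
  have close': "norm (C x - ?A x) \<le> \<epsilon> * norm x" for x
    using close[of x] by (simp add: norm_minus_commute)
  have sin1: "norm (x - ?Ph x) \<le> \<epsilon> / (\<alpha> - \<kappa>) * norm x" if "?P x = x" for x
  proof (rule sin_theta_bound[OF J onf linC eigf l _ _ linQ _ close' \<kappa>(1) _ \<epsilon>(1) that])
    show "?A x - ?Ph (?A x) = ?A (x - ?Ph x)" for x
      by (simp only: linear_diff[OF linA] proj_on_commute[OF linA emp_op_sym eigh])
    have V: "x - ?Ph x \<in> V" for x
      using inner_diff_proj_on[OF J onh] by (auto simp: V_def)
    show "norm (?A (x - ?Ph x)) \<le> \<kappa> * norm (x - ?Ph x)" for x
      by (rule emp_op_norm_le[where V = V]) (use \<kappa> V AV in auto)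
    show "norm (x - ?Ph x) \<le> norm x" for x by (rule norm_diff_proj_on_le[OF J onh])
    show "\<kappa> < \<alpha>" using g1 \<delta> by simp
  qed
  have sin2: "norm (x - ?P x) \<le> \<epsilon> / (lh r - \<beta>) * norm x" if "?Ph x = x" for x
  proof (rule sin_theta_bound[OF J onh linA eigh lh _ _ linQ _ close \<beta> _ \<epsilon>(1) that])
    show "C x - ?P (C x) = C (x - ?P x)" for x
      by (simp only: linear_diff[OF linC] proj_on_commute[OF linC symC eigf])
    show "norm (C (x - ?P x)) \<le> \<beta> * norm (x - ?P x)" for x
      by (rule C_rest) (rule inner_diff_proj_on[OF J onf])
    show "norm (x - ?P x) \<le> norm x" for x by (rule norm_diff_proj_on_le[OF J onf])
    show "\<beta> < lh r" using g2 \<delta> by simp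
  qed
  have Phu: "?Ph u = u" unfolding u_def by (rule proj_on_sum[OF J onh])
  have Py: "?P y = y" unfolding y_def by (rule proj_on_sum[OF J onf])
  have Au: "?A u = ?Ph v"
    unfolding u_def linear_sum[OF linA] proj_on_def
  proof (rule sum.cong[OF refl])
    fix j assume "j \<in> ?J"
    then show "?A (((v \<bullet> fh j) / lh j) *\<^sub>R fh j) = (v \<bullet> fh j) *\<^sub>R fh j"
      using lhpos[of j] by (simp add: linear_scale[OF linA] eigh)
  qed
  have nu: "norm u \<le> norm v / lh r"
  proof -
    have "(norm u)\<^sup>2 = (\<Sum>j\<in>?J. ((v \<bullet> fh j) / lh j)\<^sup>2)"
      unfolding u_def by (rule norm_sum_orthonormal[OF J onh])
    also have "\<dots> \<le> (\<Sum>j\<in>?J. (v \<bullet> fh j)\<^sup>2 / (lh r)\<^sup>2)"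
    proof (rule sum_mono)
      fix j assume "j \<in> ?J"
      note j = this
      have "0 < lh j" "(lh r)\<^sup>2 \<le> (lh j)\<^sup>2"
        using lhpos[OF j] power_mono[OF lh[OF j], of 2] lhpos[OF rJ] by simp_all
      from this show "((v \<bullet> fh j) / lh j)\<^sup>2 \<le> (v \<bullet> fh j)\<^sup>2 / (lh r)\<^sup>2"
        unfolding power_divide using lhpos[OF rJ] by (intro divide_left_mono) auto
    qed
    also have "\<dots> = (norm (?Ph v) / lh r)\<^sup>2"
      unfolding sum_divide_distrib[symmetric] power_divide norm_proj_on[OF J onh] ..
    also have "\<dots> \<le> (norm v / lh r)\<^sup>2"
      using norm_proj_on_le[OF J onh, of v] lhpos[OF rJ] by (intro power_mono divide_right_mono) auto
    finally show ?thesis by (rule power2_le_imp_le) (use lhpos[OF rJ] in simp)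
  qed
  define z where "z = y - u"
  \<comment> \<open>on the leading eigenspace, \<open>D\<close> is \<open>C\<close> divided by the square root of an eigenvalue \<open>\<ge> \<alpha>\<close>\<close>
  have DP: "norm (D (?P x)) \<le> norm (?P (C x)) / sqrt \<alpha>" for x
  proof -
    have "(norm (D (?P x)))\<^sup>2 = (\<Sum>j\<in>?J. l j * (x \<bullet> f j)\<^sup>2)"
      unfolding D proj_on_def by (rule eigen_sum_inner[OF J onf linC eigf])
    also have "\<dots> \<le> (\<Sum>j\<in>?J. (C x \<bullet> f j)\<^sup>2 / \<alpha>)"
    proof (rule sum_mono)
      fix j assume j: "j \<in> ?J"
      have "\<alpha> * (l j * (x \<bullet> f j)\<^sup>2) \<le> l j * (l j * (x \<bullet> f j)\<^sup>2)"
        using l[OF j] lpos[OF j] by (intro mult_right_mono) auto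
      also have "\<dots> = (C x \<bullet> f j)\<^sup>2" by (simp add: symC eigf[OF j] power2_eq_square mult_ac)
      finally show "l j * (x \<bullet> f j)\<^sup>2 \<le> (C x \<bullet> f j)\<^sup>2 / \<alpha>" using \<alpha> by (simp add: field_simps)
    qed
    also have "\<dots> = (norm (?P (C x)) / sqrt \<alpha>)\<^sup>2"
      unfolding sum_divide_distrib[symmetric] power_divide norm_proj_on[OF J onf]
      using \<alpha> by simp
    finally show ?thesis by (rule power2_le_imp_le) (use \<alpha> in simp)
  qed
  have PCz: "?P (C z) = ?P (v - ?Ph v) + ?P (?A u - C u)"
  proof -
    have "C y = ?P v"
      unfolding y_def linear_sum[OF linC] proj_on_def
    proof (rule sum.cong[OF refl])
      fix j assume "j \<in> ?J"
      then show "C (((v \<bullet> f j) / l j) *\<^sub>R f j) = (v \<bullet> f j) *\<^sub>R f j"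
        using lpos[of j] by (simp add: linear_scale[OF linC] eigf)
    qed
    then show ?thesis
      unfolding z_def linear_diff[OF linC] proj_on_diff Au by (simp add: proj_on_idem[OF J onf, simplified])
  qed
  have p1: "norm (?P (v - ?Ph v)) \<le> \<epsilon> / (\<alpha> - \<kappa>) * norm v"
  proof -
    define p where "p = ?P (v - ?Ph v)"
    have Pp: "?P p = p" unfolding p_def by (rule proj_on_idem[OF J onf])
    have "(norm p)\<^sup>2 = (v - ?Ph v) \<bullet> p"
      unfolding power2_norm_eq_inner
      by (subst p_def) (simp only: proj_on_sym[OF J onf] Pp)
    also have "\<dots> = v \<bullet> (p - ?Ph p)"
      by (simp only: inner_diff_left inner_diff_right proj_on_sym[OF J onh])
    also have "\<dots> \<le> norm v * norm (p - ?Ph p)" by (rule norm_cauchy_schwarz)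
    also have "\<dots> \<le> norm v * (\<epsilon> / (\<alpha> - \<kappa>) * norm p)"
      by (intro mult_left_mono sin1 Pp) auto
    finally have *: "norm p * norm p \<le> (\<epsilon> / (\<alpha> - \<kappa>) * norm v) * norm p"
      by (simp add: power2_eq_square mult_ac)
    have "norm p \<le> \<epsilon> / (\<alpha> - \<kappa>) * norm v"
    proof (cases "norm p = 0")
      case True
      have "0 < \<alpha> - \<kappa>" using g1 \<delta> by linarith
      with True \<epsilon> show ?thesis by simp
    next
      case False
      then have "0 < norm p" by simp
      with * show ?thesis by (rule mult_right_le_imp_le)
    qed
    then show ?thesis by (simp add: p_def)
  qed
  have "norm (?P (C z)) \<le> \<epsilon> / (\<alpha> - \<kappa>) * norm v + \<epsilon> * norm u"
    unfolding PCz
    by (rule order_trans[OF norm_triangle_ineq add_mono[OF p1 order_trans[OF norm_proj_on_le[OF J onf] close]]])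
  then have t1: "norm (D (?P z)) \<le> (\<epsilon> / (\<alpha> - \<kappa>) * norm v + \<epsilon> * norm u) / sqrt \<alpha>"
    using \<alpha> by (intro order_trans[OF DP divide_right_mono]) auto
  have t2: "norm (D (z - ?P z)) \<le> sqrt \<alpha> * (\<epsilon> / (lh r - \<beta>) * norm u)"
  proof -
    define q where "q = u - ?P u"
    have zq: "z - ?P z = - q" unfolding z_def q_def proj_on_diff Py by simp
    have "(norm (D (- q)))\<^sup>2 = C q \<bullet> q"
      unfolding D by (simp add: linear_neg[OF linC] inner_commute)
    also have "\<dots> \<le> \<beta> * (norm q)\<^sup>2"
      unfolding q_def by (rule C_rest') (rule inner_diff_proj_on[OF J onf])
    also have "\<dots> \<le> \<alpha> * (norm q)\<^sup>2" using \<delta> by (intro mult_right_mono) auto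
    also have "\<dots> = (sqrt \<alpha> * norm q)\<^sup>2" using \<alpha> by (simp add: power_mult_distrib)
    finally have "norm (D (- q)) \<le> sqrt \<alpha> * norm q" by (rule power2_le_imp_le) (use \<alpha> in simp)
    also have "\<dots> \<le> sqrt \<alpha> * (\<epsilon> / (lh r - \<beta>) * norm u)"
      using sin2[OF Phu] \<alpha> by (intro mult_left_mono) (auto simp: q_def)
    finally show ?thesis unfolding zq .
  qed
  have nu': "norm u \<le> 10/7 * norm v / \<alpha>"
  proof -
    have "norm v / lh r \<le> norm v / (7/10 * \<alpha>)" using lh7 \<alpha> by (intro divide_left_mono) auto
    then show ?thesis using nu by simp
  qed
  have a1: "\<epsilon> / (\<alpha> - \<kappa>) \<le> 5/7 * (\<epsilon> / \<delta>)"
  proof -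
    have "\<epsilon> / (\<alpha> - \<kappa>) \<le> \<epsilon> / (7/5 * \<delta>)" using g1 \<delta> \<epsilon> by (intro divide_left_mono) auto
    then show ?thesis by simp
  qed
  have a2: "\<epsilon> / (lh r - \<beta>) \<le> 5/7 * (\<epsilon> / \<delta>)"
  proof -
    have "\<epsilon> / (lh r - \<beta>) \<le> \<epsilon> / (7/5 * \<delta>)" using g2 \<delta> \<epsilon> by (intro divide_left_mono) auto
    then show ?thesis by simp
  qed
  have a3: "\<epsilon> * norm u \<le> 5/7 * (\<epsilon> / \<delta>) * norm v"
  proof -
    have "\<epsilon> * norm u \<le> \<epsilon> * (10/7 * norm v / \<alpha>)" using nu' \<epsilon> by (intro mult_left_mono) auto
    also have "\<dots> \<le> \<epsilon> * (10/7 * norm v / (2 * \<delta>))"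
      using \<alpha> \<delta> \<epsilon> by (intro mult_left_mono divide_left_mono) auto
    finally show ?thesis by simp
  qed
  have b1: "(\<epsilon> / (\<alpha> - \<kappa>) * norm v + \<epsilon> * norm u) / sqrt \<alpha> \<le> (10/7 * (\<epsilon> / \<delta>) * norm v) / sqrt \<alpha>"
    using mult_right_mono[OF a1, of "norm v"] a3 \<alpha> by (intro divide_right_mono) auto
  have "sqrt \<alpha> * (\<epsilon> / (lh r - \<beta>) * norm u) \<le> sqrt \<alpha> * (5/7 * (\<epsilon> / \<delta>) * (10/7 * norm v / \<alpha>))"
    using a2 nu' \<epsilon> \<delta> \<alpha> by (intro mult_left_mono mult_mono) auto
  also have "\<dots> = (50/49 * (\<epsilon> / \<delta>) * norm v) * (sqrt \<alpha> / \<alpha>)" by (simp add: mult_ac)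
  also have "sqrt \<alpha> / \<alpha> = 1 / sqrt \<alpha>"
    using \<alpha>(1) by (simp add: divide_eq_eq eq_divide_eq)
  finally have b2: "sqrt \<alpha> * (\<epsilon> / (lh r - \<beta>) * norm u) \<le> (50/49 * (\<epsilon> / \<delta>) * norm v) / sqrt \<alpha>"
    by simp
  have "norm (D z) \<le> norm (D (?P z)) + norm (D (z - ?P z))"
    using norm_triangle_ineq[of "D (?P z)" "D (z - ?P z)"] by (simp add: linear_add[OF linD, symmetric])
  also have "\<dots> \<le> (10/7 * (\<epsilon> / \<delta>) * norm v) / sqrt \<alpha> + (50/49 * (\<epsilon> / \<delta>) * norm v) / sqrt \<alpha>"
    using t1 t2 b1 b2 by linarith
  also have "\<dots> = 120/49 * (\<epsilon> / \<delta> * norm v / sqrt \<alpha>)" by (simp add: add_divide_distrib[symmetric])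
  also have "\<dots> \<le> 49/20 * (\<epsilon> / \<delta> * norm v / sqrt \<alpha>)"
    using \<epsilon> \<delta> \<alpha> by (intro mult_right_mono) auto
  finally show ?thesis unfolding z_def y_def u_def by simp
qed

section \<open>Square summable sequences\<close>

lemma summable_mult_square:
  fixes a b :: "nat \<Rightarrow> real"
  assumes "summable (\<lambda>n. (a n)\<^sup>2)" "summable (\<lambda>n. (b n)\<^sup>2)"
  shows "summable (\<lambda>n. a n * b n)"
proof (rule summable_comparison_test[OF _ summable_add[OF assms]], intro exI allI impI)
  fix n
  have "0 \<le> (\<bar>a n\<bar> - \<bar>b n\<bar>)\<^sup>2 + 2 * (\<bar>a n\<bar> * \<bar>b n\<bar>) \<and> 0 \<le> (\<bar>a n\<bar> - \<bar>b n\<bar>)\<^sup>2" by simp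
  then have "2 * (\<bar>a n\<bar> * \<bar>b n\<bar>) \<le> (a n)\<^sup>2 + (b n)\<^sup>2" by (simp add: power2_diff)
  moreover have "0 \<le> \<bar>a n\<bar> * \<bar>b n\<bar>" by simp
  ultimately show "norm (a n * b n) \<le> (a n)\<^sup>2 + (b n)\<^sup>2" unfolding real_norm_def abs_mult by linarith
qed

lemma summable_square_add:
  fixes a b :: "nat \<Rightarrow> real"
  assumes "summable (\<lambda>n. (a n)\<^sup>2)" "summable (\<lambda>n. (b n)\<^sup>2)"
  shows "summable (\<lambda>n. (a n + b n)\<^sup>2)"
  unfolding power2_sum
  using summable_add[OF summable_add[OF assms] summable_mult[OF summable_mult_square[OF assms], of 2]]
  by (simp add: mult.assoc)

lemma summable_square_mult:
  fixes a :: "nat \<Rightarrow> real"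
  shows "summable (\<lambda>n. (a n)\<^sup>2) \<Longrightarrow> summable (\<lambda>n. (c * a n)\<^sup>2)"
  by (simp add: power_mult_distrib summable_mult)

text \<open>
  The Hilbert space of square summable real sequences.
\<close>

typedef ell2 = "{a :: nat \<Rightarrow> real. summable (\<lambda>n. (a n)\<^sup>2)}"
  morphisms coord Abs_ell2
  by (rule exI[of _ "\<lambda>_. 0"]) simp

lemma summable_coord: "summable (\<lambda>n. (coord a n)\<^sup>2)"
  using coord[of a] by simp

lemma coord_Abs: "summable (\<lambda>n. (a n)\<^sup>2) \<Longrightarrow> coord (Abs_ell2 a) = a"
  by (simp add: Abs_ell2_inverse)

lemma ell2_eqI: "(\<And>n. coord a n = coord b n) \<Longrightarrow> a = b"
  by (metis coord_inject ext)

instantiation ell2 :: real_inner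
begin

definition zero_ell2 :: ell2 where "zero_ell2 = Abs_ell2 (\<lambda>_. 0)"
definition plus_ell2 :: "ell2 \<Rightarrow> ell2 \<Rightarrow> ell2" where
  "plus_ell2 a b = Abs_ell2 (\<lambda>n. coord a n + coord b n)"
definition scaleR_ell2 :: "real \<Rightarrow> ell2 \<Rightarrow> ell2" where
  "scaleR_ell2 c a = Abs_ell2 (\<lambda>n. c * coord a n)"
definition uminus_ell2 :: "ell2 \<Rightarrow> ell2" where "uminus_ell2 a = (-1) *\<^sub>R a"
definition minus_ell2 :: "ell2 \<Rightarrow> ell2 \<Rightarrow> ell2" where "minus_ell2 a b = a + (-1) *\<^sub>R b"
definition inner_ell2 :: "ell2 \<Rightarrow> ell2 \<Rightarrow> real" where
  "inner_ell2 a b = (\<Sum>n. coord a n * coord b n)"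
definition norm_ell2 :: "ell2 \<Rightarrow> real" where "norm_ell2 a = sqrt (inner a a)"
definition sgn_ell2 :: "ell2 \<Rightarrow> ell2" where "sgn_ell2 a = inverse (norm a) *\<^sub>R a"
definition dist_ell2 :: "ell2 \<Rightarrow> ell2 \<Rightarrow> real" where "dist_ell2 a b = norm (a - b)"
definition uniformity_ell2 :: "(ell2 \<times> ell2) filter" where
  "uniformity_ell2 = (INF e\<in>{0<..}. principal {(x, y). dist x y < e})"
definition open_ell2 :: "ell2 set \<Rightarrow> bool" where
  "open_ell2 U \<longleftrightarrow> (\<forall>x\<in>U. eventually (\<lambda>(x', y). x' = x \<longrightarrow> y \<in> U) uniformity)"

lemma coord_zero': "coord 0 n = 0"
  by (simp add: zero_ell2_def coord_Abs)

lemma coord_add': "coord (a + b) n = coord a n + coord b n"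
  by (simp add: plus_ell2_def coord_Abs summable_square_add summable_coord)

lemma coord_scaleR': "coord (c *\<^sub>R a) n = c * coord a n"
  unfolding scaleR_ell2_def by (subst coord_Abs[OF summable_square_mult[OF summable_coord]]) simp

lemma coord_uminus': "coord (- a) n = - coord a n"
  by (simp add: uminus_ell2_def coord_scaleR')

lemma coord_diff': "coord (a - b) n = coord a n - coord b n"
  by (simp add: minus_ell2_def coord_add' coord_scaleR')

lemmas coord_simps = coord_zero' coord_add' coord_scaleR' coord_uminus' coord_diff'

instance
proof
  fix a b c :: ell2 and s t :: real
  show "a + b + c = a + (b + c)" "a + b = b + a" "0 + a = a" "- a + a = 0" "a - b = a + - b"
    "s *\<^sub>R (a + b) = s *\<^sub>R a + s *\<^sub>R b" "(s + t) *\<^sub>R a = s *\<^sub>R a + t *\<^sub>R a"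
    "s *\<^sub>R t *\<^sub>R a = (s * t) *\<^sub>R a" "1 *\<^sub>R a = a"
    by (rule ell2_eqI, simp add: coord_simps algebra_simps)+
  show "dist a b = norm (a - b)" by (fact dist_ell2_def)
  show "sgn a = inverse (norm a) *\<^sub>R a" by (fact sgn_ell2_def)
  show "uniformity = (INF e\<in>{0<..}. principal {(x::ell2, y). dist x y < e})"
    by (fact uniformity_ell2_def)
  show "open U = (\<forall>x\<in>U. eventually (\<lambda>(x', y). x' = x \<longrightarrow> y \<in> U) uniformity)" for U :: "ell2 set"
    by (fact open_ell2_def)
  show "inner a b = inner b a" by (simp add: inner_ell2_def mult.commute)
  have s: "summable (\<lambda>n. coord a n * coord b n)" for a b
    by (rule summable_mult_square) (rule summable_coord)+
  show "inner (a + b) c = inner a c + inner b c"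
    by (simp add: inner_ell2_def coord_simps distrib_right suminf_add s)
  show "inner (s *\<^sub>R a) b = s * inner a b"
    by (simp add: inner_ell2_def coord_simps mult.assoc suminf_mult s)
  show "0 \<le> inner a a" by (simp add: inner_ell2_def suminf_nonneg s)
  show "inner a a = 0 \<longleftrightarrow> a = 0"
  proof
    assume "inner a a = 0"
    then have "(\<Sum>n. (coord a n)\<^sup>2) = 0" by (simp add: inner_ell2_def power2_eq_square)
    then have "\<forall>n. (coord a n)\<^sup>2 = 0" by (subst (asm) suminf_eq_zero_iff) (auto simp: summable_coord)
    then show "a = 0" by (intro ell2_eqI) (simp add: coord_simps)
  qed (simp add: inner_ell2_def coord_simps)
  show "norm a = sqrt (inner a a)" by (fact norm_ell2_def)
qed

end

lemma coord_sum: "coord (sum f I) n = (\<Sum>i\<in>I. coord (f i) n)"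
  by (induction I rule: infinite_finite_induct) (auto simp: coord_simps)

lemma inner_ell2_sums: "(\<lambda>n. coord a n * coord b n) sums (a \<bullet> b)"
  unfolding inner_ell2_def by (intro summable_sums summable_mult_square summable_coord)

lemma norm_ell2_sums: "(\<lambda>n. (coord a n)\<^sup>2) sums (norm a)\<^sup>2"
  using inner_ell2_sums[of a a] unfolding power2_norm_eq_inner by (simp add: power2_eq_square)

lemma sum_coord_le: "(\<Sum>n<N. (coord a n)\<^sup>2) \<le> (norm a)\<^sup>2"
  unfolding sums_unique[OF norm_ell2_sums] by (intro sum_le_suminf summable_coord) auto

lemma norm_ell2_leI:
  assumes "\<And>n. (\<Sum>j<n. (coord a j)\<^sup>2) \<le> c\<^sup>2" "0 \<le> c"
  shows "norm a \<le> c"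
proof -
  have "(norm a)\<^sup>2 \<le> c\<^sup>2"
    using norm_ell2_sums[of a] unfolding sums_def by (rule LIMSEQ_le_const2) (use assms in auto)
  then show ?thesis by (rule power2_le_imp_le) (rule assms(2))
qed

text \<open>
  The standard unit vectors.
\<close>

definition unit_ell2 :: "nat \<Rightarrow> ell2" where
  "unit_ell2 j = Abs_ell2 (\<lambda>n. if n = j then 1 else 0)"

lemma coord_unit: "coord (unit_ell2 j) n = (if n = j then 1 else 0)"
proof -
  have "summable (\<lambda>n. (if n = j then 1 else 0 :: real)\<^sup>2)"
    by (rule summable_finite[of "{j}"]) auto
  then show ?thesis by (simp add: unit_ell2_def coord_Abs)
qed

lemma inner_unit: "a \<bullet> unit_ell2 j = coord a j"
proof -
  have "(\<lambda>n. coord a n * coord (unit_ell2 j) n) sums (\<Sum>n\<in>{j}. coord a n * coord (unit_ell2 j) n)"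
    by (rule sums_finite) (auto simp: coord_unit)
  with inner_ell2_sums[of a "unit_ell2 j"] show ?thesis
    by (auto simp: coord_unit dest: sums_unique2)
qed

text \<open>
  The diagonal operator with entries \<open>l\<close>; it is meaningful for bounded \<open>l\<close>.
\<close>

definition diag_ell2 :: "(nat \<Rightarrow> real) \<Rightarrow> ell2 \<Rightarrow> ell2" where
  "diag_ell2 l a = Abs_ell2 (\<lambda>n. l n * coord a n)"

context
  fixes l :: "nat \<Rightarrow> real" and L :: real
  assumes bnd: "\<And>n. \<bar>l n\<bar> \<le> L"
begin

lemma coord_diag: "coord (diag_ell2 l a) n = l n * coord a n"
proof -
  have "(l n)\<^sup>2 \<le> L\<^sup>2" for n using power_mono[OF bnd[of n], of 2] by simp
  then have "summable (\<lambda>n. (l n * coord a n)\<^sup>2)"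
    by (intro summable_comparison_test[OF _ summable_mult[OF summable_coord[of a], of "L\<^sup>2"]])
      (auto simp: power_mult_distrib intro!: mult_right_mono)
  then show ?thesis by (simp add: diag_ell2_def coord_Abs)
qed

lemma linear_diag: "linear (diag_ell2 l)"
  by (intro linearI ell2_eqI) (simp_all add: coord_diag coord_simps algebra_simps)

lemma diag_sym: "diag_ell2 l a \<bullet> b = a \<bullet> diag_ell2 l b"
  by (simp add: inner_ell2_def coord_diag mult_ac)

lemma diag_unit: "diag_ell2 l (unit_ell2 j) = l j *\<^sub>R unit_ell2 j"
  by (intro ell2_eqI) (simp add: coord_diag coord_simps coord_unit)

lemma norm_diag_le:
  assumes "\<And>n. coord a n \<noteq> 0 \<Longrightarrow> \<bar>l n\<bar> \<le> c" "0 \<le> c"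
  shows "norm (diag_ell2 l a) \<le> c * norm a"
proof (rule norm_ell2_leI)
  fix n
  have "(\<Sum>j<n. (coord (diag_ell2 l a) j)\<^sup>2) \<le> (\<Sum>j<n. c\<^sup>2 * (coord a j)\<^sup>2)"
  proof (rule sum_mono)
    fix j
    show "(coord (diag_ell2 l a) j)\<^sup>2 \<le> c\<^sup>2 * (coord a j)\<^sup>2"
    proof (cases "coord a j = 0")
      case False
      then have "(l j)\<^sup>2 \<le> c\<^sup>2" using power_mono[OF assms(1), of j 2] by simp
      then show ?thesis by (simp add: coord_diag power_mult_distrib mult_right_mono)
    qed (simp add: coord_diag)
  qed
  also have "\<dots> \<le> (c * norm a)\<^sup>2"
    unfolding sum_distrib_left[symmetric] power_mult_distrib by (intro mult_left_mono sum_coord_le) simp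
  finally show "(\<Sum>j<n. (coord (diag_ell2 l a) j)\<^sup>2) \<le> (c * norm a)\<^sup>2" .
qed (use assms in simp)

end

lemma norm_diag_sqrt:
  assumes "\<And>n. 0 \<le> l n" "\<And>n. l n \<le> L"
  shows "(norm (diag_ell2 (\<lambda>n. sqrt (l n)) a))\<^sup>2 = a \<bullet> diag_ell2 l a"
proof -
  have b1: "\<bar>l n\<bar> \<le> L" and b2: "\<bar>sqrt (l n)\<bar> \<le> sqrt L" for n using assms by auto
  have "(coord (diag_ell2 (\<lambda>n. sqrt (l n)) a) n)\<^sup>2 = coord a n * coord (diag_ell2 l a) n" for n
    unfolding coord_diag[of l L, OF b1] coord_diag[of "\<lambda>n. sqrt (l n)" "sqrt L", OF b2]
    using assms by (simp add: power_mult_distrib power2_eq_square[of "coord a n"])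
  with norm_ell2_sums[of "diag_ell2 (\<lambda>n. sqrt (l n)) a"] inner_ell2_sums[of a "diag_ell2 l a"]
  show ?thesis by (auto dest: sums_unique2)
qed

text \<open>
  An infinite matrix whose finite sections have Hilbert-Schmidt norm at most \<open>\<epsilon>\<close> has operator norm
  at most \<open>\<epsilon>\<close>.
\<close>

lemma hs_truncation_bound:
  fixes E :: "nat \<Rightarrow> nat \<Rightarrow> real"
  assumes E: "\<And>n. (\<Sum>j<n. \<Sum>k<n. (E j k)\<^sup>2) \<le> \<epsilon>\<^sup>2"
    and x: "\<And>n. (\<Sum>k<n. (x k)\<^sup>2) \<le> X"
    and y: "\<And>j. (\<lambda>k. E j k * x k) sums y j"
  shows "(\<Sum>j<n. (y j)\<^sup>2) \<le> \<epsilon>\<^sup>2 * X"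
proof -
  have X0: "0 \<le> X" using x[of 0] by simp
  have "(\<lambda>N. \<Sum>j<n. (\<Sum>k<N. E j k * x k)\<^sup>2) \<longlonglongrightarrow> (\<Sum>j<n. (y j)\<^sup>2)"
    using y unfolding sums_def by (intro tendsto_sum tendsto_power) auto
  then show ?thesis
  proof (rule LIMSEQ_le_const2, intro exI allI impI)
    fix N assume N: "n \<le> N"
    have "(\<Sum>j<n. (\<Sum>k<N. E j k * x k)\<^sup>2) \<le> (\<Sum>j<n. (\<Sum>k<N. (E j k)\<^sup>2) * (\<Sum>k<N. (x k)\<^sup>2))"
      by (intro sum_mono Cauchy_Schwarz_ineq_sum)
    also have "\<dots> = (\<Sum>j<n. \<Sum>k<N. (E j k)\<^sup>2) * (\<Sum>k<N. (x k)\<^sup>2)" by (simp add: sum_distrib_right)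
    also have "\<dots> \<le> (\<Sum>j<N. \<Sum>k<N. (E j k)\<^sup>2) * X"
      using N x by (intro mult_mono sum_mono2 sum_nonneg) auto
    also have "\<dots> \<le> \<epsilon>\<^sup>2 * X" by (intro mult_right_mono E X0)
    finally show "(\<Sum>j<n. (\<Sum>k<N. E j k * x k)\<^sup>2) \<le> \<epsilon>\<^sup>2 * X" .
  qed
qed

section \<open>Orthonormal sequences in reproducing kernel Hilbert spaces\<close>

text \<open>
  Gram-Schmidt orthonormalization of a sequence. A vector that depends linearly on its predecessors
  yields \<open>0\<close>, because the division is then by zero.
\<close>

fun gram_schmidt :: "(('a \<Rightarrow> real) \<Rightarrow> ('a \<Rightarrow> real) \<Rightarrow> real) \<Rightarrow> (nat \<Rightarrow> 'a \<Rightarrow> real) \<Rightarrow> nat \<Rightarrow> 'a \<Rightarrow> real" where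
  "gram_schmidt ip h n =
    (let v = (\<lambda>x. h n x - (\<Sum>l<n. ip (h n) (gram_schmidt ip h l) * gram_schmidt ip h l x))
     in (\<lambda>x. v x / sqrt (ip v v)))"

declare gram_schmidt.simps [simp del]

context rkhs
begin

lemma lincomb_mem:
  assumes "\<And>i. i \<in> I \<Longrightarrow> f i \<in> H" shows "(\<lambda>x. \<Sum>i\<in>I. c i * f i x) \<in> H"
  using assms
  by (induction I rule: infinite_finite_induct) (auto intro!: zero_mem add_mem scale_mem)

lemma ip_zero_left: "g \<in> H \<Longrightarrow> ip (\<lambda>x. 0) g = 0"
  using ip_scale[of "\<lambda>x. 0" g 0] zero_mem by simp

lemma ip_lincomb:
  assumes "\<And>i. i \<in> I \<Longrightarrow> f i \<in> H" "g \<in> H"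
  shows "ip (\<lambda>x. \<Sum>i\<in>I. c i * f i x) g = (\<Sum>i\<in>I. c i * ip (f i) g)"
  using assms(1)
proof (induction I rule: infinite_finite_induct)
  case (insert i I)
  then have "ip (\<lambda>x. c i * f i x + (\<Sum>i\<in>I. c i * f i x)) g = c i * ip (f i) g + (\<Sum>i\<in>I. c i * ip (f i) g)"
    using assms(2) by (subst ip_add) (auto intro!: scale_mem lincomb_mem simp: ip_scale)
  with insert show ?case by simp
qed (simp_all add: ip_zero_left assms)

lemma diff_mem: "f \<in> H \<Longrightarrow> g \<in> H \<Longrightarrow> (\<lambda>x. f x - g x) \<in> H"
  using add_mem[of f "\<lambda>x. (-1) * g x"] scale_mem[of g "-1"] by simp

lemma ip_diff: "f \<in> H \<Longrightarrow> g \<in> H \<Longrightarrow> h \<in> H \<Longrightarrow> ip (\<lambda>x. f x - g x) h = ip f h - ip g h"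
  using ip_add[of f "\<lambda>x. (-1) * g x" h] ip_scale[of g h "-1"] scale_mem[of g "-1"] by simp

lemma ip_diff_right: "f \<in> H \<Longrightarrow> g \<in> H \<Longrightarrow> h \<in> H \<Longrightarrow> ip h (\<lambda>x. f x - g x) = ip h f - ip h g"
  using ip_diff[of f g h] by (simp add: ip_sym[of h] diff_mem)

lemma ip_diff_diff:
  assumes "f \<in> H" "g \<in> H"
  shows "ip (\<lambda>x. f x - g x) (\<lambda>x. f x - g x) = ip f f - 2 * ip f g + ip g g"
  using assms ip_sym[of g f] by (simp add: ip_diff ip_diff_right diff_mem)

lemma ip_Cauchy_Schwarz:
  assumes f: "f \<in> H" and g: "g \<in> H" shows "(ip f g)\<^sup>2 \<le> ip f f * ip g g"
proof (cases "ip g g = 0")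
  case True
  then have "g = (\<lambda>x. 0)" using ip_definite g by simp
  then show ?thesis using ip_zero_left[OF f] ip_sym[OF f g] True by simp
next
  case False
  then have pos: "0 < ip g g" using ip_nonneg[OF g] by simp
  define c where "c = ip f g / ip g g"
  have cg: "(\<lambda>x. c * g x) \<in> H" using g by (rule scale_mem)
  have "0 \<le> ip (\<lambda>x. f x - c * g x) (\<lambda>x. f x - c * g x)" by (intro ip_nonneg diff_mem f cg)
  also have "\<dots> = ip f f - 2 * (c * ip f g) + c * (c * ip g g)"
    using ip_scale[OF g g, of c] ip_scale[OF g cg, of c] ip_scale[OF g f, of c]
    by (simp add: ip_diff_diff[OF f cg] ip_sym[OF f cg] ip_sym[OF f g] ip_sym[OF g cg])
  also have "\<dots> = ip f f - (ip f g)\<^sup>2 / ip g g" using pos by (simp add: c_def power2_eq_square)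
  finally show ?thesis using pos by (simp add: field_simps)
qed

lemma abs_ip_le: "f \<in> H \<Longrightarrow> g \<in> H \<Longrightarrow> \<bar>ip f g\<bar> \<le> sqrt (ip f f) * sqrt (ip g g)"
  using ip_Cauchy_Schwarz[of f g] by (metis real_sqrt_abs real_sqrt_le_mono real_sqrt_mult)

lemma ip_feature: "x \<in> S \<Longrightarrow> y \<in> S \<Longrightarrow> ip (feature S k x) (feature S k y) = k x y"
  using reproducing[OF feature_mem, of x y] by (simp add: feature_def)

lemma eval_square_le:
  assumes "f \<in> H" "x \<in> S" shows "(f x)\<^sup>2 \<le> ip f f * k x x"
  using ip_Cauchy_Schwarz[OF assms(1) feature_mem[OF assms(2)]] assms
  by (simp add: reproducing ip_feature)

lemma kernel_diag_nonneg: "x \<in> S \<Longrightarrow> 0 \<le> k x x"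
  using ip_nonneg[OF feature_mem] by (simp add: ip_feature)

lemma eval_diff_square_le:
  assumes "f \<in> H" "x \<in> S" "y \<in> S"
  shows "(f x - f y)\<^sup>2 \<le> ip f f * (k x x - 2 * k x y + k y y)"
proof -
  let ?d = "\<lambda>z. feature S k x z - feature S k y z"
  have d: "?d \<in> H" using assms by (intro diff_mem feature_mem)
  have "ip f ?d = f x - f y" using assms by (simp add: ip_diff_right feature_mem reproducing)
  then show ?thesis
    using ip_Cauchy_Schwarz[OF assms(1) d] assms
    by (simp add: ip_diff_diff feature_mem ip_feature)
qed

text \<open>
  A total orthonormal sequence, in which some members may be \<open>0\<close> so that every separable space,
  also one of finite dimension, has such a sequence indexed by all natural numbers.
\<close>

definition total_orthonormal :: "(nat \<Rightarrow> 'a \<Rightarrow> real) \<Rightarrow> bool" where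
  "total_orthonormal g \<longleftrightarrow> (\<forall>n. g n \<in> H) \<and> (\<forall>i j. i \<noteq> j \<longrightarrow> ip (g i) (g j) = 0)
     \<and> (\<forall>j. ip (g j) (g j) \<in> {0, 1}) \<and> (\<forall>f\<in>H. (\<forall>j. ip f (g j) = 0) \<longrightarrow> f = (\<lambda>x. 0))"

context
  fixes g assumes tot: "total_orthonormal g"
begin

lemma basis_mem: "g n \<in> H"
  using tot by (simp add: total_orthonormal_def)

lemma ip_basis_mult:
  assumes "f \<in> H" shows "ip f (g i) * ip (g i) (g j) = (if i = j then ip f (g i) else 0)"
proof (cases "i = j")
  case True
  show ?thesis
  proof (cases "ip (g i) (g i) = 0")
    case True
    then have "ip f (g i) = 0" using ip_Cauchy_Schwarz[OF assms basis_mem, of i] by simp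
    then show ?thesis using \<open>i = j\<close> by simp
  next
    case False
    then show ?thesis using tot \<open>i = j\<close> by (auto simp: total_orthonormal_def)
  qed
qed (use tot in \<open>auto simp: total_orthonormal_def\<close>)

text \<open>
  The partial sum over \<open>I\<close> of the Fourier series of \<open>f\<close>.
\<close>

definition partial where "partial f I = (\<lambda>x. \<Sum>j\<in>I. ip f (g j) * g j x)"

lemma partial_mem: "partial f I \<in> H"
  unfolding partial_def by (intro lincomb_mem basis_mem)

lemma ip_partial: "h \<in> H \<Longrightarrow> ip (partial f I) h = (\<Sum>j\<in>I. ip f (g j) * ip h (g j))"
  unfolding partial_def by (simp add: ip_lincomb basis_mem ip_sym)

lemma ip_partial_basis:
  assumes "f \<in> H" "finite I" shows "ip (partial f I) (g i) = (if i \<in> I then ip f (g i) else 0)"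
proof -
  have "ip (partial f I) (g i) = (\<Sum>j\<in>I. ip f (g j) * ip (g j) (g i))"
    unfolding partial_def by (simp add: ip_lincomb basis_mem)
  then show ?thesis using assms by (simp add: ip_basis_mult)
qed

lemma ip_partial_partial:
  assumes "f \<in> H" "finite I" shows "ip (partial f I) (partial f I) = (\<Sum>j\<in>I. (ip f (g j))\<^sup>2)"
  using assms by (simp add: ip_partial partial_mem ip_partial_basis power2_eq_square)

lemma ip_diff_partial:
  assumes "f \<in> H" "finite I"
  shows "ip (\<lambda>x. partial f I x - f x) (\<lambda>x. partial f I x - f x) = ip f f - (\<Sum>j\<in>I. (ip f (g j))\<^sup>2)"
proof -
  have "ip (partial f I) f = (\<Sum>j\<in>I. (ip f (g j))\<^sup>2)" using assms by (simp add: ip_partial power2_eq_square)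
  then show ?thesis using assms by (simp add: ip_diff_diff partial_mem ip_partial_partial)
qed

lemma bessel:
  assumes "f \<in> H" "finite I" shows "(\<Sum>j\<in>I. (ip f (g j))\<^sup>2) \<le> ip f f"
proof -
  have "0 \<le> ip (\<lambda>x. partial f I x - f x) (\<lambda>x. partial f I x - f x)"
    using assms by (intro ip_nonneg diff_mem partial_mem)
  then show ?thesis using assms by (simp add: ip_diff_partial)
qed

lemma sum_basis_square_le:
  assumes "x \<in> S" shows "(\<Sum>j<n. (g j x)\<^sup>2) \<le> k x x"
  using bessel[OF feature_mem[OF assms], of "{..<n}"] assms
  by (simp add: ip_feature ip_sym[OF feature_mem basis_mem] reproducing basis_mem)

lemma partial_tendsto:
  assumes f: "f \<in> H"
  shows "(\<lambda>n. ip (\<lambda>x. partial f {..<n} x - f x) (\<lambda>x. partial f {..<n} x - f x)) \<longlonglongrightarrow> 0"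
proof -
  define s where "s n = (\<Sum>j<n. (ip f (g j))\<^sup>2)" for n
  have s_inc: "s m \<le> s n" if "m \<le> n" for m n
    unfolding s_def using that by (intro sum_mono2) auto
  have dist: "ip (\<lambda>x. partial f {..<m} x - partial f {..<n} x) (\<lambda>x. partial f {..<m} x - partial f {..<n} x)
      = \<bar>s m - s n\<bar>" for m n
  proof -
    have "ip (partial f {..<m}) (partial f {..<n}) = s (min m n)"
      unfolding s_def using f
      by (simp add: ip_partial partial_mem ip_partial_basis power2_eq_square if_distrib[of "\<lambda>x. _ * x"] sum.If_cases
          cong: if_cong) (auto intro!: sum.cong)
    then show ?thesis
      using f s_inc[of m n] s_inc[of n m]
      by (cases "m \<le> n") (auto simp: ip_diff_diff partial_mem ip_partial_partial s_def[symmetric] min_def)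
  qed
  have "incseq s" using s_inc by (auto simp: incseq_def)
  moreover have "s n \<le> ip f f" for n unfolding s_def by (rule bessel[OF f]) simp
  ultimately have "convergent s"
    using incseq_convergent[of s "ip f f"] unfolding convergent_def by metis
  then have Cauchy: "Cauchy s" by (rule convergent_Cauchy)
  have "\<exists>h\<in>H. (\<lambda>n. sqrt (ip (\<lambda>x. partial f {..<n} x - h x) (\<lambda>x. partial f {..<n} x - h x))) \<longlonglongrightarrow> 0"
  proof (rule complete)
    show "partial f {..<n} \<in> H" for n by (rule partial_mem)
    fix \<eta> :: real assume "\<eta> > 0"
    then obtain M where M: "\<And>m n. m \<ge> M \<Longrightarrow> n \<ge> M \<Longrightarrow> \<bar>s m - s n\<bar> < \<eta>\<^sup>2"
      using CauchyD[OF Cauchy, of "\<eta>\<^sup>2"] by auto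
    then have "sqrt \<bar>s m - s n\<bar> < \<eta>" if "m \<ge> M" "n \<ge> M" for m n
      using that \<open>\<eta> > 0\<close> real_sqrt_less_mono[of "\<bar>s m - s n\<bar>" "\<eta>\<^sup>2"] by simp
    then show "\<exists>M. \<forall>m\<ge>M. \<forall>n\<ge>M. sqrt (ip (\<lambda>x. partial f {..<m} x - partial f {..<n} x)
        (\<lambda>x. partial f {..<m} x - partial f {..<n} x)) < \<eta>"
      unfolding dist by blast
  qed
  then obtain h where h: "h \<in> H"
    "(\<lambda>n. sqrt (ip (\<lambda>x. partial f {..<n} x - h x) (\<lambda>x. partial f {..<n} x - h x))) \<longlonglongrightarrow> 0" by blast
  have "ip (\<lambda>x. f x - h x) (g j) = 0" for j
  proof -
    have "(\<lambda>n. sqrt (ip (\<lambda>x. partial f {..<n} x - h x) (\<lambda>x. partial f {..<n} x - h x)) * sqrt (ip (g j) (g j))) \<longlonglongrightarrow> 0"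
      using tendsto_mult_right[OF h(2), of "sqrt (ip (g j) (g j))"] by simp
    then have "(\<lambda>n. ip f (g j) - ip h (g j)) \<longlonglongrightarrow> 0"
    proof (rule Lim_null_comparison[rotated])
      show "\<forall>\<^sub>F n in sequentially. norm (ip f (g j) - ip h (g j))
        \<le> sqrt (ip (\<lambda>x. partial f {..<n} x - h x) (\<lambda>x. partial f {..<n} x - h x)) * sqrt (ip (g j) (g j))"
        using eventually_gt_at_top[of j]
      proof eventually_elim
        case (elim n)
        then have "ip (\<lambda>x. partial f {..<n} x - h x) (g j) = ip f (g j) - ip h (g j)"
          using f h(1) by (simp add: ip_diff partial_mem basis_mem ip_partial_basis)
        then show ?case
          using abs_ip_le[OF diff_mem[OF partial_mem[of f "{..<n}"] h(1)] basis_mem[of j]] by simp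
      qed
    qed
    then have "ip f (g j) - ip h (g j) = 0" by (simp add: LIMSEQ_const_iff)
    then show ?thesis using f h(1) by (simp add: ip_diff basis_mem)
  qed
  then have "(\<lambda>x. f x - h x) = (\<lambda>x. 0)"
    using tot diff_mem[OF f h(1)] unfolding total_orthonormal_def by blast
  then have "h = f" by (auto simp: fun_eq_iff)
  then have "(\<lambda>n. (sqrt (ip (\<lambda>x. partial f {..<n} x - f x) (\<lambda>x. partial f {..<n} x - f x)))\<^sup>2) \<longlonglongrightarrow> 0\<^sup>2"
    using h(2) by (intro tendsto_power) simp
  then show ?thesis
    by (simp add: ip_nonneg diff_mem partial_mem f)
qed

text \<open>
  A linear functional that is bounded near \<open>f\<close> can be computed along the Fourier series of \<open>f\<close>.
\<close>

lemma functional_partial_tendsto: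
  assumes f: "f \<in> H" and F: "\<And>h. h \<in> H \<Longrightarrow> \<bar>F (\<lambda>x. h x - f x)\<bar> \<le> c * sqrt (ip (\<lambda>x. h x - f x) (\<lambda>x. h x - f x))"
    and lin: "\<And>h. h \<in> H \<Longrightarrow> F (\<lambda>x. h x - f x) = F h - F f"
  shows "(\<lambda>n. F (partial f {..<n})) \<longlonglongrightarrow> (F f :: real)"
proof -
  have "(\<lambda>n. c * sqrt (ip (\<lambda>x. partial f {..<n} x - f x) (\<lambda>x. partial f {..<n} x - f x))) \<longlonglongrightarrow> c * sqrt 0"
    by (intro tendsto_mult tendsto_const tendsto_real_sqrt partial_tendsto f)
  then have lim0: "(\<lambda>n. c * sqrt (ip (\<lambda>x. partial f {..<n} x - f x) (\<lambda>x. partial f {..<n} x - f x))) \<longlonglongrightarrow> 0"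
    by simp
  have "norm (F (partial f {..<n}) - F f)
      \<le> c * sqrt (ip (\<lambda>x. partial f {..<n} x - f x) (\<lambda>x. partial f {..<n} x - f x))" for n
    using F[OF partial_mem[of f "{..<n}"]] unfolding lin[OF partial_mem[of f "{..<n}"]] by simp
  then have "(\<lambda>n. F (partial f {..<n}) - F f) \<longlonglongrightarrow> 0"
    by (intro Lim_null_comparison[OF always_eventually[OF allI] lim0])
  then show ?thesis by (simp add: LIM_zero_iff)
qed

lemma parseval:
  assumes "f \<in> H" "h \<in> H"
  shows "(\<lambda>j. ip f (g j) * ip h (g j)) sums ip f h"
proof -
  have "(\<lambda>n. ip (partial f {..<n}) h) \<longlonglongrightarrow> ip f h"
    by (rule functional_partial_tendsto[where F = "\<lambda>f. ip f h" and c = "sqrt (ip h h)"])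
      (use assms abs_ip_le[OF diff_mem[OF _ assms(1)] assms(2)] in \<open>auto simp: ip_diff mult.commute\<close>)
  then show ?thesis using assms by (simp add: sums_def ip_partial)
qed

end

lemma gram_schmidt_orthonormal:
  assumes h: "\<And>n. h n \<in> H"
  shows "gram_schmidt ip h n \<in> H \<and> (\<forall>l<n. ip (gram_schmidt ip h n) (gram_schmidt ip h l) = 0)
    \<and> ip (gram_schmidt ip h n) (gram_schmidt ip h n) \<in> {0, 1}"
proof (induction n rule: less_induct)
  case (less n)
  let ?g = "gram_schmidt ip h"
  define v where "v = (\<lambda>x. h n x - (\<Sum>l<n. ip (h n) (?g l) * ?g l x))"
  have gn: "?g n = (\<lambda>x. (1 / sqrt (ip v v)) * v x)"
    by (subst gram_schmidt.simps) (simp add: v_def Let_def)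
  have gm: "?g l \<in> H" if "l < n" for l using less that by blast
  have sm: "(\<lambda>x. \<Sum>l<n. ip (h n) (?g l) * ?g l x) \<in> H" using gm by (intro lincomb_mem) auto
  have v: "v \<in> H" unfolding v_def by (intro diff_mem h sm)
  have vg: "ip v (?g l) = 0" if l: "l < n" for l
  proof -
    have "ip (h n) (?g j) * ip (?g j) (?g l) = (if j = l then ip (h n) (?g l) else 0)" if j: "j < n" for j
    proof (cases "j = l")
      case True
      have "ip (?g l) (?g l) \<in> {0, 1}" using less l by blast
      moreover have "ip (h n) (?g l) = 0" if "ip (?g l) (?g l) = 0"
        using ip_Cauchy_Schwarz[OF h gm[OF l], of n] that by simp
      ultimately show ?thesis using True by auto
    next
      case False
      then have "ip (?g j) (?g l) = 0"
        using less j l ip_sym[OF gm[OF j] gm[OF l]] by (cases "j < l") auto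
      with False show ?thesis by simp
    qed
    then have "(\<Sum>j<n. ip (h n) (?g j) * ip (?g j) (?g l)) = ip (h n) (?g l)" using l by simp
    moreover have "ip (\<lambda>x. \<Sum>j<n. ip (h n) (?g j) * ?g j x) (?g l) = (\<Sum>j<n. ip (h n) (?g j) * ip (?g j) (?g l))"
      using gm l by (intro ip_lincomb) auto
    ultimately show ?thesis
      unfolding v_def using ip_diff[OF h sm gm[OF l], of n] by simp
  qed
  have "ip (?g n) (?g l) = 0" if "l < n" for l
    unfolding gn using v gm[OF that] vg[OF that] by (subst ip_scale) auto
  moreover have "ip (?g n) (?g n) = (1 / sqrt (ip v v)) * ((1 / sqrt (ip v v)) * ip v v)"
    unfolding gn using v by (simp only: ip_scale scale_mem ip_sym[OF v scale_mem[OF v]])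
  then have "ip (?g n) (?g n) \<in> {0, 1}" using ip_nonneg[OF v] by (cases "ip v v = 0") auto
  moreover have "?g n \<in> H" unfolding gn by (rule scale_mem[OF v])
  ultimately show ?case by blast
qed

lemma gram_schmidt_span:
  assumes h: "\<And>n. h n \<in> H" and f: "f \<in> H" and z: "\<And>n. ip f (gram_schmidt ip h n) = 0"
  shows "ip f (h n) = 0"
proof -
  let ?g = "gram_schmidt ip h"
  have gm: "?g l \<in> H" for l using gram_schmidt_orthonormal[of h, OF h] by blast
  define v where "v = (\<lambda>x. h n x - (\<Sum>l<n. ip (h n) (?g l) * ?g l x))"
  have gn: "?g n = (\<lambda>x. (1 / sqrt (ip v v)) * v x)"
    by (subst gram_schmidt.simps) (simp add: v_def Let_def)
  have sm: "(\<lambda>x. \<Sum>l<n. ip (h n) (?g l) * ?g l x) \<in> H" using gm by (intro lincomb_mem) auto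
  have v: "v \<in> H" unfolding v_def by (intro diff_mem h sm)
  have "ip v f = 0"
  proof (cases "ip v v = 0")
    case True then show ?thesis using ip_definite[OF v] ip_zero_left[OF f] by simp
  next
    case False
    have "(1 / sqrt (ip v v)) * ip v f = ip (?g n) f" unfolding gn by (rule ip_scale[OF v f, symmetric])
    also have "\<dots> = 0" using z[of n] ip_sym[OF f gm] by simp
    finally show ?thesis using False by simp
  qed
  moreover have "ip v f = ip (h n) f - (\<Sum>l<n. ip (h n) (?g l) * ip (?g l) f)"
    using ip_diff[OF h sm f] ip_lincomb[of "{..<n}" ?g f "\<lambda>l. ip (h n) (?g l)"] gm f
    unfolding v_def by simp
  moreover have "ip (?g l) f = 0" for l using z[of l] ip_sym[OF f gm] by simp
  ultimately show ?thesis using ip_sym[OF f h] by simp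
qed

lemma total_orthonormal_gram_schmidt:
  assumes h: "\<And>n. h n \<in> H" and dense: "\<And>f. f \<in> H \<Longrightarrow> (\<And>n. ip f (h n) = 0) \<Longrightarrow> f = (\<lambda>x. 0)"
  shows "total_orthonormal (gram_schmidt ip h)"
  unfolding total_orthonormal_def
proof (intro conjI allI impI ballI)
  let ?g = "gram_schmidt ip h"
  note gs = gram_schmidt_orthonormal[of h, OF h] and sp = gram_schmidt_span[of h, OF h]
  show "?g n \<in> H" "ip (?g n) (?g n) \<in> {0, 1}" for n using gs by blast+
  show "ip (?g i) (?g j) = 0" if "i \<noteq> j" for i j
    using gs[of i] gs[of j] that ip_sym[of "?g i" "?g j"] by (cases "i < j") auto
  show "f = (\<lambda>x. 0)" if "f \<in> H" "\<forall>j. ip f (?g j) = 0" for f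
  proof (rule dense[OF that(1)])
    show "ip f (h n) = 0" for n using sp[OF that(1)] that(2) by blast
  qed
qed

end

lemma rkhs_continuous_on:
  fixes S :: "'a::topological_space set"
  assumes "rkhs S k H ip" and k: "continuous_on (S \<times> S) (\<lambda>(x, y). k x y)" and f: "f \<in> H"
  shows "continuous_on S f"
proof -
  interpret rkhs S k H ip by fact
  show ?thesis
    unfolding continuous_on_def
  proof
    fix x assume x: "x \<in> S"
    have c1: "((\<lambda>y. k x y) \<longlongrightarrow> k x x) (at x within S)"
    proof -
      have "continuous_on S (\<lambda>y. case (x, y) of (x, y) \<Rightarrow> k x y)"
        by (rule continuous_on_compose2[OF k]) (use x in \<open>auto intro!: continuous_intros\<close>)
      then show ?thesis using x by (simp add: continuous_on_def)
    qed
    have c2: "((\<lambda>y. k y y) \<longlongrightarrow> k x x) (at x within S)"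
    proof -
      have "continuous_on S (\<lambda>y. case (y, y) of (x, y) \<Rightarrow> k x y)"
        by (rule continuous_on_compose2[OF k]) (auto intro!: continuous_intros)
      then show ?thesis using x by (simp add: continuous_on_def)
    qed
    have "((\<lambda>y. ip f f * (k x x - 2 * k x y + k y y)) \<longlongrightarrow> ip f f * (k x x - 2 * k x x + k x x)) (at x within S)"
      by (intro tendsto_intros c1 c2)
    then have "((\<lambda>y. sqrt (ip f f * (k x x - 2 * k x y + k y y))) \<longlongrightarrow> 0) (at x within S)"
      using tendsto_real_sqrt by fastforce
    then have "((\<lambda>y. f y - f x) \<longlongrightarrow> 0) (at x within S)"
    proof (rule Lim_null_comparison[rotated])
      show "\<forall>\<^sub>F y in at x within S. norm (f y - f x) \<le> sqrt (ip f f * (k x x - 2 * k x y + k y y))"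
        unfolding eventually_at_filter
        using eval_diff_square_le[OF f x]
        by (intro always_eventually) (auto intro!: real_le_rsqrt simp: power2_commute)
    qed
    then show "(f \<longlongrightarrow> f x) (at x within S)" by (simp add: LIM_zero_iff)
  qed
qed

lemma rkhs_borel_measurable:
  fixes S :: "'a::topological_space set"
  assumes "rkhs S k H ip" "continuous_on (S \<times> S) (\<lambda>(x, y). k x y)" "closed S" "f \<in> H"
  shows "f \<in> borel_measurable borel"
proof -
  interpret rkhs S k H ip by fact
  have "(\<lambda>x. if x \<in> S then f x else 0) \<in> borel_measurable borel"
    using rkhs_continuous_on[OF assms(1,2,4)] assms(3)
    by (intro borel_measurable_continuous_on_if) (auto intro: borel_closed)
  also have "(\<lambda>x. if x \<in> S then f x else 0) = f" using zero_outside[OF assms(4)] by auto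
  finally show ?thesis .
qed

text \<open>
  Functions in the space are continuous, hence determined by their values on a countable dense set of
  points; so the features of these points span a dense subspace.
\<close>

lemma rkhs_total_orthonormal_exists:
  fixes S :: "'a::{metric_space, second_countable_topology} set"
  assumes rk: "rkhs S k H ip" and k: "continuous_on (S \<times> S) (\<lambda>(x, y). k x y)" and S: "S \<noteq> {}"
  shows "\<exists>g. rkhs.total_orthonormal H ip g"
proof -
  interpret rkhs S k H ip by fact
  obtain T where T: "countable T" "T \<subseteq> S" "S \<subseteq> closure T" using separable by blast
  then have "T \<noteq> {}" using S by auto
  then have d: "range (from_nat_into T) = T" using T(1) by (rule range_from_nat_into)
  define d where "d = from_nat_into T"
  note d = d[folded d_def]
  have dS: "d n \<in> S" for n using d T(2) by auto
  have "total_orthonormal (gram_schmidt ip (\<lambda>n. feature S k (d n)))"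
  proof (rule total_orthonormal_gram_schmidt)
    show "feature S k (d n) \<in> H" for n by (rule feature_mem[OF dS])
    fix f assume f: "f \<in> H" and 0: "\<And>n. ip f (feature S k (d n)) = 0"
    have T0: "f x = 0" if "x \<in> T" for x using 0 that d reproducing[OF f dS] by auto
    have cont: "continuous_on S f" by (rule rkhs_continuous_on[OF rk k f])
    have "f x = 0" for x
    proof (cases "x \<in> S")
      case True
      then obtain u where u: "\<And>n. u n \<in> T" "u \<longlonglongrightarrow> x" using T(3) closure_sequential[of x T] by blast
      have "(\<lambda>n. f (u n)) \<longlonglongrightarrow> f x"
        by (rule continuous_on_tendsto_compose[OF cont u(2) True]) (use subsetD[OF T(2) u(1)] in auto)
      then show ?thesis using T0[OF u(1)] by (simp add: LIMSEQ_const_iff)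
    qed (rule zero_outside[OF f])
    then show "f = (\<lambda>x. 0)" by auto
  qed
  then show ?thesis by blast
qed

section \<open>The covariance operator in the Mercer basis\<close>

text \<open>
  The data of the approximation problem without the sample: \<open>M\<close> is a probability measure on the
  closed set \<open>X\<close> and \<open>\<kappa>\<close> is the transition kernel for one time step. \<open>A\<close> is an upper bound of the diagonal of
  the reproducing kernel. The measure on \<open>Y\<close> is not involved.
\<close>

locale koopman_setting =
  HX: rkhs X k HX ipX + HY: rkhs Y k HY ipY + M: prob_space M
  for X Y :: "'a::euclidean_space set" and k HX ipX HY ipY and M :: "'a measure" +
  fixes \<kappa> :: "'a \<Rightarrow> 'a measure" and J :: "nat set" and e :: "nat \<Rightarrow> 'a \<Rightarrow> real" and lam :: "nat \<Rightarrow> real"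
    and A :: real
  assumes X: "closed X" and Y: "closed Y" "X \<subseteq> Y"
    and k_cont: "continuous_on (Y \<times> Y) (\<lambda>(x, y). k x y)" and k_le: "\<And>x. x \<in> Y \<Longrightarrow> k x x \<le> A"
    and sets_M: "sets M = sets (restrict_space borel X)"
    and \<kappa>: "\<kappa> \<in> measurable borel (prob_algebra borel)"
    and HX_injective: "\<And>\<psi>. \<psi> \<in> HX \<Longrightarrow> (AE x in M. \<psi> x = 0) \<Longrightarrow> \<psi> = (\<lambda>x. 0)"
    and mercer: "mercer_basis HX ipX M J e lam"
begin

text \<open>
  The trace of the covariance operator, which is the \<open>L\<^sup>1\<close> norm of the diagonal of the kernel.
\<close>

definition trace :: real where "trace = (\<integral>x. k x x \<partial>M)"

lemma space_M: "space M = X"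
  using sets_eq_imp_space_eq[OF sets_M] by (simp add: space_restrict_space)

lemma X_nonempty: "X \<noteq> {}"
  using M.not_empty space_M by simp

lemma kX_cont: "continuous_on (X \<times> X) (\<lambda>(x, y). k x y)"
  using k_cont by (rule continuous_on_subset) (use Y in auto)

lemma HX_borel: "f \<in> HX \<Longrightarrow> f \<in> borel_measurable borel"
  by (rule rkhs_borel_measurable[OF HX.rkhs_axioms kX_cont X])

lemma HY_borel: "f \<in> HY \<Longrightarrow> f \<in> borel_measurable borel"
  by (rule rkhs_borel_measurable[OF HY.rkhs_axioms k_cont Y(1)])

lemma borel_M: "f \<in> borel_measurable borel \<Longrightarrow> f \<in> borel_measurable M"
  unfolding measurable_cong_sets[OF sets_M refl] by (rule measurable_restrict_space1)

lemma HX_meas: "f \<in> HX \<Longrightarrow> f \<in> borel_measurable M"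
  by (intro borel_M HX_borel)

lemma A_nonneg: "0 \<le> A"
proof -
  obtain x where "x \<in> X" using X_nonempty by blast
  then have "x \<in> Y" using Y(2) by blast
  then show ?thesis using HY.kernel_diag_nonneg k_le order_trans by blast
qed

lemma kernel_diag_meas: "(\<lambda>x. k x x) \<in> borel_measurable M"
proof -
  have "continuous_on X (\<lambda>y. case (y, y) of (x, y) \<Rightarrow> k x y)"
    by (rule continuous_on_compose2[OF kX_cont]) (auto intro!: continuous_intros)
  then have "(\<lambda>x. k x x) \<in> borel_measurable (restrict_space borel X)"
    by (intro borel_measurable_continuous_on_restrict) simp
  then show ?thesis unfolding measurable_cong_sets[OF sets_M refl] .
qed

lemma kernel_diag_integrable: "integrable M (\<lambda>x. k x x)"
  using kernel_diag_meas k_le HX.kernel_diag_nonneg Y(2)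
  by (intro M.integrable_const_bound[of _ A]) (auto simp: space_M intro!: AE_I2)

lemma trace_le: "trace \<le> A"
proof -
  have "trace \<le> (\<integral>x. A \<partial>M)"
    unfolding trace_def using kernel_diag_integrable k_le Y(2)
    by (intro integral_mono) (auto simp: space_M)
  then show ?thesis by (simp add: M.prob_space)
qed

lemma trace_nonneg: "0 \<le> trace"
  unfolding trace_def using HX.kernel_diag_nonneg by (intro integral_nonneg_AE AE_I2) (auto simp: space_M)

lemma HX_abs_le: "f \<in> HX \<Longrightarrow> \<bar>f x\<bar> \<le> sqrt A * h_norm ipX f"
proof (cases "x \<in> X")
  case True
  assume f: "f \<in> HX"
  have "(f x)\<^sup>2 \<le> ipX f f * k x x" by (rule HX.eval_square_le[OF f True])
  also have "\<dots> \<le> ipX f f * A" using k_le[of x] True Y(2) HX.ip_nonneg[OF f] by (intro mult_left_mono) auto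
  finally have "sqrt ((f x)\<^sup>2) \<le> sqrt (ipX f f * A)" by (rule real_sqrt_le_mono)
  then show ?thesis by (simp add: h_norm_def real_sqrt_mult mult.commute)
next
  case False
  assume f: "f \<in> HX"
  then show ?thesis using HX.zero_outside[OF f False] A_nonneg HX.ip_nonneg[OF f] by (simp add: h_norm_def)
qed

lemma HY_abs_le: "f \<in> HY \<Longrightarrow> \<bar>f x\<bar> \<le> sqrt A * h_norm ipY f"
proof (cases "x \<in> Y")
  case True
  assume f: "f \<in> HY"
  have "(f x)\<^sup>2 \<le> ipY f f * k x x" by (rule HY.eval_square_le[OF f True])
  also have "\<dots> \<le> ipY f f * A" using k_le[of x] True HY.ip_nonneg[OF f] by (intro mult_left_mono) auto
  finally have "sqrt ((f x)\<^sup>2) \<le> sqrt (ipY f f * A)" by (rule real_sqrt_le_mono)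
  then show ?thesis by (simp add: h_norm_def real_sqrt_mult mult.commute)
next
  case False
  assume f: "f \<in> HY"
  then show ?thesis using HY.zero_outside[OF f False] A_nonneg HY.ip_nonneg[OF f] by (simp add: h_norm_def)
qed

lemma L2_bounded: "f \<in> borel_measurable M \<Longrightarrow> (\<And>x. \<bar>f x\<bar> \<le> B) \<Longrightarrow> f \<in> L2 M"
proof -
  assume f[measurable]: "f \<in> borel_measurable M" and B: "\<And>x. \<bar>f x\<bar> \<le> B"
  have "(f x)\<^sup>2 \<le> B\<^sup>2" for x using power_mono[OF B[of x], of 2] by simp
  then show ?thesis unfolding L2_def by (auto intro!: M.integrable_const_bound[of _ "B\<^sup>2"])
qed

lemma HX_L2: "f \<in> HX \<Longrightarrow> f \<in> L2 M"
  using HX_meas HX_abs_le by (intro L2_bounded[where B = "sqrt A * h_norm ipX f"]) auto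

lemma L2_mult_integrable: "f \<in> L2 M \<Longrightarrow> g \<in> L2 M \<Longrightarrow> integrable M (\<lambda>x. f x * g x)"
proof -
  assume f: "f \<in> L2 M" and g: "g \<in> L2 M"
  have [measurable]: "f \<in> borel_measurable M" "g \<in> borel_measurable M" using f g by (auto simp: L2_def)
  have "integrable M (\<lambda>x. (f x)\<^sup>2 + (g x)\<^sup>2)" using f g by (auto simp: L2_def)
  then show ?thesis
  proof (rule Bochner_Integration.integrable_bound)
    have "\<bar>a * b\<bar> \<le> a\<^sup>2 + b\<^sup>2" for a b :: real
    proof -
      have 1: "0 \<le> (\<bar>a\<bar> - \<bar>b\<bar>)\<^sup>2" and 2: "0 \<le> \<bar>a\<bar> * \<bar>b\<bar>" by simp_all
      from 1 have "2 * (\<bar>a\<bar> * \<bar>b\<bar>) \<le> a\<^sup>2 + b\<^sup>2" unfolding power2_diff by simp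
      with 2 show ?thesis unfolding abs_mult by linarith
    qed
    then show "AE x in M. norm (f x * g x) \<le> norm ((f x)\<^sup>2 + (g x)\<^sup>2)"
      by (intro AE_I2) (auto intro: order_trans[OF _ abs_ge_self])
  qed simp
qed

lemma l2_inner_cong_AE:
  assumes "f \<in> L2 M" "g \<in> L2 M" "h \<in> L2 M" "AE x in M. f x = g x"
  shows "l2_inner M f h = l2_inner M g h" "l2_inner M h f = l2_inner M h g"
proof -
  have [measurable]: "f \<in> borel_measurable M" "g \<in> borel_measurable M" "h \<in> borel_measurable M"
    using assms by (auto simp: L2_def)
  show "l2_inner M f h = l2_inner M g h" "l2_inner M h f = l2_inner M h g"
    unfolding l2_inner_def using assms(4) by (auto intro!: integral_cong_AE elim: eventually_mono)
qed

lemma l2_inner_sym: "l2_inner M f g = l2_inner M g f"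
  by (simp add: l2_inner_def mult.commute)

lemma l2_inner_scale: "l2_inner M (\<lambda>x. c * f x) g = c * l2_inner M f g"
  by (simp add: l2_inner_def mult.assoc)

lemma J_ge: "j \<in> J \<Longrightarrow> 1 \<le> j"
  using mercer by (auto simp: mercer_basis_def)

lemma lam_pos: "j \<in> J \<Longrightarrow> 0 < lam j"
  using mercer by (auto simp: mercer_basis_def)

lemma e_L2: "j \<in> J \<Longrightarrow> e j \<in> L2 M"
  using mercer by (auto simp: mercer_basis_def l2_orthonormal_basis_def)

text \<open>
  The Mercer eigenfunctions as orthonormal basis of the reproducing kernel Hilbert space, that is, the
  representatives of \<open>sqrt (lam j) * e j\<close>. They and the eigenvalues \<open>ev\<close> below are extended by \<open>0\<close> to
  indices outside \<open>J\<close>.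
\<close>

definition ef :: "nat \<Rightarrow> 'a \<Rightarrow> real" where
  "ef j = (if j \<in> J then (\<lambda>x. (1 / sqrt (lam j)) *
      (SOME g. is_incl_adjoint HX ipX M (e j) g \<and> (AE x in M. g x = lam j * e j x)) x) else (\<lambda>x. 0))"

text \<open>
  The eigenvalues of the covariance operator, extended by \<open>0\<close>.
\<close>

definition ev :: "nat \<Rightarrow> real" where "ev j = (if j \<in> J then lam j else 0)"

lemma ef_eigenfunction:
  assumes j: "j \<in> J"
  shows ef_mem': "ef j \<in> HX" and ip_ef': "\<eta> \<in> HX \<Longrightarrow> ipX \<eta> (ef j) = l2_inner M \<eta> (e j) / sqrt (lam j)"
    and ef_AE: "AE x in M. ef j x = sqrt (lam j) * e j x"
proof -
  define g where "g = (SOME g. is_incl_adjoint HX ipX M (e j) g \<and> (AE x in M. g x = lam j * e j x))"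
  have "\<exists>g. is_incl_adjoint HX ipX M (e j) g \<and> (AE x in M. g x = lam j * e j x)"
    using mercer j by (auto simp: mercer_basis_def)
  then have g: "is_incl_adjoint HX ipX M (e j) g" "AE x in M. g x = lam j * e j x"
    unfolding g_def by (rule someI2_ex, blast)+
  have ef: "ef j = (\<lambda>x. (1 / sqrt (lam j)) * g x)" using j by (simp add: ef_def g_def)
  have gH: "g \<in> HX" using g(1) by (simp add: is_incl_adjoint_def)
  show m: "ef j \<in> HX" unfolding ef by (rule HX.scale_mem[OF gH])
  show "ipX \<eta> (ef j) = l2_inner M \<eta> (e j) / sqrt (lam j)" if "\<eta> \<in> HX"
    unfolding HX.ip_sym[OF that m] unfolding ef HX.ip_scale[OF gH that] HX.ip_sym[OF gH that]
    using g(1) that by (simp add: is_incl_adjoint_def)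
  show "AE x in M. ef j x = sqrt (lam j) * e j x"
    using g(2)
  proof eventually_elim
    case (elim x)
    have "lam j / sqrt (lam j) = sqrt (lam j)" using lam_pos[OF j] by (simp add: real_div_sqrt)
    then show ?case unfolding ef elim by (metis divide_inverse inverse_eq_divide mult.assoc mult.commute)
  qed
qed

lemma ef_zero: "j \<notin> J \<Longrightarrow> ef j = (\<lambda>x. 0)"
  by (simp add: ef_def)

lemma ef_mem: "ef j \<in> HX"
  using ef_mem' ef_zero HX.zero_mem by (cases "j \<in> J") auto

lemma l2_inner_ef: 
  assumes "\<eta> \<in> HX" shows "l2_inner M \<eta> (ef j) = ev j * ipX \<eta> (ef j)"
proof (cases "j \<in> J")
  case True
  have se: "(\<lambda>x. sqrt (lam j) * e j x) \<in> L2 M"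
    using e_L2[OF True] by (auto simp: L2_def power_mult_distrib)
  have "l2_inner M \<eta> (ef j) = l2_inner M \<eta> (\<lambda>x. sqrt (lam j) * e j x)"
    by (rule l2_inner_cong_AE(2)[OF HX_L2[OF ef_mem] se HX_L2[OF assms] ef_AE[OF True]])
  also have "\<dots> = sqrt (lam j) * l2_inner M \<eta> (e j)"
    unfolding l2_inner_sym[of \<eta>] by (rule l2_inner_scale)
  also have "\<dots> = lam j * (l2_inner M \<eta> (e j) / sqrt (lam j))"
    using lam_pos[OF True] by (simp add: real_div_sqrt field_simps)
  finally show ?thesis using True by (simp add: ip_ef' assms ev_def)
qed (simp add: ef_zero ev_def l2_inner_def)

lemma ip_ef_ef: "ipX (ef i) (ef j) = (if i = j \<and> i \<in> J then 1 else 0)"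
proof (cases "i \<in> J \<and> j \<in> J")
  case True
  then have i: "i \<in> J" and j: "j \<in> J" by auto
  have se: "(\<lambda>x. sqrt (lam i) * e i x) \<in> L2 M"
    using e_L2[OF i] by (auto simp: L2_def power_mult_distrib)
  have "ipX (ef i) (ef j) = l2_inner M (ef i) (e j) / sqrt (lam j)" by (rule ip_ef'[OF j ef_mem])
  also have "l2_inner M (ef i) (e j) = l2_inner M (\<lambda>x. sqrt (lam i) * e i x) (e j)"
    by (rule l2_inner_cong_AE(1)[OF HX_L2[OF ef_mem] se e_L2[OF j] ef_AE[OF i]])
  also have "\<dots> = sqrt (lam i) * (if i = j then 1 else 0)"
    using mercer i j by (simp add: l2_inner_scale mercer_basis_def l2_orthonormal_basis_def)
  finally show ?thesis using lam_pos[OF i] i by auto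
next
  case False
  then show ?thesis
    using HX.ip_zero_left[OF ef_mem] HX.ip_zero_left[OF HX.zero_mem] HX.ip_sym[OF ef_mem HX.zero_mem]
      ef_zero by auto
qed

lemma ef_total: "HX.total_orthonormal ef"
  unfolding HX.total_orthonormal_def
proof (intro conjI allI ballI impI)
  show "f = (\<lambda>x. 0)" if f: "f \<in> HX" and z: "\<forall>j. ipX f (ef j) = 0" for f
  proof (rule HX_injective[OF f])
    have "l2_inner M f (e j) = 0" if "j \<in> J" for j
      using z ip_ef'[OF that f] lam_pos[OF that] by auto
    then show "AE x in M. f x = 0"
      using mercer HX_L2[OF f] by (auto simp: mercer_basis_def l2_orthonormal_basis_def)
  qed
qed (auto simp: ef_mem ip_ef_ef)

lemma ev_le: "ev j \<le> trace" and ev_nonneg: "0 \<le> ev j"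
proof -
  show "0 \<le> ev j" using lam_pos[of j] by (auto simp: ev_def)
  show "ev j \<le> trace"
  proof (cases "j \<in> J")
    case True
    have "ev j = (\<integral>x. ef j x * ef j x \<partial>M)"
      using l2_inner_ef[OF ef_mem, of j j] True by (simp add: ip_ef_ef l2_inner_def)
    also have "\<dots> \<le> (\<integral>x. k x x \<partial>M)"
    proof (rule integral_mono[OF L2_mult_integrable[OF HX_L2[OF ef_mem] HX_L2[OF ef_mem]] kernel_diag_integrable])
      fix x assume "x \<in> space M"
      then show "ef j x * ef j x \<le> k x x"
        using HX.eval_square_le[OF ef_mem[of j], of x] True by (simp add: space_M ip_ef_ef power2_eq_square)
    qed
    finally show ?thesis by (simp add: trace_def)
  qed (simp add: ev_def trace_nonneg)
qed

lemma abs_ev_le: "\<bar>ev j\<bar> \<le> trace"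
  using ev_le ev_nonneg by simp

text \<open>
  The isometry that maps a function to its coefficients in the eigenbasis. It turns the covariance
  operator into a diagonal operator.
\<close>

definition U :: "('a \<Rightarrow> real) \<Rightarrow> ell2" where "U \<eta> = Abs_ell2 (\<lambda>j. ipX \<eta> (ef j))"

lemma coord_U: "\<eta> \<in> HX \<Longrightarrow> coord (U \<eta>) j = ipX \<eta> (ef j)"
proof -
  assume "\<eta> \<in> HX"
  then have "summable (\<lambda>j. (ipX \<eta> (ef j))\<^sup>2)"
    using sums_summable[OF HX.parseval[OF ef_total, of \<eta> \<eta>]] by (simp add: power2_eq_square)
  then show ?thesis by (simp add: U_def coord_Abs)
qed

lemma inner_U: "\<eta> \<in> HX \<Longrightarrow> \<zeta> \<in> HX \<Longrightarrow> U \<eta> \<bullet> U \<zeta> = ipX \<eta> \<zeta>"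
  using inner_ell2_sums[of "U \<eta>" "U \<zeta>"] HX.parseval[OF ef_total, of \<eta> \<zeta>]
  by (simp add: coord_U sums_unique2)

lemma U_lincomb:
  assumes "\<And>i. i \<in> I \<Longrightarrow> f i \<in> HX"
  shows "U (\<lambda>x. \<Sum>i\<in>I. c i * f i x) = (\<Sum>i\<in>I. c i *\<^sub>R U (f i))"
  by (rule ell2_eqI) (simp add: coord_U HX.lincomb_mem HX.ip_lincomb ef_mem assms coord_sum coord_scaleR')

lemma U_feature_inner: "\<eta> \<in> HX \<Longrightarrow> x \<in> X \<Longrightarrow> U \<eta> \<bullet> U (feature X k x) = \<eta> x"
  by (simp add: inner_U HX.feature_mem HX.reproducing)

lemma coord_U_feature: "x \<in> X \<Longrightarrow> coord (U (feature X k x)) j = ef j x"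
  by (simp add: coord_U HX.feature_mem HX.ip_sym[OF HX.feature_mem ef_mem] HX.reproducing ef_mem)

lemma U_diff: "f \<in> HX \<Longrightarrow> g \<in> HX \<Longrightarrow> U (\<lambda>x. f x - g x) = U f - U g"
  by (rule ell2_eqI) (simp add: coord_U HX.diff_mem HX.ip_diff ef_mem coord_diff')

lemma U_ef: "j \<in> J \<Longrightarrow> U (ef j) = unit_ell2 j"
  by (rule ell2_eqI) (auto simp: coord_U ef_mem ip_ef_ef coord_unit)

lemma l2_inner_add: "f \<in> HX \<Longrightarrow> g \<in> HX \<Longrightarrow> h \<in> HX \<Longrightarrow> l2_inner M (\<lambda>x. f x - g x) h = l2_inner M f h - l2_inner M g h"
  by (simp add: l2_inner_def left_diff_distrib L2_mult_integrable HX_L2)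

lemma l2_inner_U:
  assumes \<eta>: "\<eta> \<in> HX" and \<zeta>: "\<zeta> \<in> HX"
  shows "l2_inner M \<eta> \<zeta> = U \<eta> \<bullet> diag_ell2 ev (U \<zeta>)"
proof -
  have "(\<lambda>n. l2_inner M (HX.partial ef \<eta> {..<n}) \<zeta>) \<longlonglongrightarrow> l2_inner M \<eta> \<zeta>"
  proof (rule HX.functional_partial_tendsto[OF ef_total \<eta>, where c = "A * h_norm ipX \<zeta>"])
    fix h assume h: "h \<in> HX"
    show "l2_inner M (\<lambda>x. h x - \<eta> x) \<zeta> = l2_inner M h \<zeta> - l2_inner M \<eta> \<zeta>" by (rule l2_inner_add[OF h \<eta> \<zeta>])
    let ?d = "\<lambda>x. h x - \<eta> x"
    have d: "?d \<in> HX" by (intro HX.diff_mem h \<eta>)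
    have "\<bar>l2_inner M ?d \<zeta>\<bar> \<le> (\<integral>x. \<bar>?d x * \<zeta> x\<bar> \<partial>M)"
      unfolding l2_inner_def by (rule integral_abs_bound)
    also have "\<dots> \<le> (\<integral>x. A * h_norm ipX \<zeta> * h_norm ipX ?d \<partial>M)"
    proof (rule integral_mono)
      show "integrable M (\<lambda>x. \<bar>?d x * \<zeta> x\<bar>)" by (intro integrable_abs L2_mult_integrable HX_L2 d \<zeta>)
      fix x
      have "\<bar>?d x * \<zeta> x\<bar> \<le> (sqrt A * h_norm ipX ?d) * (sqrt A * h_norm ipX \<zeta>)"
        unfolding abs_mult using HX_abs_le[OF d] HX_abs_le[OF \<zeta>] A_nonneg HX.ip_nonneg[OF d]
        by (intro mult_mono) (auto simp: h_norm_def)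
      also have "\<dots> = (sqrt A * sqrt A) * h_norm ipX \<zeta> * h_norm ipX ?d" by (simp only: mult_ac)
      also have "sqrt A * sqrt A = A" using A_nonneg by simp
      finally show "\<bar>?d x * \<zeta> x\<bar> \<le> A * h_norm ipX \<zeta> * h_norm ipX ?d" .
    qed simp
    finally show "\<bar>l2_inner M ?d \<zeta>\<bar> \<le> A * h_norm ipX \<zeta> * sqrt (ipX ?d ?d)"
      by (simp add: h_norm_def M.prob_space)
  qed
  moreover have "l2_inner M (HX.partial ef \<eta> {..<n}) \<zeta> = (\<Sum>j<n. ipX \<eta> (ef j) * (ev j * ipX \<zeta> (ef j)))" for n
  proof -
    have "l2_inner M (HX.partial ef \<eta> {..<n}) \<zeta> = (\<Sum>j<n. ipX \<eta> (ef j) * l2_inner M (ef j) \<zeta>)"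
      unfolding l2_inner_def HX.partial_def[OF ef_total] sum_distrib_right
      by (subst Bochner_Integration.integral_sum)
        (auto simp: mult.assoc intro!: integrable_mult_right L2_mult_integrable HX_L2 ef_mem \<zeta>)
    then show ?thesis by (simp add: l2_inner_sym[of "ef _"] l2_inner_ef[OF \<zeta>])
  qed
  ultimately have "(\<lambda>j. ipX \<eta> (ef j) * (ev j * ipX \<zeta> (ef j))) sums l2_inner M \<eta> \<zeta>"
    by (simp add: sums_def)
  with inner_ell2_sums[of "U \<eta>" "diag_ell2 ev (U \<zeta>)"] show ?thesis
    by (simp add: coord_U coord_diag[OF abs_ev_le] \<eta> \<zeta> sums_unique2)
qed

lemma l2_norm_U: "\<eta> \<in> HX \<Longrightarrow> l2_norm M \<eta> = norm (diag_ell2 (\<lambda>n. sqrt (ev n)) (U \<eta>))"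
  using norm_diag_sqrt[of ev trace "U \<eta>"] ev_nonneg ev_le
  by (simp add: l2_norm_def l2_inner_U real_sqrt_unique)

end

section \<open>The Koopman operator and the cross-covariance\<close>

context koopman_setting
begin

text \<open>
  The law of a single data point.
\<close>

definition nu :: "('a \<times> 'a) measure" where "nu = joint_law M \<kappa>"

text \<open>
  The coefficients of the image of \<open>\<psi>\<close> under the cross-covariance operator.
\<close>

definition cross :: "('a \<Rightarrow> real) \<Rightarrow> nat \<Rightarrow> real" where
  "cross \<psi> j = (\<integral>z. ef j (fst z) * \<psi> (snd z) \<partial>nu)"

lemma \<kappa>_prob: "prob_space (\<kappa> x)" and \<kappa>_sets: "sets (\<kappa> x) = sets borel"
  using measurable_space[OF \<kappa>, of x] by (simp_all add: space_prob_algebra)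

lemma \<kappa>_M: "\<kappa> \<in> measurable M (subprob_algebra borel)"
  unfolding measurable_cong_sets[OF sets_M refl]
  by (intro measurable_restrict_space1 measurable_prob_algebraD \<kappa>)

lemma ident_M: "(\<lambda>x. x) \<in> measurable M borel"
  unfolding measurable_cong_sets[OF sets_M refl] by (intro measurable_restrict_space1) simp

lemma joint_kernel: "(\<lambda>x. distr (\<kappa> x) (borel \<Otimes>\<^sub>M borel) (\<lambda>y. (x, y))) \<in> measurable M (subprob_algebra (borel \<Otimes>\<^sub>M borel))"
proof (rule measurable_distr2[OF _ \<kappa>_M])
  have "(\<lambda>z. (fst z, snd z)) \<in> M \<Otimes>\<^sub>M borel \<rightarrow>\<^sub>M borel \<Otimes>\<^sub>M borel"
    by (intro measurable_Pair measurable_compose[OF measurable_fst ident_M] measurable_snd)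
  then show "case_prod Pair \<in> M \<Otimes>\<^sub>M borel \<rightarrow>\<^sub>M borel \<Otimes>\<^sub>M borel" by (simp add: case_prod_beta')
qed

lemma Pair_\<kappa>: "(\<lambda>y. (x, y)) \<in> \<kappa> x \<rightarrow>\<^sub>M borel \<Otimes>\<^sub>M borel"
  unfolding measurable_cong_sets[OF \<kappa>_sets refl] by simp

lemma sets_nu: "sets nu = sets (borel \<Otimes>\<^sub>M borel)"
  unfolding nu_def joint_law_def by (rule sets_bind) (use M.not_empty in auto)

lemma prob_space_nu: "prob_space nu"
  unfolding nu_def joint_law_def
  by (rule M.prob_space_bind[OF _ joint_kernel])
    (auto intro!: AE_I2 prob_space.prob_space_distr \<kappa>_prob Pair_\<kappa>)

lemma integral_nu:
  assumes F: "F \<in> borel_measurable (borel \<Otimes>\<^sub>M borel)" and B: "\<And>z. \<bar>F z\<bar> \<le> (B :: real)"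
  shows "integrable nu F" "integral\<^sup>L nu F = (\<integral>x. (\<integral>y. F (x, y) \<partial>\<kappa> x) \<partial>M)"
proof -
  have b: "AE x in M. emeasure (distr (\<kappa> x) (borel \<Otimes>\<^sub>M borel) (\<lambda>y. (x, y)))
      (space (distr (\<kappa> x) (borel \<Otimes>\<^sub>M borel) (\<lambda>y. (x, y)))) \<le> ennreal 1"
    using prob_space.emeasure_space_1[OF prob_space.prob_space_distr[OF \<kappa>_prob Pair_\<kappa>]]
    by (intro AE_I2) simp
  show "integrable nu F"
    unfolding nu_def joint_law_def by (rule integrable_bind[OF F B joint_kernel M.finite_measure b])
  have "integral\<^sup>L nu F = (\<integral>x. integral\<^sup>L (distr (\<kappa> x) (borel \<Otimes>\<^sub>M borel) (\<lambda>y. (x, y))) F \<partial>M)"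
    unfolding nu_def joint_law_def by (rule integral_bind[OF F B joint_kernel M.finite_measure b])
  then show "integral\<^sup>L nu F = (\<integral>x. (\<integral>y. F (x, y) \<partial>\<kappa> x) \<partial>M)"
    by (simp add: integral_distr[OF Pair_\<kappa> F])
qed

lemma integral_nu_fst:
  assumes F: "F \<in> borel_measurable borel" and B: "\<And>z. \<bar>F z\<bar> \<le> (B :: real)"
  shows "(\<integral>z. F (fst z) \<partial>nu) = integral\<^sup>L M F"
proof -
  have "(\<lambda>z. F (fst z)) \<in> borel_measurable (borel \<Otimes>\<^sub>M borel)" using F by measurable
  from integral_nu(2)[OF this B] show ?thesis
    by (simp add: prob_space.prob_space[OF \<kappa>_prob])
qed

lemma koopman_eq: "\<psi> \<in> HY \<Longrightarrow> koopman Y \<kappa> \<psi> x = integral\<^sup>L (\<kappa> x) \<psi>"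
  unfolding koopman_def set_lebesgue_integral_def
  by (intro Bochner_Integration.integral_cong) (auto simp: indicator_def HY.zero_outside)

lemma koopman_meas: "\<psi> \<in> HY \<Longrightarrow> koopman Y \<kappa> \<psi> \<in> borel_measurable M"
  using measurable_compose[OF \<kappa>_M integral_measurable_subprob_algebra[OF HY_borel, of \<psi>]]
  by (simp add: koopman_eq cong: measurable_cong)

lemma koopman_abs_le: "\<psi> \<in> HY \<Longrightarrow> \<bar>koopman Y \<kappa> \<psi> x\<bar> \<le> sqrt A * h_norm ipY \<psi>"
proof -
  assume \<psi>: "\<psi> \<in> HY"
  interpret K: prob_space "\<kappa> x" by (rule \<kappa>_prob)
  have m: "\<psi> \<in> borel_measurable (\<kappa> x)"
    unfolding measurable_cong_sets[OF \<kappa>_sets refl] by (rule HY_borel[OF \<psi>])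
  have i: "integrable (\<kappa> x) \<psi>"
    using HY_abs_le[OF \<psi>] by (intro K.integrable_const_bound[OF _ m, of "sqrt A * h_norm ipY \<psi>"]) auto
  have "\<bar>integral\<^sup>L (\<kappa> x) \<psi>\<bar> \<le> (\<integral>y. \<bar>\<psi> y\<bar> \<partial>\<kappa> x)" by (rule integral_abs_bound)
  also have "\<dots> \<le> (\<integral>y. sqrt A * h_norm ipY \<psi> \<partial>\<kappa> x)"
    using i HY_abs_le[OF \<psi>] by (intro integral_mono) auto
  finally show ?thesis by (simp add: koopman_eq[OF \<psi>] K.prob_space)
qed

lemma koopman_L2: "\<psi> \<in> HY \<Longrightarrow> koopman Y \<kappa> \<psi> \<in> L2 M"
  using koopman_meas koopman_abs_le by (rule L2_bounded)

lemma product_meas: "f \<in> HX \<Longrightarrow> \<psi> \<in> HY \<Longrightarrow> (\<lambda>z. f (fst z) * \<psi> (snd z)) \<in> borel_measurable (borel \<Otimes>\<^sub>M borel)"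
  using HX_borel[of f] HY_borel[of \<psi>] by measurable

lemma product_bound: "f \<in> HX \<Longrightarrow> \<psi> \<in> HY \<Longrightarrow> \<bar>f x * \<psi> y\<bar> \<le> A * h_norm ipX f * h_norm ipY \<psi>"
proof -
  assume f: "f \<in> HX" and \<psi>: "\<psi> \<in> HY"
  have "\<bar>f x * \<psi> y\<bar> \<le> (sqrt A * h_norm ipX f) * (sqrt A * h_norm ipY \<psi>)"
    unfolding abs_mult using HX_abs_le[OF f] HY_abs_le[OF \<psi>] A_nonneg HX.ip_nonneg[OF f]
    by (intro mult_mono) (auto simp: h_norm_def)
  also have "\<dots> = (sqrt A * sqrt A) * h_norm ipX f * h_norm ipY \<psi>" by (simp only: mult_ac)
  also have "sqrt A * sqrt A = A" using A_nonneg by simp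
  finally show ?thesis .
qed

lemma product_integrable: "f \<in> HX \<Longrightarrow> \<psi> \<in> HY \<Longrightarrow> integrable nu (\<lambda>z. f (fst z) * \<psi> (snd z))"
  by (rule integral_nu(1)[OF product_meas product_bound])

lemma cross_koopman: "\<psi> \<in> HY \<Longrightarrow> cross \<psi> j = l2_inner M (ef j) (koopman Y \<kappa> \<psi>)"
  unfolding cross_def integral_nu(2)[OF product_meas product_bound, OF ef_mem _ ef_mem] l2_inner_def
  by (simp add: koopman_eq)

lemma koopman_coeff:
  assumes \<psi>: "\<psi> \<in> HY" and j: "j \<in> J"
  shows "l2_inner M (koopman Y \<kappa> \<psi>) (e j) = cross \<psi> j / sqrt (lam j)"
proof -
  have se: "(\<lambda>x. sqrt (lam j) * e j x) \<in> L2 M"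
    using e_L2[OF j] by (auto simp: L2_def power_mult_distrib)
  have "cross \<psi> j = l2_inner M (\<lambda>x. sqrt (lam j) * e j x) (koopman Y \<kappa> \<psi>)"
    unfolding cross_koopman[OF \<psi>]
    by (rule l2_inner_cong_AE(1)[OF HX_L2[OF ef_mem] se koopman_L2[OF \<psi>] ef_AE[OF j]])
  then show ?thesis using lam_pos[OF j] by (simp add: l2_inner_scale l2_inner_sym[of "e j"])
qed

lemma L2_lincomb: "finite I \<Longrightarrow> (\<And>i. i \<in> I \<Longrightarrow> f i \<in> L2 M) \<Longrightarrow> (\<lambda>x. \<Sum>i\<in>I. c i * f i x) \<in> L2 M"
proof (induction I rule: finite_induct)
  case (insert i I)
  have add: "(\<lambda>x. f x + g x) \<in> L2 M" if "f \<in> L2 M" "g \<in> L2 M" for f g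
  proof -
    have "(\<lambda>x. (f x + g x)\<^sup>2) = (\<lambda>x. (f x)\<^sup>2 + (g x)\<^sup>2 + 2 * (f x * g x))"
      by (simp add: power2_sum mult.assoc)
    moreover have "integrable M (\<lambda>x. (f x)\<^sup>2 + (g x)\<^sup>2 + 2 * (f x * g x))"
      using that L2_mult_integrable[OF that] by (auto simp: L2_def)
    ultimately show ?thesis using that by (auto simp: L2_def)
  qed
  have sc: "(\<lambda>x. c i * f i x) \<in> L2 M"
    using insert.prems[of i] by (auto simp: L2_def power_mult_distrib)
  show ?case using insert add[OF sc, of "\<lambda>x. \<Sum>i\<in>I. c i * f i x"] by simp
qed (simp add: L2_def)

lemma l2_inner_lincomb_right:
  assumes "F \<in> L2 M" "\<And>i. i \<in> I \<Longrightarrow> f i \<in> L2 M"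
  shows "l2_inner M F (\<lambda>x. \<Sum>i\<in>I. c i * f i x) = (\<Sum>i\<in>I. c i * l2_inner M F (f i))"
proof -
  have "(\<lambda>x. F x * (\<Sum>i\<in>I. c i * f i x)) = (\<lambda>x. \<Sum>i\<in>I. c i * (F x * f i x))"
    unfolding sum_distrib_left by (simp add: mult_ac)
  then show ?thesis
    unfolding l2_inner_def using L2_mult_integrable[OF assms] by simp
qed

lemma l2_proj_eq:
  assumes F: "F \<in> L2 M" and r: "{1..r} \<subseteq> J"
  shows "l2_proj M e r F = (\<lambda>x. \<Sum>j=1..r. l2_inner M F (e j) * e j x)"
proof -
  have on: "l2_inner M (e i) (e j) = (if i = j then 1 else 0)" if "i \<in> {1..r}" "j \<in> {1..r}" for i j
    using mercer that r by (auto simp: mercer_basis_def l2_orthonormal_basis_def)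
  have eL: "e j \<in> L2 M" if "j \<in> {1..r}" for j using e_L2 that r by auto
  have res: "l2_inner M (\<lambda>x. F x - (\<Sum>j=1..r. a j * e j x)) (e i) = l2_inner M F (e i) - a i"
    if i: "i \<in> {1..r}" for a i
  proof -
    have ii: "integrable M (\<lambda>x. a j * e j x * e i x)" if "j \<in> {1..r}" for j
      using L2_mult_integrable[OF eL[OF that] eL[OF i]] by (simp add: mult.assoc)
    have "l2_inner M (\<lambda>x. F x - (\<Sum>j=1..r. a j * e j x)) (e i)
        = l2_inner M F (e i) - (\<Sum>j=1..r. a j * l2_inner M (e j) (e i))"
      unfolding l2_inner_def left_diff_distrib sum_distrib_right
      using ii L2_mult_integrable[OF F eL[OF i]]
      by (subst Bochner_Integration.integral_diff) (auto simp: mult.assoc)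
    also have "(\<Sum>j=1..r. a j * l2_inner M (e j) (e i)) = (\<Sum>j=1..r. if j = i then a j else 0)"
      using i by (intro sum.cong) (auto simp: on)
    finally show ?thesis using i by simp
  qed
  let ?g = "\<lambda>x. \<Sum>j=1..r. l2_inner M F (e j) * e j x"
  let ?P = "\<lambda>g. g \<in> fun_span e r \<and> (\<forall>h\<in>fun_span e r. l2_inner M (\<lambda>x. F x - g x) h = 0)"
  have "?P ?g"
  proof (intro conjI ballI)
    show "?g \<in> fun_span e r"
      unfolding fun_span_def by (intro CollectI exI[of _ "\<lambda>j. l2_inner M F (e j)"]) simp
    fix h assume "h \<in> fun_span e r"
    then obtain b where h: "h = (\<lambda>x. \<Sum>j=1..r. b j * e j x)" unfolding fun_span_def by blast
    have gL: "?g \<in> L2 M" by (intro L2_lincomb eL) auto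
    have "(\<lambda>x. F x - ?g x) = (\<lambda>x. \<Sum>i\<in>{0,1}. (if i = 0 then 1 else -1) * (if i = (0::nat) then F x else ?g x))"
      by auto
    also have "\<dots> \<in> L2 M"
      using L2_lincomb[of "{0,1::nat}" "\<lambda>i. if i = 0 then F else ?g" "\<lambda>i. if i = 0 then 1 else -1"] F gL
      by (simp add: if_distribR cong: if_cong)
    finally have d: "(\<lambda>x. F x - ?g x) \<in> L2 M" .
    have "l2_inner M (\<lambda>x. F x - ?g x) h = (\<Sum>i=1..r. b i * l2_inner M (\<lambda>x. F x - ?g x) (e i))"
      unfolding h by (rule l2_inner_lincomb_right[OF d eL])
    also have "\<dots> = 0"
    proof (intro sum.neutral ballI)
      fix i assume i: "i \<in> {1..r}"
      show "b i * l2_inner M (\<lambda>x. F x - ?g x) (e i) = 0" unfolding res[OF i] by simp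
    qed
    finally show "l2_inner M (\<lambda>x. F x - ?g x) h = 0" .
  qed
  then have P: "?P (l2_proj M e r F)" unfolding l2_proj_def by (rule someI[of ?P])
  then obtain a where a: "l2_proj M e r F = (\<lambda>x. \<Sum>j=1..r. a j * e j x)" unfolding fun_span_def by blast
  have "a i = l2_inner M F (e i)" if i: "i \<in> {1..r}" for i
  proof -
    have "e i = (\<lambda>x. \<Sum>j=1..r. (if j = i then 1 else 0) * e j x)"
      using i by (auto simp: if_distrib[of "\<lambda>x. x * _"] cong: if_cong)
    then have "e i \<in> fun_span e r"
      unfolding fun_span_def by (intro CollectI exI[of _ "\<lambda>j. if j = i then 1 else 0"]) simp
    with P have "l2_inner M (\<lambda>x. F x - (\<Sum>j=1..r. a j * e j x)) (e i) = 0" unfolding a by blast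
    then show ?thesis using res[OF i, of a] by simp
  qed
  then show ?thesis unfolding a by simp
qed

lemma sqrt_diag_integral_le:
  assumes "0 < trace" shows "integrable M (\<lambda>x. sqrt (k x x))" "(\<integral>x. sqrt (k x x) \<partial>M) \<le> sqrt trace"
proof -
  note [measurable] = kernel_diag_meas
  show i: "integrable M (\<lambda>x. sqrt (k x x))"
    using k_le HX.kernel_diag_nonneg Y(2)
    by (intro M.integrable_const_bound[of _ "sqrt A"]) (auto simp: space_M intro!: AE_I2)
  \<comment> \<open>inequality of arithmetic and geometric mean for \<open>k x x / sqrt trace\<close> and \<open>sqrt trace\<close>\<close>
  have "(\<integral>x. sqrt (k x x) \<partial>M) \<le> (\<integral>x. (k x x / sqrt trace + sqrt trace) / 2 \<partial>M)"
  proof (rule integral_mono[OF i])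
    show "integrable M (\<lambda>x. (k x x / sqrt trace + sqrt trace) / 2)"
      using kernel_diag_integrable by simp
    fix x assume "x \<in> space M"
    then have k0: "0 \<le> k x x" using HX.kernel_diag_nonneg by (simp add: space_M)
    have "0 \<le> (sqrt (k x x) - sqrt trace)\<^sup>2" by simp
    then have "2 * sqrt (k x x) * sqrt trace \<le> k x x + trace"
      using k0 assms by (simp add: power2_diff)
    then have "2 * sqrt (k x x) * sqrt trace / sqrt trace \<le> (k x x + trace) / sqrt trace"
      using assms by (intro divide_right_mono) auto
    moreover have "2 * sqrt (k x x) * sqrt trace / sqrt trace = 2 * sqrt (k x x)" using assms by simp
    moreover have "trace / sqrt trace = sqrt trace" using assms by (simp add: real_div_sqrt)
    ultimately show "sqrt (k x x) \<le> (k x x / sqrt trace + sqrt trace) / 2"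
      by (simp add: add_divide_distrib)
  qed
  also have "\<dots> = (trace / sqrt trace + sqrt trace) / 2"
    using kernel_diag_integrable by (simp add: M.prob_space trace_def)
  also have "\<dots> = sqrt trace" using assms by (simp add: real_div_sqrt)
  finally show "(\<integral>x. sqrt (k x x) \<partial>M) \<le> sqrt trace" .
qed

text \<open>
  By duality, the cross-covariance operator has norm at most \<open>sqrt (trace * A)\<close>.
\<close>

lemma cross_combination_le:
  assumes \<psi>: "\<psi> \<in> HY" and t: "0 < trace"
  shows "(\<Sum>j<n. v j * cross \<psi> j) \<le> sqrt (\<Sum>j<n. (v j)\<^sup>2) * (sqrt (trace * A) * h_norm ipY \<psi>)"
proof -
  let ?v = "\<lambda>x. \<Sum>j<n. v j * ef j x" and ?K = "koopman Y \<kappa> \<psi>" and ?s = "sqrt (\<Sum>j<n. (v j)\<^sup>2)"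
  have vH: "?v \<in> HX" by (intro HX.lincomb_mem ef_mem)
  have n0: "0 \<le> h_norm ipY \<psi>" by (simp add: h_norm_def HY.ip_nonneg[OF \<psi>])
  have "ipX ?v ?v = (\<Sum>j<n. v j * ipX (ef j) ?v)" by (rule HX.ip_lincomb[OF ef_mem vH])
  also have "\<dots> = (\<Sum>j<n. v j * (\<Sum>i<n. v i * ipX (ef i) (ef j)))"
    by (simp add: HX.ip_sym[OF ef_mem vH] HX.ip_lincomb ef_mem)
  also have "\<dots> \<le> (\<Sum>j<n. (v j)\<^sup>2)"
  proof (rule sum_mono)
    fix j assume "j \<in> {..<n}"
    have "(\<Sum>i<n. v i * ipX (ef i) (ef j)) = (\<Sum>i<n. if i = j then v i * (if j \<in> J then 1 else 0) else 0)"
      by (intro sum.cong) (auto simp: ip_ef_ef)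
    then have "(\<Sum>i<n. v i * ipX (ef i) (ef j)) = v j * (if j \<in> J then 1 else 0)"
      using \<open>j \<in> {..<n}\<close> by simp
    then show "v j * (\<Sum>i<n. v i * ipX (ef i) (ef j)) \<le> (v j)\<^sup>2" by (simp add: power2_eq_square)
  qed
  finally have ipv: "ipX ?v ?v \<le> (\<Sum>j<n. (v j)\<^sup>2)" .
  have iK: "integrable M (\<lambda>x. ?v x * ?K x)" by (intro L2_mult_integrable HX_L2 vH koopman_L2 \<psi>)
  have "(\<Sum>j<n. v j * cross \<psi> j) = (\<integral>x. ?v x * ?K x \<partial>M)"
    unfolding cross_koopman[OF \<psi>] l2_inner_def sum_distrib_right
    by (subst Bochner_Integration.integral_sum)
      (auto simp: mult.assoc intro!: integrable_mult_right L2_mult_integrable HX_L2 ef_mem koopman_L2 \<psi>)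
  also have "\<dots> \<le> (\<integral>x. ?s * (sqrt A * h_norm ipY \<psi>) * sqrt (k x x) \<partial>M)"
  proof (rule integral_mono[OF iK])
    show "integrable M (\<lambda>x. ?s * (sqrt A * h_norm ipY \<psi>) * sqrt (k x x))"
      using sqrt_diag_integral_le(1)[OF t] by simp
    fix x assume "x \<in> space M"
    then have x: "x \<in> X" by (simp add: space_M)
    have "(?v x)\<^sup>2 \<le> (\<Sum>j<n. (v j)\<^sup>2) * k x x"
      using HX.eval_square_le[OF vH x] mult_right_mono[OF ipv HX.kernel_diag_nonneg[OF x]] by linarith
    then have "sqrt ((?v x)\<^sup>2) \<le> sqrt ((\<Sum>j<n. (v j)\<^sup>2) * k x x)" by (rule real_sqrt_le_mono)
    then have 1: "\<bar>?v x\<bar> \<le> ?s * sqrt (k x x)" by (simp add: real_sqrt_mult)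
    have "?v x * ?K x \<le> \<bar>?v x\<bar> * \<bar>?K x\<bar>" unfolding abs_mult[symmetric] by (rule abs_ge_self)
    also have "\<dots> \<le> (?s * sqrt (k x x)) * (sqrt A * h_norm ipY \<psi>)"
      by (intro mult_mono 1 koopman_abs_le \<psi>) (auto simp: HX.kernel_diag_nonneg[OF x] sum_nonneg)
    finally show "?v x * ?K x \<le> ?s * (sqrt A * h_norm ipY \<psi>) * sqrt (k x x)" by (simp only: mult_ac)
  qed
  also have "\<dots> = ?s * (sqrt A * h_norm ipY \<psi>) * (\<integral>x. sqrt (k x x) \<partial>M)" by simp
  also have "\<dots> \<le> ?s * (sqrt A * h_norm ipY \<psi>) * sqrt trace"
    using n0 A_nonneg by (intro mult_left_mono sqrt_diag_integral_le(2)[OF t] mult_nonneg_nonneg)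
      (auto simp: sum_nonneg)
  finally show ?thesis by (simp add: real_sqrt_mult mult_ac)
qed

end

section \<open>The estimator for a fixed sample\<close>

context koopman_setting
begin

lemma J_down: "r + 1 \<in> J \<Longrightarrow> {1..r + 1} \<subseteq> J"
  using mercer by (auto simp: mercer_basis_def)

lemma lam_antimono: "i \<in> J \<Longrightarrow> j \<in> J \<Longrightarrow> i \<le> j \<Longrightarrow> lam j \<le> lam i"
  using mercer by (auto simp: mercer_basis_def)

lemma emp_cov_eq: "emp_cov X k m x y \<psi> = (\<lambda>z. \<Sum>i<m. (\<psi> (y i) / real m) * feature X k (x i) z)"
  unfolding emp_cov_def sum_distrib_left by (simp add: mult_ac divide_inverse)

context
  fixes m :: nat and x y :: "nat \<Rightarrow> 'a" and \<epsilon> :: real and g :: "nat \<Rightarrow> 'a \<Rightarrow> real"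
  assumes x: "\<And>i. i < m \<Longrightarrow> x i \<in> X" and m: "0 < m" and \<epsilon>: "0 \<le> \<epsilon>"
    and g: "HY.total_orthonormal g"
    and cov: "\<And>n. (\<Sum>j<n. \<Sum>l<n. ((\<Sum>i<m. ef j (x i) * ef l (x i)) / real m
        - (if j = l then ev j else 0))\<^sup>2) \<le> \<epsilon>\<^sup>2"
    and cross_cov: "\<And>n. (\<Sum>j<n. \<Sum>l<n. ((\<Sum>i<m. ef j (x i) * g l (y i)) / real m - cross (g l) j)\<^sup>2) \<le> \<epsilon>\<^sup>2"
begin

text \<open>
  The feature vectors of the sample in coordinates.
\<close>

definition w :: "nat \<Rightarrow> ell2" where "w i = U (feature X k (x i))"

lemma coord_w: "i < m \<Longrightarrow> coord (w i) j = ef j (x i)"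
  unfolding w_def by (intro coord_U_feature x)

lemma emp_cov_mem: "emp_cov X k m x y' \<psi> \<in> HX"
  unfolding emp_cov_eq by (intro HX.lincomb_mem HX.feature_mem x) simp

lemma U_emp_cov: "U (emp_cov X k m x y' \<psi>) = (\<Sum>i<m. (\<psi> (y' i) / real m) *\<^sub>R w i)"
  unfolding emp_cov_eq w_def by (intro U_lincomb HX.feature_mem x) simp

lemma U_emp_cov_op: "\<eta> \<in> HX \<Longrightarrow> U (emp_cov X k m x x \<eta>) = emp_op m w (U \<eta>)"
  unfolding U_emp_cov emp_op_def scaleR_sum_right
  by (intro sum.cong refl) (simp add: w_def U_feature_inner x)

lemma emp_op_close: "norm (emp_op m w a - diag_ell2 ev a) \<le> \<epsilon> * norm a"
proof (rule norm_ell2_leI)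
  define E where "E j l = (\<Sum>i<m. ef j (x i) * ef l (x i)) / real m - (if j = l then ev j else 0)" for j l
  have "(\<Sum>j<n. (coord (emp_op m w a - diag_ell2 ev a) j)\<^sup>2) \<le> \<epsilon>\<^sup>2 * (norm a)\<^sup>2" for n
  proof (rule hs_truncation_bound)
    show "(\<Sum>j<n. \<Sum>l<n. (E j l)\<^sup>2) \<le> \<epsilon>\<^sup>2" for n unfolding E_def by (rule cov)
    show "(\<Sum>l<n. (coord a l)\<^sup>2) \<le> (norm a)\<^sup>2" for n by (rule sum_coord_le)
    fix j
    have "(\<lambda>l. \<Sum>i<m. coord a l * coord (w i) l * ef j (x i)) sums (\<Sum>i<m. (a \<bullet> w i) * ef j (x i))"
      by (intro sums_sum sums_mult2 inner_ell2_sums)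
    then have "(\<lambda>l. (\<Sum>i<m. coord a l * coord (w i) l * ef j (x i)) / real m)
        sums ((\<Sum>i<m. (a \<bullet> w i) * ef j (x i)) / real m)"
      by (rule sums_divide)
    moreover have "(\<lambda>l. if l = j then ev j * coord a j else 0) sums (ev j * coord a j)"
      using sums_single[of j "\<lambda>l. ev j * coord a j"] by simp
    ultimately have "(\<lambda>l. (\<Sum>i<m. coord a l * coord (w i) l * ef j (x i)) / real m - (if l = j then ev j * coord a j else 0))
        sums ((\<Sum>i<m. (a \<bullet> w i) * ef j (x i)) / real m - ev j * coord a j)"
      by (rule sums_diff)
    moreover have "(\<Sum>i<m. coord a l * coord (w i) l * ef j (x i)) / real m - (if l = j then ev j * coord a j else 0)
        = E j l * coord a l" for l
    proof -
      have "(\<Sum>i<m. coord a l * coord (w i) l * ef j (x i)) = (\<Sum>i<m. ef j (x i) * ef l (x i)) * coord a l"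
        unfolding sum_distrib_right by (intro sum.cong) (auto simp: coord_w)
      then show ?thesis unfolding E_def by (auto simp: left_diff_distrib)
    qed
    moreover have "(\<Sum>i<m. (a \<bullet> w i) * ef j (x i)) / real m - ev j * coord a j
        = coord (emp_op m w a - diag_ell2 ev a) j"
      unfolding emp_op_def coord_diff' coord_scaleR' coord_sum coord_diag[of ev trace, OF abs_ev_le]
      by (simp add: coord_w)
    ultimately show "(\<lambda>l. E j l * coord a l) sums coord (emp_op m w a - diag_ell2 ev a) j" by simp
  qed
  then show "(\<Sum>j<n. (coord (emp_op m w a - diag_ell2 ev a) j)\<^sup>2) \<le> (\<epsilon> * norm a)\<^sup>2" for n
    by (simp add: power_mult_distrib)
qed (use \<epsilon> in simp)

lemma cross_sums: "\<psi> \<in> HY \<Longrightarrow> (\<lambda>l. cross (g l) j * ipY \<psi> (g l)) sums cross \<psi> j"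
proof -
  assume \<psi>: "\<psi> \<in> HY"
  note gm = HY.basis_mem[OF g]
  have "(\<lambda>n. cross (HY.partial g \<psi> {..<n}) j) \<longlonglongrightarrow> cross \<psi> j"
  proof (rule HY.functional_partial_tendsto[OF g \<psi>, where F = "\<lambda>\<psi>. cross \<psi> j" and c = "A * h_norm ipX (ef j)"])
    fix h assume h: "h \<in> HY"
    let ?d = "\<lambda>z. h z - \<psi> z"
    have d: "?d \<in> HY" by (intro HY.diff_mem h \<psi>)
    interpret nu: prob_space nu by (rule prob_space_nu)
    show "cross ?d j = cross h j - cross \<psi> j"
      unfolding cross_def right_diff_distrib
      by (intro Bochner_Integration.integral_diff product_integrable ef_mem h \<psi>)
    have "\<bar>cross ?d j\<bar> \<le> (\<integral>z. \<bar>ef j (fst z) * ?d (snd z)\<bar> \<partial>nu)"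
      unfolding cross_def by (rule integral_abs_bound)
    also have "\<dots> \<le> (\<integral>z. A * h_norm ipX (ef j) * h_norm ipY ?d \<partial>nu)"
      by (intro integral_mono integrable_abs product_integrable[OF ef_mem d] product_bound[OF ef_mem d]) simp
    finally show "\<bar>cross ?d j\<bar> \<le> A * h_norm ipX (ef j) * sqrt (ipY ?d ?d)"
      by (simp add: h_norm_def nu.prob_space)
  qed
  moreover have "cross (HY.partial g \<psi> {..<n}) j = (\<Sum>l<n. cross (g l) j * ipY \<psi> (g l))" for n
  proof -
    have "(\<lambda>z. ef j (fst z) * (\<Sum>l<n. ipY \<psi> (g l) * g l (snd z)))
        = (\<lambda>z. \<Sum>l<n. ipY \<psi> (g l) * (ef j (fst z) * g l (snd z)))"
      unfolding sum_distrib_left by (simp add: mult_ac)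
    then show ?thesis
      unfolding cross_def HY.partial_def[OF g]
      using product_integrable[OF ef_mem gm] by (simp add: mult.commute)
  qed
  ultimately show ?thesis by (simp add: sums_def)
qed

lemma eval_sums: "\<psi> \<in> HY \<Longrightarrow> (\<lambda>l. g l z * ipY \<psi> (g l)) sums \<psi> z"
proof (cases "z \<in> Y")
  case True
  assume \<psi>: "\<psi> \<in> HY"
  have "ipY (feature Y k z) (g l) = g l z" for l
    using HY.ip_sym[OF HY.feature_mem[OF True] HY.basis_mem[OF g]] HY.reproducing[OF HY.basis_mem[OF g] True] by simp
  then show ?thesis
    using HY.parseval[OF g \<psi> HY.feature_mem[OF True]] HY.reproducing[OF \<psi> True] by (simp add: mult.commute)
next
  case False
  assume \<psi>: "\<psi> \<in> HY"
  show ?thesis using HY.zero_outside[OF HY.basis_mem[OF g] False] HY.zero_outside[OF \<psi> False] by simp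
qed

lemma cross_close:
  assumes \<psi>: "\<psi> \<in> HY"
  shows "(\<Sum>j<n. (coord (U (emp_cov X k m x y \<psi>)) j - cross \<psi> j)\<^sup>2) \<le> \<epsilon>\<^sup>2 * ipY \<psi> \<psi>"
proof (rule hs_truncation_bound)
  show "(\<Sum>j<n. \<Sum>l<n. ((\<Sum>i<m. ef j (x i) * g l (y i)) / real m - cross (g l) j)\<^sup>2) \<le> \<epsilon>\<^sup>2" for n
    by (rule cross_cov)
  show "(\<Sum>l<n. (ipY \<psi> (g l))\<^sup>2) \<le> ipY \<psi> \<psi>" for n by (rule HY.bessel[OF g \<psi>]) simp
  fix j
  have "(\<lambda>l. (\<Sum>i<m. ef j (x i) * (g l (y i) * ipY \<psi> (g l))) / real m - cross (g l) j * ipY \<psi> (g l))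
      sums ((\<Sum>i<m. ef j (x i) * \<psi> (y i)) / real m - cross \<psi> j)"
    by (intro sums_diff sums_divide sums_sum sums_mult eval_sums cross_sums \<psi>)
  moreover have "(\<Sum>i<m. ef j (x i) * (g l (y i) * ipY \<psi> (g l))) / real m - cross (g l) j * ipY \<psi> (g l)
      = ((\<Sum>i<m. ef j (x i) * g l (y i)) / real m - cross (g l) j) * ipY \<psi> (g l)" for l
    by (simp add: left_diff_distrib sum_distrib_right mult.assoc)
  moreover have "coord (U (emp_cov X k m x y \<psi>)) j = (\<Sum>i<m. ef j (x i) * \<psi> (y i)) / real m"
    unfolding U_emp_cov coord_sum coord_scaleR' sum_divide_distrib
    by (intro sum.cong) (auto simp: coord_w)
  ultimately show "(\<lambda>l. ((\<Sum>i<m. ef j (x i) * g l (y i)) / real m - cross (g l) j) * ipY \<psi> (g l))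
      sums (coord (U (emp_cov X k m x y \<psi>)) j - cross \<psi> j)" by simp
qed

lemma norm_emp_cov_le:
  assumes \<psi>: "\<psi> \<in> HY" and t: "0 < trace"
  shows "norm (U (emp_cov X k m x y \<psi>)) \<le> (sqrt (trace * A) + \<epsilon>) * h_norm ipY \<psi>"
proof (rule norm_ell2_leI)
  define v where "v = coord (U (emp_cov X k m x y \<psi>))"
  define B where "B = (sqrt (trace * A) + \<epsilon>) * h_norm ipY \<psi>"
  have n0: "0 \<le> h_norm ipY \<psi>" by (simp add: h_norm_def HY.ip_nonneg[OF \<psi>])
  show B0: "0 \<le> (sqrt (trace * A) + \<epsilon>) * h_norm ipY \<psi>" using n0 \<epsilon> t A_nonneg by simp
  fix n
  define s where "s = sqrt (\<Sum>j<n. (v j)\<^sup>2)"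
  have s0: "0 \<le> s" and s2: "s\<^sup>2 = (\<Sum>j<n. (v j)\<^sup>2)" by (simp_all add: s_def sum_nonneg)
  have 1: "(\<Sum>j<n. v j * cross \<psi> j) \<le> s * (sqrt (trace * A) * h_norm ipY \<psi>)"
    unfolding s_def by (rule cross_combination_le[OF \<psi> t])
  have "(\<Sum>j<n. v j * (v j - cross \<psi> j)) \<le> (\<Sum>j<n. \<bar>v j\<bar> * \<bar>v j - cross \<psi> j\<bar>)"
    by (intro sum_mono) (simp add: abs_mult[symmetric])
  also have "\<dots> \<le> L2_set v {..<n} * L2_set (\<lambda>j. v j - cross \<psi> j) {..<n}" by (rule L2_set_mult_ineq)
  also have "\<dots> \<le> s * (\<epsilon> * h_norm ipY \<psi>)"
  proof (rule mult_mono)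
    have "L2_set (\<lambda>j. v j - cross \<psi> j) {..<n} \<le> sqrt (\<epsilon>\<^sup>2 * ipY \<psi> \<psi>)"
      unfolding L2_set_def v_def by (intro real_sqrt_le_mono cross_close \<psi>)
    then show "L2_set (\<lambda>j. v j - cross \<psi> j) {..<n} \<le> \<epsilon> * h_norm ipY \<psi>"
      using \<epsilon> by (simp add: real_sqrt_mult h_norm_def)
  qed (auto simp: s_def L2_set_def sum_nonneg)
  finally have 2: "(\<Sum>j<n. v j * (v j - cross \<psi> j)) \<le> s * (\<epsilon> * h_norm ipY \<psi>)" .
  have "s * s = (\<Sum>j<n. v j * cross \<psi> j) + (\<Sum>j<n. v j * (v j - cross \<psi> j))"
    unfolding power2_eq_square[symmetric] s2 by (simp add: sum.distrib[symmetric] power2_eq_square algebra_simps)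
  also have "\<dots> \<le> s * B" using 1 2 by (simp add: B_def algebra_simps)
  finally have "s * s \<le> s * B" .
  then have "s \<le> B" using s0 B0 by (cases "s = 0") (auto simp: B_def)
  then have "s\<^sup>2 \<le> B\<^sup>2" using s0 by (intro power_mono)
  then show "(\<Sum>j<n. (coord (U (emp_cov X k m x y \<psi>)) j)\<^sup>2) \<le> ((sqrt (trace * A) + \<epsilon>) * h_norm ipY \<psi>)\<^sup>2"
    by (simp add: s2 v_def B_def)
qed

text \<open>
  The deterministic part of the argument. If the empirical covariance and cross-covariance operators
  have Hilbert-Schmidt distance at most \<open>\<epsilon>\<close> from their expectations, then the estimator is close to
  the projected Koopman operator. The error has two parts, one from the cross-covariance and one from the
  truncated inverse.
\<close>

lemma estimator_error:
  assumes r: "1 \<le> r" "r + 1 \<in> J" and \<delta>: "0 < \<delta>" "2 * \<delta> \<le> lam r - lam (r + 1)" "5 * \<epsilon> \<le> 3 * \<delta>"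
    and top: "top_eigensystem HX ipX (emp_cov X k m x x) r lh fh" and \<psi>: "\<psi> \<in> HY"
  defines "K \<equiv> trunc_pinv ipX r lh fh (emp_cov X k m x y \<psi>)"
  shows "K \<in> HX" "\<exists>h\<in>HX. (AE z in M. l2_proj M e r (koopman Y \<kappa> \<psi>) z - K z = h z) \<and>
    l2_norm M h \<le> (\<epsilon> / sqrt (lam r) + 49/20 * \<epsilon> / (\<delta> * sqrt (lam r)) * (sqrt (trace * A) + \<epsilon>)) * h_norm ipY \<psi>"
proof -
  let ?C = "diag_ell2 ev" and ?D = "diag_ell2 (\<lambda>n. sqrt (ev n))" and ?J = "{1..r}"
  define v where "v = U (emp_cov X k m x y \<psi>)"
  have rJ: "{1..r} \<subseteq> J" using J_down[OF r(2)] by auto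
  have lpos: "0 < lam j" if "j \<in> ?J" for j using rJ that lam_pos by auto
  have lr: "lam r \<le> lam j" if "j \<in> ?J" for j using that rJ r by (intro lam_antimono) auto
  have evj: "ev j = lam j" if "j \<in> ?J" for j using that rJ by (auto simp: ev_def)
  have \<alpha>: "0 < lam r" using lpos[of r] r by simp
  have \<beta>: "0 < lam (r + 1)" using lam_pos r by simp
  have trace_pos: "0 < trace" using ev_le[of r] evj[of r] \<alpha> r by simp
  have fh: "fh j \<in> HX" "emp_cov X k m x x (fh j) = (\<lambda>z. lh j * fh j z)" if "j \<in> ?J" for j
    using top that by (auto simp: top_eigensystem_def)
  have linD: "linear ?D"
    by (rule linear_diag[of _ "sqrt trace"]) (use ev_le ev_nonneg in auto)
  have K_eq: "K = (\<lambda>z. \<Sum>j\<in>?J. (inverse (lh j) * ipX (emp_cov X k m x y \<psi>) (fh j)) * fh j z)"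
    unfolding K_def trunc_pinv_def ..
  show KH: "K \<in> HX" unfolding K_eq by (intro HX.lincomb_mem fh)
  have UK: "U K = (\<Sum>j\<in>?J. ((v \<bullet> U (fh j)) / lh j) *\<^sub>R U (fh j))"
    unfolding K_eq using fh(1)
    by (subst U_lincomb) (auto simp: v_def inner_U emp_cov_mem divide_inverse mult.commute intro!: sum.cong)
  have pert: "norm (?D ((\<Sum>j\<in>?J. ((v \<bullet> unit_ell2 j) / lam j) *\<^sub>R unit_ell2 j) - U K))
      \<le> 49/20 * \<epsilon> / (\<delta> * sqrt (lam r)) * norm v"
    unfolding UK
  proof (rule truncated_inverse_perturbation[where C = ?C and m = m and w = w and \<beta> = "lam (r + 1)" and lh = lh])
    show "linear ?C" by (rule linear_diag[OF abs_ev_le])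
    show "?C a \<bullet> b = a \<bullet> ?C b" for a b by (rule diag_sym[OF abs_ev_le])
    show "linear ?D" by (rule linD)
    show "(norm (?D a))\<^sup>2 = a \<bullet> ?C a" for a by (rule norm_diag_sqrt[OF ev_nonneg ev_le])
    show "orthonormal_on ?J unit_ell2" by (auto simp: orthonormal_on_def inner_unit coord_unit)
    show "?C (unit_ell2 j) = lam j *\<^sub>R unit_ell2 j" if "j \<in> ?J" for j
      using diag_unit[of ev trace j, OF abs_ev_le] evj[OF that] by simp
    show "lam r \<le> lam j" if "j \<in> ?J" for j by (rule lr[OF that])
    show "norm (?C a) \<le> lam (r + 1) * norm a" if a: "\<And>j. j \<in> ?J \<Longrightarrow> a \<bullet> unit_ell2 j = 0" for a
    proof (rule norm_diag_le[OF abs_ev_le])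
      fix n assume "coord a n \<noteq> 0"
      then have n: "n \<notin> ?J" using a by (auto simp: inner_unit)
      show "\<bar>ev n\<bar> \<le> lam (r + 1)"
      proof (cases "n \<in> J")
        case True
        then have "r + 1 \<le> n" using n J_ge[of n] by auto
        then show ?thesis using lam_antimono[OF r(2) True] lam_pos[OF True] True by (simp add: ev_def)
      qed (use \<beta> in \<open>simp add: ev_def\<close>)
    qed (use \<beta> in simp)
    show "orthonormal_on ?J (\<lambda>j. U (fh j))"
      using top fh(1) by (auto simp: orthonormal_on_def inner_U top_eigensystem_def)
    show "emp_op m w (U (fh j)) = lh j *\<^sub>R U (fh j)" if j: "j \<in> ?J" for j
    proof -
      have "emp_op m w (U (fh j)) = U (\<lambda>z. lh j * fh j z)"
        unfolding U_emp_cov_op[OF fh(1)[OF j], symmetric] fh(2)[OF j] ..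
      also have "\<dots> = lh j *\<^sub>R U (fh j)"
        using U_lincomb[of "{j}" fh lh] fh(1)[OF j] by simp
      finally show ?thesis .
    qed
    show "lh r \<le> lh j" if "j \<in> ?J" for j
      using top that r by (auto simp: top_eigensystem_def)
    fix a c assume a: "a \<noteq> 0" and c: "0 < c" "emp_op m w a = c *\<^sub>R a"
      and orth: "\<And>j. j \<in> ?J \<Longrightarrow> a \<bullet> U (fh j) = 0"
    \<comment> \<open>an eigenvector with nonzero eigenvalue is a combination of features, hence comes from a function\<close>
    define \<eta> where "\<eta> = (\<lambda>z. \<Sum>i<m. ((a \<bullet> w i) / (c * real m)) * feature X k (x i) z)"
    have \<eta>H: "\<eta> \<in> HX" unfolding \<eta>_def by (intro HX.lincomb_mem HX.feature_mem x) simp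
    have U\<eta>: "U \<eta> = a"
    proof -
      have "U \<eta> = (\<Sum>i<m. ((a \<bullet> w i) / (c * real m)) *\<^sub>R w i)"
        unfolding \<eta>_def w_def by (intro U_lincomb HX.feature_mem x) simp
      also have "\<dots> = (1 / c) *\<^sub>R emp_op m w a"
        unfolding emp_op_def scaleR_sum_right by (simp add: mult_ac)
      finally show ?thesis using c by simp
    qed
    have "\<eta> \<noteq> (\<lambda>z. 0)"
    proof
      assume "\<eta> = (\<lambda>z. 0)"
      then have "a \<bullet> a = 0" using inner_U[OF \<eta>H \<eta>H] HX.ip_zero_left[OF HX.zero_mem] U\<eta> by simp
      then show False using a by simp
    qed
    moreover have "emp_cov X k m x x \<eta> = (\<lambda>z. c * \<eta> z)"
    proof -
      have "emp_cov X k m x x \<eta> = (\<lambda>z. \<Sum>i<m. (\<eta> (x i) / real m) * feature X k (x i) z)"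
        by (rule emp_cov_eq)
      also have "\<dots> = (\<lambda>z. \<Sum>i<m. c * (((a \<bullet> w i) / (c * real m)) * feature X k (x i) z))"
      proof (intro ext sum.cong refl)
        fix z i assume "i \<in> {..<m}"
        then have "\<eta> (x i) = a \<bullet> w i" using U_feature_inner[OF \<eta>H x[of i]] by (simp add: U\<eta> w_def)
        then show "(\<eta> (x i) / real m) * feature X k (x i) z = c * (((a \<bullet> w i) / (c * real m)) * feature X k (x i) z)"
          using c by simp
      qed
      finally show ?thesis by (simp add: \<eta>_def sum_distrib_left)
    qed
    moreover have "ipX \<eta> (fh j) = 0" if "j \<in> ?J" for j
      using orth[OF that] inner_U[OF \<eta>H fh(1)[OF that]] U\<eta> by simp
    ultimately show "c \<le> lh r" using top \<eta>H unfolding top_eigensystem_def by blast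
  next
    show "norm (emp_op m w a - ?C a) \<le> \<epsilon> * norm a" for a by (rule emp_op_close)
  qed (use r \<beta> \<delta> \<epsilon> in auto)
  define h where "h = (\<lambda>z. (\<Sum>j\<in>?J. (cross \<psi> j / lam j) * ef j z) - K z)"
  have pH: "(\<lambda>z. \<Sum>j\<in>?J. (cross \<psi> j / lam j) * ef j z) \<in> HX" by (intro HX.lincomb_mem ef_mem)
  have hH: "h \<in> HX" unfolding h_def by (intro HX.diff_mem pH KH)
  have ae: "AE z in M. l2_proj M e r (koopman Y \<kappa> \<psi>) z - K z = h z"
  proof -
    have "AE z in M. \<forall>j\<in>?J. ef j z = sqrt (lam j) * e j z"
      using rJ ef_AE by (intro AE_finite_allI) auto
    then show ?thesis
    proof eventually_elim
      case (elim z)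
      have "l2_proj M e r (koopman Y \<kappa> \<psi>) z = (\<Sum>j\<in>?J. cross \<psi> j / sqrt (lam j) * e j z)"
        unfolding l2_proj_eq[OF koopman_L2[OF \<psi>] rJ] using rJ
        by (intro sum.cong) (auto simp: koopman_coeff[OF \<psi>])
      also have "\<dots> = (\<Sum>j\<in>?J. (cross \<psi> j / lam j) * ef j z)"
      proof (rule sum.cong[OF refl])
        fix j assume j: "j \<in> ?J"
        have "sqrt (lam j) / lam j = 1 / sqrt (lam j)"
          using lpos[OF j] by (simp add: divide_eq_eq eq_divide_eq)
        moreover have "(cross \<psi> j / lam j) * ef j z = cross \<psi> j * (sqrt (lam j) / lam j) * e j z"
          using elim j by simp
        ultimately show "cross \<psi> j / sqrt (lam j) * e j z = (cross \<psi> j / lam j) * ef j z" by simp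
      qed
      finally show ?case by (simp add: h_def)
    qed
  qed
  define p where "p = (\<Sum>j\<in>?J. ((cross \<psi> j - coord v j) / lam j) *\<^sub>R unit_ell2 j)"
  have Uh: "U h = p + ((\<Sum>j\<in>?J. ((v \<bullet> unit_ell2 j) / lam j) *\<^sub>R unit_ell2 j) - U K)"
  proof -
    have "U h = (\<Sum>j\<in>?J. (cross \<psi> j / lam j) *\<^sub>R U (ef j)) - U K"
      unfolding h_def U_diff[OF pH KH] by (subst U_lincomb) (auto intro: ef_mem)
    also have "(\<Sum>j\<in>?J. (cross \<psi> j / lam j) *\<^sub>R U (ef j)) = (\<Sum>j\<in>?J. (cross \<psi> j / lam j) *\<^sub>R unit_ell2 j)"
      using rJ by (intro sum.cong) (auto simp: U_ef)
    also have "\<dots> = p + (\<Sum>j\<in>?J. ((v \<bullet> unit_ell2 j) / lam j) *\<^sub>R unit_ell2 j)"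
      unfolding p_def sum.distrib[symmetric] scaleR_add_left[symmetric]
      by (simp add: inner_unit diff_divide_distrib)
    finally show ?thesis by simp
  qed
  have Dp: "norm (?D p) \<le> \<epsilon> / sqrt (lam r) * h_norm ipY \<psi>"
  proof -
    have "(norm (?D p))\<^sup>2 = (\<Sum>j\<in>?J. lam j * ((cross \<psi> j - coord v j) / lam j)\<^sup>2)"
      unfolding norm_diag_sqrt[OF ev_nonneg ev_le] p_def
    proof (rule eigen_sum_inner)
      show "orthonormal_on ?J unit_ell2" by (auto simp: orthonormal_on_def inner_unit coord_unit)
      show "linear ?C" by (rule linear_diag[OF abs_ev_le])
      show "?C (unit_ell2 j) = lam j *\<^sub>R unit_ell2 j" if "j \<in> ?J" for j
        using diag_unit[of ev trace j, OF abs_ev_le] evj[OF that] by simp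
    qed simp
    also have "\<dots> \<le> (\<Sum>j\<in>?J. (coord v j - cross \<psi> j)\<^sup>2 / lam r)"
    proof (rule sum_mono)
      fix j assume j: "j \<in> ?J"
      have "lam j * ((cross \<psi> j - coord v j) / lam j)\<^sup>2 = (coord v j - cross \<psi> j)\<^sup>2 / lam j"
        using lpos[OF j] by (simp add: power_divide power2_commute power2_eq_square[of "lam j"])
      also have "\<dots> \<le> (coord v j - cross \<psi> j)\<^sup>2 / lam r"
        using lr[OF j] lpos[OF j] \<alpha> by (intro divide_left_mono) auto
      finally show "lam j * ((cross \<psi> j - coord v j) / lam j)\<^sup>2 \<le> (coord v j - cross \<psi> j)\<^sup>2 / lam r" .
    qed
    also have "\<dots> = (\<Sum>j\<in>?J. (coord v j - cross \<psi> j)\<^sup>2) / lam r" by (simp add: sum_divide_distrib)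
    also have "\<dots> \<le> (\<Sum>j<r + 1. (coord v j - cross \<psi> j)\<^sup>2) / lam r"
      using \<alpha> by (intro divide_right_mono sum_mono2) auto
    also have "\<dots> \<le> (\<epsilon>\<^sup>2 * ipY \<psi> \<psi>) / lam r"
      unfolding v_def using \<alpha> by (intro divide_right_mono cross_close \<psi>) auto
    also have "\<dots> = (\<epsilon> / sqrt (lam r) * h_norm ipY \<psi>)\<^sup>2"
      using \<alpha> HY.ip_nonneg[OF \<psi>] by (simp add: power_mult_distrib power_divide h_norm_def)
    finally show ?thesis
      by (rule power2_le_imp_le) (use \<epsilon> \<alpha> HY.ip_nonneg[OF \<psi>] in \<open>simp add: h_norm_def\<close>)
  qed
  have "l2_norm M h \<le> norm (?D p) + norm (?D ((\<Sum>j\<in>?J. ((v \<bullet> unit_ell2 j) / lam j) *\<^sub>R unit_ell2 j) - U K))"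
    unfolding l2_norm_U[OF hH] Uh linear_add[OF linD] by (rule norm_triangle_ineq)
  also have "\<dots> \<le> \<epsilon> / sqrt (lam r) * h_norm ipY \<psi>
      + 49/20 * \<epsilon> / (\<delta> * sqrt (lam r)) * ((sqrt (trace * A) + \<epsilon>) * h_norm ipY \<psi>)"
  proof (intro add_mono Dp order_trans[OF pert] mult_left_mono)
    show "norm v \<le> (sqrt (trace * A) + \<epsilon>) * h_norm ipY \<psi>"
      unfolding v_def by (rule norm_emp_cov_le[OF \<psi> trace_pos])
  qed (use \<epsilon> \<delta> \<alpha> in simp)
  finally have "l2_norm M h \<le> (\<epsilon> / sqrt (lam r) + 49/20 * \<epsilon> / (\<delta> * sqrt (lam r)) * (sqrt (trace * A) + \<epsilon>)) * h_norm ipY \<psi>"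
    by (simp add: algebra_simps)
  with hH ae show "\<exists>h\<in>HX. (AE z in M. l2_proj M e r (koopman Y \<kappa> \<psi>) z - K z = h z) \<and>
    l2_norm M h \<le> (\<epsilon> / sqrt (lam r) + 49/20 * \<epsilon> / (\<delta> * sqrt (lam r)) * (sqrt (trace * A) + \<epsilon>)) * h_norm ipY \<psi>"
    by blast
qed

end

end

section \<open>Random samples and the projection error\<close>

context koopman_setting
begin

lemma L2_diff: "f \<in> L2 M \<Longrightarrow> g \<in> L2 M \<Longrightarrow> (\<lambda>x. f x - g x) \<in> L2 M"
proof -
  assume f: "f \<in> L2 M" and g: "g \<in> L2 M"
  have "(\<lambda>x. (f x - g x)\<^sup>2) = (\<lambda>x. (f x)\<^sup>2 + (g x)\<^sup>2 - 2 * (f x * g x))"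
    by (simp add: power2_diff mult.assoc)
  moreover have "integrable M (\<lambda>x. (f x)\<^sup>2 + (g x)\<^sup>2 - 2 * (f x * g x))"
    using f g L2_mult_integrable[OF f g] by (auto simp: L2_def)
  ultimately show ?thesis using f g by (auto simp: L2_def)
qed

lemma l2_norm_cong_AE: "f \<in> L2 M \<Longrightarrow> g \<in> L2 M \<Longrightarrow> AE x in M. f x = g x \<Longrightarrow> l2_norm M f = l2_norm M g"
  unfolding l2_norm_def using l2_inner_cong_AE[of f g f] l2_inner_cong_AE[of f g g] by simp

lemma l2_norm_add_le:
  assumes f: "f \<in> HX" and g: "g \<in> HX"
  shows "l2_norm M (\<lambda>x. f x + g x) \<le> l2_norm M f + l2_norm M g"
proof -
  have "U (\<lambda>x. f x + g x) = U f + U g"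
    using f g by (intro ell2_eqI) (simp add: coord_U HX.add_mem HX.ip_add ef_mem coord_add')
  moreover have "linear (diag_ell2 (\<lambda>n. sqrt (ev n)))"
    by (rule linear_diag[of _ "sqrt trace"]) (use ev_le ev_nonneg in auto)
  ultimately show ?thesis
    unfolding l2_norm_U[OF f] l2_norm_U[OF g] l2_norm_U[OF HX.add_mem[OF f g]]
    by (simp add: linear_add norm_triangle_ineq)
qed

text \<open>
  If \<open>F\<close> has a representative \<open>\<eta>\<close> in the reproducing kernel Hilbert space, its tail coefficients in
  \<open>L\<^sup>2\<close> are those of \<open>\<eta>\<close> multiplied by the square roots of eigenvalues \<open>\<le> lam (r + 1)\<close>.
\<close>

lemma projection_error:
  assumes r: "1 \<le> r" "r + 1 \<in> J" and F: "F \<in> L2 M" and \<eta>: "\<eta> \<in> HX" and ae: "AE x in M. \<eta> x = F x"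
  shows "\<exists>h\<in>HX. (AE x in M. F x - l2_proj M e r F x = h x)
    \<and> l2_norm M h \<le> sqrt (lam (r + 1)) * h_norm ipX \<eta>"
proof -
  let ?J = "{1..r}"
  have rJ: "?J \<subseteq> J" using J_down[OF r(2)] by auto
  define p where "p = HX.partial ef \<eta> ?J"
  have pH: "p \<in> HX" unfolding p_def by (rule HX.partial_mem[OF ef_total])
  have p_eq: "p x = (\<Sum>j\<in>?J. ipX \<eta> (ef j) * ef j x)" for x
    by (simp add: p_def HX.partial_def[OF ef_total])
  let ?h = "\<lambda>x. \<eta> x - p x"
  have hH: "?h \<in> HX" by (intro HX.diff_mem \<eta> pH)
  have "AE x in M. \<forall>j\<in>?J. ef j x = sqrt (lam j) * e j x"
    using rJ ef_AE by (intro AE_finite_allI) auto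
  then have "AE x in M. F x - l2_proj M e r F x = ?h x"
    using ae
  proof eventually_elim
    case (elim x)
    have "l2_proj M e r F x = p x"
      unfolding l2_proj_eq[OF F rJ] p_eq
    proof (rule sum.cong[OF refl])
      fix j assume j: "j \<in> ?J"
      then have jJ: "j \<in> J" using rJ by auto
      have "l2_inner M F (e j) = l2_inner M \<eta> (e j)"
        by (rule l2_inner_cong_AE(1)[OF F HX_L2[OF \<eta>] e_L2[OF jJ]]) (use ae in \<open>auto elim: eventually_mono\<close>)
      then show "l2_inner M F (e j) * e j x = ipX \<eta> (ef j) * ef j x"
        using elim(1) j lam_pos[OF jJ] by (simp add: ip_ef'[OF jJ \<eta>])
    qed
    then show ?case using elim(2) by simp
  qed
  moreover have "l2_norm M ?h \<le> sqrt (lam (r + 1)) * h_norm ipX \<eta>"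
  proof -
    have bnd: "\<bar>sqrt (ev n)\<bar> \<le> sqrt trace" for n using ev_le ev_nonneg by simp
    have "norm (diag_ell2 (\<lambda>n. sqrt (ev n)) (U ?h)) \<le> sqrt (lam (r + 1)) * norm (U ?h)"
    proof (rule norm_diag_le[OF bnd])
      fix n assume "coord (U ?h) n \<noteq> 0"
      then have "ipX \<eta> (ef n) - ipX p (ef n) \<noteq> 0"
        unfolding coord_U[OF hH] HX.ip_diff[OF \<eta> pH ef_mem] .
      then have n: "n \<notin> ?J"
        using HX.ip_partial_basis[OF ef_total \<eta>, of ?J n] by (auto simp: p_def)
      have "ev n \<le> lam (r + 1)"
      proof (cases "n \<in> J")
        case True
        then have "r + 1 \<le> n" using n J_ge[of n] by auto
        then show ?thesis using lam_antimono[OF r(2) True] True by (simp add: ev_def)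
      qed (use lam_pos[OF r(2)] in \<open>simp add: ev_def\<close>)
      then show "\<bar>sqrt (ev n)\<bar> \<le> sqrt (lam (r + 1))" using ev_nonneg[of n] by simp
    qed (use lam_pos[OF r(2)] in simp)
    also have "norm (U ?h) \<le> h_norm ipX \<eta>"
    proof -
      have "ipX ?h ?h = ipX \<eta> \<eta> - 2 * ipX \<eta> p + ipX p p" by (rule HX.ip_diff_diff[OF \<eta> pH])
      also have "\<dots> = ipX (\<lambda>x. p x - \<eta> x) (\<lambda>x. p x - \<eta> x)"
        using HX.ip_sym[OF \<eta> pH] by (simp add: HX.ip_diff_diff[OF pH \<eta>])
      also have "\<dots> = ipX \<eta> \<eta> - (\<Sum>j\<in>?J. (ipX \<eta> (ef j))\<^sup>2)"
        unfolding p_def by (rule HX.ip_diff_partial[OF ef_total \<eta>]) simp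
      also have "\<dots> \<le> ipX \<eta> \<eta>" by (simp add: sum_nonneg)
      finally have "ipX ?h ?h \<le> ipX \<eta> \<eta>" .
      then show ?thesis by (simp add: norm_eq_sqrt_inner inner_U[OF hH hH] h_norm_def)
    qed
    finally show ?thesis
      unfolding l2_norm_U[OF hH] using lam_pos[OF r(2)] by (simp add: mult_left_mono)
  qed
  ultimately show ?thesis by (intro bexI[OF _ hH] conjI)
qed

text \<open>
  The random part of the argument: with probability at least \<open>1 - \<delta>\<close>, both empirical operators are
  close to their expectations.
\<close>

lemma good_sample:
  assumes D: "prob_space D"
    and law: "\<And>i. i < m \<Longrightarrow> distr D (borel \<Otimes>\<^sub>M borel) (\<lambda>\<omega>. (xs i \<omega>, ys i \<omega>)) = nu"
    and indep: "prob_space.indep_vars D (\<lambda>i. borel \<Otimes>\<^sub>M borel) (\<lambda>i \<omega>. (xs i \<omega>, ys i \<omega>)) {..<m}"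
    and m: "0 < m" and t: "0 < trace" and \<epsilon>: "0 < \<epsilon>" "2 * \<epsilon> \<le> trace" and \<delta>: "0 < \<delta>"
    and mm: "8 * A\<^sup>2 * ln (4 / \<delta>) / \<epsilon>\<^sup>2 \<le> real m"
    and g: "HY.total_orthonormal g"
  defines "\<eta> \<equiv> 3/5 * \<epsilon> * sqrt (trace / A)"
  shows "\<exists>E\<in>sets D. 1 - \<delta> \<le> measure D E \<and> (\<forall>\<omega>\<in>E. (\<forall>i<m. xs i \<omega> \<in> X) \<and>
     (\<forall>n. (\<Sum>j<n. \<Sum>l<n. ((\<Sum>i<m. ef j (xs i \<omega>) * ef l (xs i \<omega>)) / real m
        - (if j = l then ev j else 0))\<^sup>2) \<le> \<eta>\<^sup>2) \<and>
     (\<forall>n. (\<Sum>j<n. \<Sum>l<n. ((\<Sum>i<m. ef j (xs i \<omega>) * g l (ys i \<omega>)) / real m - cross (g l) j)\<^sup>2) \<le> \<eta>\<^sup>2))"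
proof -
  interpret D: prob_space D by fact
  interpret nu: prob_space nu by (rule prob_space_nu)
  let ?K = "borel \<Otimes>\<^sub>M borel :: ('a \<times> 'a) measure"
  define V where "V i \<omega> = (xs i \<omega>, ys i \<omega>)" for i \<omega>
  have law': "distr D ?K (V i) = nu" if "i < m" for i using law[OF that] by (simp add: V_def[abs_def])
  have indep': "D.indep_vars (\<lambda>_. ?K) V {..<m}" using indep by (simp add: V_def[abs_def])
  have V: "V i \<in> measurable D ?K" if "i < m" for i
    using indep' that by (auto simp: D.indep_vars_def)
  note gm = HY.basis_mem[OF g]
  note cong_nu = measurable_cong_sets[OF sets_nu refl]
  have [measurable]: "ef j \<in> borel_measurable borel" "g j \<in> borel_measurable borel" for j
    using HX_borel[OF ef_mem] HY_borel[OF gm] by auto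
  have f1: "(\<lambda>z. ef j (fst z)) \<in> borel_measurable nu" for j unfolding cong_nu by measurable
  have f2: "(\<lambda>z. g j (snd z)) \<in> borel_measurable nu" for j unfolding cong_nu by measurable
  define kd where "kd x = (if x \<in> X then k x x else 0)" for x
  have kd_meas: "kd \<in> borel_measurable borel"
  proof -
    have "continuous_on X (\<lambda>y. case (y, y) of (x, y) \<Rightarrow> k x y)"
      by (rule continuous_on_compose2[OF kX_cont]) (auto intro!: continuous_intros)
    then show ?thesis
      unfolding kd_def[abs_def] using X
      by (intro borel_measurable_continuous_on_if) (auto intro: borel_closed)
  qed
  have kd_le: "kd x \<le> A" and kd_nonneg: "0 \<le> kd x" for x
    using k_le[of x] Y(2) HX.kernel_diag_nonneg[of x] A_nonneg by (auto simp: kd_def)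
  have kd_abs: "\<bar>kd x\<bar> \<le> A" for x using kd_le kd_nonneg by simp
  have G_int: "integrable nu (\<lambda>z. kd (fst z))"
    by (rule integral_nu(1)[OF _ kd_abs]) (use kd_meas in measurable)
  have G_eq: "(\<integral>z. kd (fst z) \<partial>nu) = trace"
    unfolding integral_nu_fst[OF kd_meas kd_abs] trace_def
    by (intro Bochner_Integration.integral_cong) (auto simp: kd_def space_M)
  have sum_f: "(\<Sum>j<n. (ef j (fst z))\<^sup>2) \<le> kd (fst z)" for n z
    using HX.sum_basis_square_le[OF ef_total, of "fst z" n] HX.zero_outside[OF ef_mem, of "fst z"]
    by (auto simp: kd_def)
  have sum_g: "(\<Sum>j<n. (g j (snd z))\<^sup>2) \<le> A" for n z
    using HY.sum_basis_square_le[OF g, of "snd z" n] HY.zero_outside[OF gm, of "snd z"] k_le[of "snd z"] A_nonneg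
    by (cases "snd z \<in> Y") (auto intro: order_trans)
  define c1 where "c1 \<omega> n = (\<Sum>j<n. \<Sum>l<n. ((\<Sum>i<m. ef j (xs i \<omega>) * ef l (xs i \<omega>)) / real m
        - (if j = l then ev j else 0))\<^sup>2)" for \<omega> n
  define c2 where "c2 \<omega> n = (\<Sum>j<n. \<Sum>l<n. ((\<Sum>i<m. ef j (xs i \<omega>) * g l (ys i \<omega>)) / real m - cross (g l) j)\<^sup>2)" for \<omega> n
  have mean1: "(\<integral>z. ef j (fst z) * ef l (fst z) \<partial>nu) = (if j = l then ev j else 0)" for j l
  proof -
    have "\<bar>ef j x * ef l x\<bar> \<le> (sqrt A * h_norm ipX (ef j)) * (sqrt A * h_norm ipX (ef l))" for x
      unfolding abs_mult using HX_abs_le[OF ef_mem] A_nonneg HX.ip_nonneg[OF ef_mem]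
      by (intro mult_mono) (auto simp: h_norm_def)
    then have "(\<integral>z. ef j (fst z) * ef l (fst z) \<partial>nu) = l2_inner M (ef j) (ef l)"
      unfolding l2_inner_def by (intro integral_nu_fst) measurable
    then show ?thesis unfolding l2_inner_ef[OF ef_mem] ip_ef_ef by (auto simp: ev_def)
  qed
  have P1: "D.prob {\<omega> \<in> space D. \<exists>n. \<eta>\<^sup>2 \<le> c1 \<omega> n} \<le> \<delta> / 2"
    using D.product_feature_concentration[OF law' indep' m f1 f1 sum_f order_trans[OF sum_f kd_le] kd_le
        G_int _ t trace_le \<epsilon> \<delta> mm] G_eq
    by (simp add: c1_def V_def \<eta>_def mean1)
  have P2: "D.prob {\<omega> \<in> space D. \<exists>n. \<eta>\<^sup>2 \<le> c2 \<omega> n} \<le> \<delta> / 2"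
    using D.product_feature_concentration[OF law' indep' m f1 f2 sum_f sum_g kd_le
        G_int _ t trace_le \<epsilon> \<delta> mm] G_eq
    by (simp add: c2_def V_def \<eta>_def cross_def)
  have xm: "xs i \<in> measurable D borel" and ym: "ys i \<in> measurable D borel" if "i < m" for i
    using measurable_compose[OF V[OF that] measurable_fst] measurable_compose[OF V[OF that] measurable_snd]
    by (simp_all add: V_def)
  have ex: "(\<lambda>\<omega>. ef j (xs i \<omega>)) \<in> borel_measurable D" and gy: "(\<lambda>\<omega>. g j (ys i \<omega>)) \<in> borel_measurable D"
    if "i < m" for i j
    by (rule measurable_compose[OF xm[OF that] HX_borel[OF ef_mem]],
        rule measurable_compose[OF ym[OF that] HY_borel[OF gm]])
  have [measurable]: "(\<lambda>\<omega>. c1 \<omega> n) \<in> borel_measurable D" "(\<lambda>\<omega>. c2 \<omega> n) \<in> borel_measurable D" for n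
    unfolding c1_def c2_def
    by (intro borel_measurable_sum borel_measurable_power borel_measurable_diff borel_measurable_divide
        borel_measurable_times ex gy borel_measurable_const; simp)+
  have B1: "{\<omega> \<in> space D. \<exists>n. \<eta>\<^sup>2 \<le> c1 \<omega> n} \<in> sets D" and B2: "{\<omega> \<in> space D. \<exists>n. \<eta>\<^sup>2 \<le> c2 \<omega> n} \<in> sets D"
    by measurable
  let ?B = "{\<omega> \<in> space D. \<exists>n. \<eta>\<^sup>2 \<le> c1 \<omega> n} \<union> {\<omega> \<in> space D. \<exists>n. \<eta>\<^sup>2 \<le> c2 \<omega> n}"
  have "AE z in nu. fst z \<in> X"
  proof -
    have iX: "(indicator X :: 'a \<Rightarrow> real) \<in> borel_measurable borel" using X by (simp add: borel_closed)
    have "(\<integral>z. indicator X (fst z) \<partial>nu) = integral\<^sup>L M (indicator X :: 'a \<Rightarrow> real)"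
      by (rule integral_nu_fst[OF iX, of 1]) (simp add: indicator_def)
    also have "\<dots> = (\<integral>x. 1 \<partial>M)"
      by (intro Bochner_Integration.integral_cong) (auto simp: space_M)
    finally have "(\<integral>z. indicator X (fst z) \<partial>nu) = (1::real)" by (simp add: M.prob_space)
    moreover have XU: "{z \<in> space nu. fst z \<in> X} \<in> sets nu"
    proof -
      have "{z \<in> space ?K. fst z \<in> X} \<in> sets ?K"
        using measurable_sets[OF measurable_fst borel_closed[OF X], of "borel :: 'a measure"]
        by (simp add: vimage_def Int_def conj_commute)
      then show ?thesis using sets_nu sets_eq_imp_space_eq[OF sets_nu] by simp
    qed
    moreover have "(\<integral>z. indicator X (fst z) \<partial>nu) = (\<integral>z. indicator {z \<in> space nu. fst z \<in> X} z \<partial>nu :: real)"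
      by (intro Bochner_Integration.integral_cong) (auto simp: indicator_def)
    ultimately have "nu.prob {z \<in> space nu. fst z \<in> X} = 1" by simp
    from nu.AE_prob_1[OF this] show ?thesis by simp
  qed
  then have aeX: "AE \<omega> in D. xs i \<omega> \<in> X" if "i < m" for i
    using AE_distrD[OF V[OF that], of "\<lambda>z. fst z \<in> X"] unfolding law'[OF that] by (simp add: V_def)
  define E where "E = {\<omega> \<in> space D. \<forall>i<m. xs i \<omega> \<in> X} - ?B"
  have EX: "{\<omega> \<in> space D. \<forall>i<m. xs i \<omega> \<in> X} \<in> sets D"
  proof -
    have "{\<omega> \<in> space D. xs i \<omega> \<in> X} \<in> sets D" if "i < m" for i
    proof -
      have "{\<omega> \<in> space D. xs i \<omega> \<in> X} = xs i -` X \<inter> space D" by auto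
      then show ?thesis using measurable_sets[OF xm[OF that] borel_closed[OF X]] by simp
    qed
    then have "{\<omega> \<in> space D. \<forall>i\<in>{..<m}. xs i \<omega> \<in> X} \<in> sets D"
      by (intro sets.sets_Collect_finite_All) auto
    then show ?thesis unfolding Ball_def lessThan_iff .
  qed
  have E: "E \<in> sets D" unfolding E_def by (intro sets.Diff sets.Un EX B1 B2)
  have "D.prob E = D.prob (space D - ?B)"
  proof (rule D.finite_measure_eq_AE[OF _ E])
    have "AE \<omega> in D. \<forall>i\<in>{..<m}. xs i \<omega> \<in> X" using aeX by (intro AE_finite_allI) auto
    then show "AE \<omega> in D. (\<omega> \<in> E) = (\<omega> \<in> space D - ?B)"
      by eventually_elim (simp add: E_def)
    show "space D - ?B \<in> sets D" by (intro sets.Diff sets.Un sets.top B1 B2)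
  qed
  also have "\<dots> = 1 - D.prob ?B" by (intro D.prob_compl sets.Un B1 B2)
  also have "\<dots> \<ge> 1 - \<delta>"
    using measure_Un_le[OF B1 B2] P1 P2 by linarith
  finally have "1 - \<delta> \<le> D.prob E" .
  moreover have "\<forall>\<omega>\<in>E. (\<forall>i<m. xs i \<omega> \<in> X) \<and> (\<forall>n. c1 \<omega> n \<le> \<eta>\<^sup>2) \<and> (\<forall>n. c2 \<omega> n \<le> \<eta>\<^sup>2)"
    unfolding E_def by (auto simp: not_le intro: less_imp_le)
  ultimately show ?thesis using E unfolding c1_def c2_def by blast
qed

end

section \<open>The error bound\<close>

lemma op_norm_le:
  assumes "0 \<le> c" "\<And>\<psi>. \<psi> \<in> H \<Longrightarrow> B \<psi> \<in> K \<and> nK (B \<psi>) \<le> c * nH \<psi>"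
  shows "op_norm H nH K nK B \<le> ennreal c"
  unfolding op_norm_def using assms by (intro Inf_lower) auto

lemma ennreal_le_affine_Inf:
  fixes x :: ennreal and s t :: real
  assumes s: "0 < s" and le: "\<And>c. c \<in> S \<Longrightarrow> x \<le> ennreal s * c + ennreal t"
  shows "x \<le> ennreal s * Inf S + ennreal t"
proof -
  have inv: "ennreal (1 / s) * (ennreal s * z) = z" "ennreal s * (ennreal (1 / s) * z) = z" for z
    using s by (simp_all add: mult.assoc[symmetric] ennreal_mult[symmetric])
  have "ennreal (1 / s) * (x - ennreal t) \<le> Inf S"
  proof (rule Inf_greatest)
    fix c assume "c \<in> S"
    then have "x - ennreal t \<le> ennreal s * c"
      using le[of c] by (simp add: ennreal_minus_le_iff add.commute)
    then have "ennreal (1 / s) * (x - ennreal t) \<le> ennreal (1 / s) * (ennreal s * c)"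
      by (intro mult_left_mono) auto
    then show "ennreal (1 / s) * (x - ennreal t) \<le> c" by (simp only: inv)
  qed
  then have "ennreal s * (ennreal (1 / s) * (x - ennreal t)) \<le> ennreal s * Inf S"
    by (intro mult_left_mono) auto
  then have "x - ennreal t \<le> ennreal s * Inf S" by (simp only: inv)
  then show ?thesis by (simp add: ennreal_minus_le_iff add.commute)
qed

text \<open>
  The numerical constants. Here \<open>l\<close> is the smallest eigenvalue that is inverted, \<open>t\<close> is the trace
  and \<open>A\<close> bounds the kernel. As \<open>\<eta> sqrt (t A) = 3/5 * \<epsilon> t\<close>, the bound \<open>A\<close> cancels.
\<close>

lemma estimator_constant_le:
  fixes r :: real
  assumes \<epsilon>: "0 < \<epsilon>" "\<epsilon> < \<delta>" and \<lambda>: "0 < l" "2 * \<delta> \<le> l" "l \<le> t" "t \<le> A" and p: "t \<le> p" and r: "1 \<le> r"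
  defines "\<eta> \<equiv> 3/5 * \<epsilon> * sqrt (t / A)"
  shows "\<eta> / sqrt l + 49/20 * \<eta> / (\<delta> * sqrt l) * (sqrt (t * A) + \<eta>)
    \<le> (1 / sqrt l + (r + 1) / (\<delta> * l) * (1 + p) * sqrt t) * \<epsilon>"
proof -
  have pos: "0 < \<delta>" "0 < t" "0 < A" using assms by linarith+
  have "sqrt (t / A) \<le> 1" using \<lambda> pos by simp
  then have "3/5 * \<epsilon> * sqrt (t / A) \<le> 3/5 * \<epsilon> * 1" using \<epsilon> by (intro mult_left_mono) auto
  then have \<eta>1: "\<eta> \<le> \<epsilon>" unfolding \<eta>_def using \<epsilon> by linarith
  have \<eta>0: "0 \<le> \<eta>" using \<epsilon> pos by (simp add: \<eta>_def)
  have "sqrt (t / A) * sqrt (t * A) = t"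
    using pos by (simp add: real_sqrt_mult[symmetric])
  then have e1: "\<eta> * sqrt (t * A) = 3/5 * \<epsilon> * t" unfolding \<eta>_def by (simp add: mult.assoc)
  have "\<epsilon> \<le> A / 2" using assms by linarith
  then have "\<epsilon> / A \<le> 1/2" using pos by (simp add: divide_le_eq)
  have "\<eta> * \<eta> = 9/25 * (\<epsilon> * t) * (\<epsilon> / A)"
  proof -
    have "p * q * s * (p * q * s) = p * p * (q * q) * (s * s)" for p q s :: real by simp
    then have "\<eta> * \<eta> = 3/5 * (3/5) * (\<epsilon> * \<epsilon>) * (sqrt (t / A) * sqrt (t / A))" unfolding \<eta>_def .
    also have "sqrt (t / A) * sqrt (t / A) = t / A" using pos by (intro real_sqrt_mult_self[THEN trans]) simp
    finally show ?thesis by (simp add: mult_ac)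
  qed
  also have "\<dots> \<le> 9/25 * (\<epsilon> * t) * (1/2)"
    using \<open>\<epsilon> / A \<le> 1/2\<close> \<epsilon> pos by (intro mult_left_mono) auto
  finally have e2: "\<eta> * (sqrt (t * A) + \<eta>) \<le> 39/50 * (\<epsilon> * t)" using e1 by (simp add: distrib_left)
  have "49/20 * \<eta> / (\<delta> * sqrt l) * (sqrt (t * A) + \<eta>) = 49/20 * (\<eta> * (sqrt (t * A) + \<eta>)) / (\<delta> * sqrt l)"
    by simp
  also have "\<dots> \<le> 49/20 * (39/50 * (\<epsilon> * t)) / (\<delta> * sqrt l)"
    using e2 pos \<lambda> by (intro divide_right_mono mult_left_mono) auto
  also have "\<dots> \<le> (2 * (\<epsilon> * t)) / (\<delta> * sqrt l)"
    using \<epsilon> pos \<lambda> by (intro divide_right_mono) auto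
  also have "\<dots> = 2 * \<epsilon> / (\<delta> * l) * (t * sqrt l)"
  proof -
    have "1 / sqrt l = sqrt l / l" using \<lambda> by (simp add: divide_eq_eq eq_divide_eq)
    then have "(2 * (\<epsilon> * t)) / \<delta> * (1 / sqrt l) = (2 * (\<epsilon> * t)) / \<delta> * (sqrt l / l)" by (rule arg_cong)
    then show ?thesis by (simp add: mult_ac)
  qed
  also have "\<dots> \<le> (r + 1) * \<epsilon> / (\<delta> * l) * ((1 + p) * sqrt t)"
    using \<lambda> pos \<epsilon> p r by (intro mult_mono divide_right_mono mult_right_mono) auto
  finally have 2: "49/20 * \<eta> / (\<delta> * sqrt l) * (sqrt (t * A) + \<eta>) \<le> (r + 1) / (\<delta> * l) * (1 + p) * sqrt t * \<epsilon>"
    by (simp add: mult_ac)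
  have "\<eta> / sqrt l \<le> 1 / sqrt l * \<epsilon>" using \<eta>1 \<lambda> by (simp add: divide_right_mono)
  with 2 show ?thesis unfolding distrib_right by linarith
qed

theorem theorem4p2:
  fixes N :: "'w measure" and F :: "real \<Rightarrow> 'w measure" and W :: "real \<Rightarrow> 'w \<Rightarrow> real^'d"
    and b :: "real^'d \<Rightarrow> real^'d" and \<sigma> :: "real^'d \<Rightarrow> real^'d^'d"
    and \<rho> :: "real \<Rightarrow> real^'d \<Rightarrow> (real^'d) measure"
    and \<Omega> X Y :: "(real^'d) set" and \<mu> \<mu>X :: "(real^'d) measure" and T L :: real
    and k :: "real^'d \<Rightarrow> real^'d \<Rightarrow> real" and \<phi> :: "real^'d \<Rightarrow> real" and knorm :: real
    and HY HX :: "(real^'d \<Rightarrow> real) set"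
    and ipY ipX :: "(real^'d \<Rightarrow> real) \<Rightarrow> (real^'d \<Rightarrow> real) \<Rightarrow> real"
    and J :: "nat set" and e :: "nat \<Rightarrow> real^'d \<Rightarrow> real" and lam :: "nat \<Rightarrow> real"
    and D :: "'v measure" and xs ys :: "nat \<Rightarrow> 'v \<Rightarrow> real^'d"
    and r m :: nat and t \<delta>\<^sub>r c\<^sub>r \<epsilon> \<delta> :: real
  assumes lipschitz_b: "\<exists>C. C-lipschitz_on UNIV b"
    and lipschitz_\<sigma>: "\<exists>C. C-lipschitz_on UNIV \<sigma>"
    and N: "prob_space N"
    and F: "filtration (space N) F" "\<And>s. subalgebra N (F s)"
    and W: "brownian_motion N F W"
    and \<rho>: "sde_transition_kernel N F W b \<sigma> \<rho>"
    and \<Omega>: "open \<Omega>" "connected \<Omega>" "bounded \<Omega>" and X: "X = closure \<Omega>"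
    and T: "T > 0"
    and Y: "closed Y" "X \<subseteq> Y" "\<And>s x. s \<ge> 0 \<Longrightarrow> x \<in> X \<Longrightarrow> emeasure (\<rho> s x) Y = 1"
    and \<mu>: "finite_measure \<mu>" "sets \<mu> = sets (restrict_space borel Y)" "emeasure \<mu> X = 1"
    and \<mu>X: "\<mu>X = restrict_space \<mu> X"
    and L: "L > 0"
      "\<And>s A. s \<in> {0..T} \<Longrightarrow> A \<in> sets \<mu> \<Longrightarrow>
        (\<integral>\<^sup>+x. emeasure (\<rho> s x) A \<partial>\<mu>X) \<le> ennreal L * emeasure \<mu> A"
    and k: "pd_kernel Y k" "continuous_on (Y \<times> Y) (\<lambda>(x, y). k x y)"
      "bounded ((\<lambda>(x, y). k x y) ` (Y \<times> Y))"
    and \<phi>: "\<phi> = (\<lambda>x. k x x)"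
    and knorm: "knorm = (SUP (x, y)\<in>Y \<times> Y. \<bar>k x y\<bar>)"
    and HY: "rkhs Y k HY ipY" and HX: "rkhs X k HX ipX"
    and k_definite: "\<And>\<psi>. \<psi> \<in> L2 \<mu> \<Longrightarrow> (\<integral>x. (\<integral>y. k x y * \<psi> x * \<psi> y \<partial>\<mu>) \<partial>\<mu>) = 0 \<Longrightarrow>
        (AE x in \<mu>. \<psi> x = 0)"
    and HY_injective: "\<And>\<psi>. \<psi> \<in> HY \<Longrightarrow> (AE x in \<mu>. \<psi> x = 0) \<Longrightarrow> \<psi> = (\<lambda>x. 0)"
    and HX_injective: "\<And>\<psi>. \<psi> \<in> HX \<Longrightarrow> (AE x in \<mu>X. \<psi> x = 0) \<Longrightarrow> \<psi> = (\<lambda>x. 0)"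
    and mercer: "mercer_basis HX ipX \<mu>X J e lam"
    and t: "t \<in> {0<..T}"
    and D: "prob_space D"
    and data_law: "\<And>i. i < m \<Longrightarrow>
        distr D (borel \<Otimes>\<^sub>M borel) (\<lambda>\<omega>. (xs i \<omega>, ys i \<omega>)) = joint_law \<mu>X (\<rho> t)"
    and data_indep:
      "prob_space.indep_vars D (\<lambda>i. borel \<Otimes>\<^sub>M borel) (\<lambda>i \<omega>. (xs i \<omega>, ys i \<omega>)) {..<m}"
    and r: "r \<ge> 1" "r + 1 \<in> J"
    and simple: "\<And>j. j \<in> {1..r} \<Longrightarrow> lam (j + 1) < lam j"
    and \<delta>\<^sub>r: "\<delta>\<^sub>r = (MIN j\<in>{1..r}. (lam j - lam (j + 1)) / 2)"
    and c\<^sub>r: "c\<^sub>r = 1 / sqrt (lam r)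
        + (real r + 1) / (\<delta>\<^sub>r * lam r) * (1 + l1_norm \<mu> \<phi>) * sqrt (l1_norm \<mu>X \<phi>)"
    and \<epsilon>: "\<epsilon> \<in> {0<..<\<delta>\<^sub>r}" and \<delta>: "\<delta> \<in> {0<..<1}"
    and m: "real m \<ge> max (real r) (8 * knorm\<^sup>2 * ln (4 / \<delta>) / \<epsilon>\<^sup>2)"
  shows "with_prob_at_least D (1 - \<delta>) (\<lambda>\<omega>. \<forall>Khat.
           is_koopman_estimator X k HX ipX r m (\<lambda>i. xs i \<omega>) (\<lambda>i. ys i \<omega>) Khat \<longrightarrow>
           op_norm HY (h_norm ipY) (L2 \<mu>X) (l2_norm \<mu>X)
             (\<lambda>\<psi> x. l2_proj \<mu>X e r (koopman Y (\<rho> t) \<psi>) x - Khat \<psi> x)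
           \<le> ennreal (c\<^sub>r * \<epsilon>))
       \<and> ((\<forall>\<psi>\<in>HY. \<exists>\<eta>\<in>HX. AE x in \<mu>X. \<eta> x = koopman Y (\<rho> t) \<psi> x) \<longrightarrow>
         with_prob_at_least D (1 - \<delta>) (\<lambda>\<omega>. \<forall>Khat.
           is_koopman_estimator X k HX ipX r m (\<lambda>i. xs i \<omega>) (\<lambda>i. ys i \<omega>) Khat \<longrightarrow>
           op_norm HY (h_norm ipY) (L2 \<mu>X) (l2_norm \<mu>X)
             (\<lambda>\<psi> x. koopman Y (\<rho> t) \<psi> x - Khat \<psi> x)
           \<le> ennreal (sqrt (lam (r + 1)))
               * op_norm HY (h_norm ipY) HX (h_norm ipX)
                   (\<lambda>\<psi>. rep_in HX \<mu>X (koopman Y (\<rho> t) \<psi>))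
             + ennreal (c\<^sub>r * \<epsilon>)))"
proof -
  have X_closed: "closed X" unfolding X by simp
  have X_sets: "X \<in> sets \<mu>" using \<mu>(3) emeasure_notin_sets[of X \<mu>] by fastforce
  have space_\<mu>: "space \<mu> = Y"
    using sets_eq_imp_space_eq[OF \<mu>(2)] by (simp add: space_restrict_space)
  have prob: "prob_space \<mu>X"
    unfolding \<mu>X using X_sets \<mu>(3) Y(2) space_\<mu>
    by (intro prob_spaceI) (simp add: emeasure_restrict_space space_restrict_space Int_absorb2)
  have sets_\<mu>X: "sets \<mu>X = sets (restrict_space borel X)"
  proof -
    have "sets \<mu>X = (\<inter>) X ` (\<inter>) Y ` sets borel"
      unfolding \<mu>X sets_restrict_space \<mu>(2) ..
    also have "\<dots> = (\<inter>) X ` sets borel"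
      unfolding image_image using Y(2) by (intro image_cong refl) auto
    finally show ?thesis by (simp add: sets_restrict_space)
  qed
  have k_bdd: "bdd_above ((\<lambda>(x, y). \<bar>k x y\<bar>) ` (Y \<times> Y))"
  proof -
    obtain B where "\<forall>v\<in>(\<lambda>(x, y). k x y) ` (Y \<times> Y). norm v \<le> B" using k(3) unfolding bounded_iff by blast
    then show ?thesis by (intro bdd_aboveI2[of _ _ B]) auto
  qed
  have k_le: "k x x \<le> knorm" if "x \<in> Y" for x
  proof -
    have "k x x \<le> \<bar>k x x\<bar>" by simp
    also have "\<dots> \<le> knorm"
      unfolding knorm using cSUP_upper[OF _ k_bdd, of "(x, x)"] that by auto
    finally show ?thesis .
  qed
  have kernel: "\<rho> t \<in> measurable borel (prob_algebra borel)"
    using \<rho> t by (auto simp: sde_transition_kernel_def)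
  interpret koopman_setting X Y k HX ipX HY ipY \<mu>X "\<rho> t" J e lam knorm
    using HX HY prob X_closed Y k(2) k_le sets_\<mu>X kernel HX_injective mercer
    by (auto simp: koopman_setting_def koopman_setting_axioms_def)
  interpret \<mu>: finite_measure \<mu> by (rule \<mu>(1))
  have rJ: "{1..r + 1} \<subseteq> J" by (rule J_down[OF r(2)])
  have rJ': "r \<in> J" using subsetD[OF rJ, of r] r by auto
  have lam_r: "0 < lam r" "0 < lam (r + 1)" by (rule lam_pos[OF rJ'], rule lam_pos[OF r(2)])
  have lam_trace: "lam r \<le> trace" using ev_le[of r] rJ' by (simp add: ev_def)
  then have trace_pos: "0 < trace" using lam_r by linarith
  have \<delta>r_le: "2 * \<delta>\<^sub>r \<le> lam r - lam (r + 1)"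
  proof -
    have "\<delta>\<^sub>r \<le> (lam r - lam (r + 1)) / 2" unfolding \<delta>\<^sub>r using r by (intro Min_le) auto
    then show ?thesis by simp
  qed
  have \<epsilon>_bounds: "0 < \<epsilon>" "\<epsilon> < \<delta>\<^sub>r" using \<epsilon> by auto
  have l1X: "l1_norm \<mu>X \<phi> = trace"
    unfolding l1_norm_def trace_def \<phi>
    by (intro Bochner_Integration.integral_cong) (auto simp: space_M HX.kernel_diag_nonneg)
  have l1_le: "trace \<le> l1_norm \<mu> \<phi>"
  proof -
    have "continuous_on Y (\<lambda>y. case (y, y) of (x, y) \<Rightarrow> k x y)"
      by (rule continuous_on_compose2[OF k(2)]) (auto intro!: continuous_intros)
    then have "\<phi> \<in> borel_measurable (restrict_space borel Y)"
      unfolding \<phi> by (intro borel_measurable_continuous_on_restrict) simp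
    then have m\<phi>: "\<phi> \<in> borel_measurable \<mu>" unfolding measurable_cong_sets[OF \<mu>(2) refl] .
    have i: "integrable \<mu> (\<lambda>x. \<bar>\<phi> x\<bar>)"
      using m\<phi> k_le HY.kernel_diag_nonneg
      by (intro integrable_abs \<mu>.integrable_const_bound[of _ knorm]) (auto intro!: AE_I2 simp: \<phi> space_\<mu>)
    have "X \<inter> space \<mu> \<in> sets \<mu>" using X_sets by auto
    from integral_restrict_space[OF this, of "\<lambda>x. \<bar>\<phi> x\<bar>"]
    have "trace = (\<integral>x. indicator X x *\<^sub>R \<bar>\<phi> x\<bar> \<partial>\<mu>)"
      using l1X unfolding l1_norm_def \<mu>X[symmetric] by simp
    also have "\<dots> \<le> (\<integral>x. \<bar>\<phi> x\<bar> \<partial>\<mu>)"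
      using i X_sets by (intro integral_mono integrable_mult_indicator) (auto simp: indicator_def)
    finally show ?thesis by (simp add: l1_norm_def)
  qed
  \<comment> \<open>the deviation of the empirical operators\<close>
  define \<eta> where "\<eta> = 3/5 * \<epsilon> * sqrt (trace / knorm)"
  have knorm_pos: "0 < knorm" using trace_pos trace_le by linarith
  have \<eta>0: "0 \<le> \<eta>" using \<epsilon>_bounds trace_pos knorm_pos by (simp add: \<eta>_def)
  have \<eta>_le: "5 * \<eta> \<le> 3 * \<delta>\<^sub>r"
  proof -
    have "sqrt (trace / knorm) \<le> 1" using trace_le knorm_pos by simp
    then have "3/5 * \<epsilon> * sqrt (trace / knorm) \<le> 3/5 * \<epsilon> * 1"
      using \<epsilon>_bounds by (intro mult_left_mono) auto
    then show ?thesis using \<epsilon>_bounds unfolding \<eta>_def by linarith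
  qed
  have const: "\<eta> / sqrt (lam r) + 49/20 * \<eta> / (\<delta>\<^sub>r * sqrt (lam r)) * (sqrt (trace * knorm) + \<eta>) \<le> c\<^sub>r * \<epsilon>"
    unfolding c\<^sub>r l1X \<eta>_def
    using \<epsilon>_bounds lam_r \<delta>r_le lam_trace trace_le l1_le r
    by (intro estimator_constant_le) auto
  have m0: "0 < m" using m r by (cases m) auto
  obtain g where g: "HY.total_orthonormal g"
    using rkhs_total_orthonormal_exists[OF HY k(2)] X_nonempty Y(2) by blast
  obtain E where E: "E \<in> sets D" "1 - \<delta> \<le> measure D E"
    and E_X: "\<And>\<omega> i. \<omega> \<in> E \<Longrightarrow> i < m \<Longrightarrow> xs i \<omega> \<in> X"
    and E_cov: "\<And>\<omega> n. \<omega> \<in> E \<Longrightarrow> (\<Sum>j<n. \<Sum>l<n. ((\<Sum>i<m. ef j (xs i \<omega>) * ef l (xs i \<omega>)) / real m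
        - (if j = l then ev j else 0))\<^sup>2) \<le> \<eta>\<^sup>2"
    and E_cross: "\<And>\<omega> n. \<omega> \<in> E \<Longrightarrow> (\<Sum>j<n. \<Sum>l<n. ((\<Sum>i<m. ef j (xs i \<omega>) * g l (ys i \<omega>)) / real m
        - cross (g l) j)\<^sup>2) \<le> \<eta>\<^sup>2"
  proof -
    have "distr D (borel \<Otimes>\<^sub>M borel) (\<lambda>\<omega>. (xs i \<omega>, ys i \<omega>)) = nu" if "i < m" for i
      unfolding nu_def by (rule data_law[OF that])
    from good_sample[OF D this data_indep m0 trace_pos \<epsilon>_bounds(1) _ _ _ g, of \<delta>]
    have "\<exists>E\<in>sets D. 1 - \<delta> \<le> measure D E \<and> (\<forall>\<omega>\<in>E. (\<forall>i<m. xs i \<omega> \<in> X) \<and>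
     (\<forall>n. (\<Sum>j<n. \<Sum>l<n. ((\<Sum>i<m. ef j (xs i \<omega>) * ef l (xs i \<omega>)) / real m
        - (if j = l then ev j else 0))\<^sup>2) \<le> \<eta>\<^sup>2) \<and>
     (\<forall>n. (\<Sum>j<n. \<Sum>l<n. ((\<Sum>i<m. ef j (xs i \<omega>) * g l (ys i \<omega>)) / real m - cross (g l) j)\<^sup>2) \<le> \<eta>\<^sup>2))"
      using \<epsilon>_bounds \<delta>r_le lam_r lam_trace \<delta> m unfolding \<eta>_def by auto
    then show ?thesis using that by blast
  qed
  have error: "Khat \<psi> \<in> HX \<and> (\<exists>h\<in>HX. (AE z in \<mu>X. l2_proj \<mu>X e r (koopman Y (\<rho> t) \<psi>) z - Khat \<psi> z = h z) \<and>
      l2_norm \<mu>X h \<le> c\<^sub>r * \<epsilon> * h_norm ipY \<psi>)"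
    if \<omega>: "\<omega> \<in> E" and K: "is_koopman_estimator X k HX ipX r m (\<lambda>i. xs i \<omega>) (\<lambda>i. ys i \<omega>) Khat"
      and \<psi>: "\<psi> \<in> HY" for \<omega> Khat \<psi>
  proof -
    obtain lh fh where top: "top_eigensystem HX ipX (emp_cov X k m (\<lambda>i. xs i \<omega>) (\<lambda>i. xs i \<omega>)) r lh fh"
      and Khat: "Khat = (\<lambda>\<psi>. trunc_pinv ipX r lh fh (emp_cov X k m (\<lambda>i. xs i \<omega>) (\<lambda>i. ys i \<omega>) \<psi>))"
      using K unfolding is_koopman_estimator_def by blast
    have \<delta>r0: "0 < \<delta>\<^sub>r" using \<epsilon>_bounds by simp
    note est = estimator_error[OF E_X[OF \<omega>] m0 \<eta>0 g E_cov[OF \<omega>] E_cross[OF \<omega>] r \<delta>r0 \<delta>r_le \<eta>_le top \<psi>]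
    obtain h where h: "h \<in> HX" "AE z in \<mu>X. l2_proj \<mu>X e r (koopman Y (\<rho> t) \<psi>) z - Khat \<psi> z = h z"
      "l2_norm \<mu>X h \<le> (\<eta> / sqrt (lam r) + 49/20 * \<eta> / (\<delta>\<^sub>r * sqrt (lam r)) * (sqrt (trace * knorm) + \<eta>)) * h_norm ipY \<psi>"
      using est(2) unfolding Khat by blast
    have "0 \<le> h_norm ipY \<psi>" by (simp add: h_norm_def HY.ip_nonneg[OF \<psi>])
    with h(3) have "l2_norm \<mu>X h \<le> c\<^sub>r * \<epsilon> * h_norm ipY \<psi>"
      using mult_right_mono[OF const] by fastforce
    then show ?thesis using est(1) h unfolding Khat by blast
  qed
  have c\<epsilon>: "0 \<le> c\<^sub>r * \<epsilon>"
  proof (rule order_trans[OF _ const])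
    show "0 \<le> \<eta> / sqrt (lam r) + 49/20 * \<eta> / (\<delta>\<^sub>r * sqrt (lam r)) * (sqrt (trace * knorm) + \<eta>)"
      using \<eta>0 \<epsilon>_bounds lam_r trace_pos knorm_pos by simp
  qed
  have proj_L2: "(\<lambda>x. l2_proj \<mu>X e r (koopman Y (\<rho> t) \<psi>) x) \<in> L2 \<mu>X" if "\<psi> \<in> HY" for \<psi>
  proof -
    have "{1..r} \<subseteq> J" using rJ by auto
    then show ?thesis
      unfolding l2_proj_eq[OF koopman_L2[OF that] \<open>{1..r} \<subseteq> J\<close>]
      by (intro L2_lincomb e_L2) auto
  qed
  show ?thesis
  proof (intro conjI impI)
    show "with_prob_at_least D (1 - \<delta>) (\<lambda>\<omega>. \<forall>Khat.
           is_koopman_estimator X k HX ipX r m (\<lambda>i. xs i \<omega>) (\<lambda>i. ys i \<omega>) Khat \<longrightarrow>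
           op_norm HY (h_norm ipY) (L2 \<mu>X) (l2_norm \<mu>X)
             (\<lambda>\<psi> x. l2_proj \<mu>X e r (koopman Y (\<rho> t) \<psi>) x - Khat \<psi> x) \<le> ennreal (c\<^sub>r * \<epsilon>))"
      unfolding with_prob_at_least_def
    proof (intro bexI[OF _ E(1)] conjI E(2) ballI allI impI op_norm_le c\<epsilon>)
      fix \<omega> Khat \<psi> assume a: "\<omega> \<in> E"
        "is_koopman_estimator X k HX ipX r m (\<lambda>i. xs i \<omega>) (\<lambda>i. ys i \<omega>) Khat" "\<psi> \<in> HY"
      obtain h where h: "h \<in> HX" "AE z in \<mu>X. l2_proj \<mu>X e r (koopman Y (\<rho> t) \<psi>) z - Khat \<psi> z = h z"
        "l2_norm \<mu>X h \<le> c\<^sub>r * \<epsilon> * h_norm ipY \<psi>" and K: "Khat \<psi> \<in> HX" using error[OF a] by blast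
      show L: "(\<lambda>x. l2_proj \<mu>X e r (koopman Y (\<rho> t) \<psi>) x - Khat \<psi> x) \<in> L2 \<mu>X"
        by (intro L2_diff proj_L2 a HX_L2 K)
      show "l2_norm \<mu>X (\<lambda>x. l2_proj \<mu>X e r (koopman Y (\<rho> t) \<psi>) x - Khat \<psi> x) \<le> c\<^sub>r * \<epsilon> * h_norm ipY \<psi>"
        using l2_norm_cong_AE[OF L HX_L2[OF h(1)] h(2)] h(3) by simp
    qed
  next
    assume range: "\<forall>\<psi>\<in>HY. \<exists>\<eta>\<in>HX. AE x in \<mu>X. \<eta> x = koopman Y (\<rho> t) \<psi> x"
    have rep: "rep_in HX \<mu>X (koopman Y (\<rho> t) \<psi>) \<in> HX \<and>
        (AE x in \<mu>X. rep_in HX \<mu>X (koopman Y (\<rho> t) \<psi>) x = koopman Y (\<rho> t) \<psi> x)" if \<psi>: "\<psi> \<in> HY" for \<psi>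
    proof -
      obtain \<zeta> where \<zeta>: "\<zeta> \<in> HX" "AE x in \<mu>X. \<zeta> x = koopman Y (\<rho> t) \<psi> x" using range \<psi> by blast
      show ?thesis
        unfolding rep_in_def
      proof (rule theI[where a = \<zeta>])
        show "\<zeta> \<in> HX \<and> (AE x in \<mu>X. \<zeta> x = koopman Y (\<rho> t) \<psi> x)" using \<zeta> by blast
        fix \<xi> assume \<xi>: "\<xi> \<in> HX \<and> (AE x in \<mu>X. \<xi> x = koopman Y (\<rho> t) \<psi> x)"
        have "AE x in \<mu>X. \<xi> x - \<zeta> x = 0" using conjunct2[OF \<xi>] \<zeta>(2) by eventually_elim simp
        then have "(\<lambda>x. \<xi> x - \<zeta> x) = (\<lambda>x. 0)"
          using HX_injective[OF HX.diff_mem[of \<xi> \<zeta>]] \<xi> \<zeta>(1) by blast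
        then show "\<xi> = \<zeta>" by (auto simp: fun_eq_iff)
      qed
    qed
    show "with_prob_at_least D (1 - \<delta>) (\<lambda>\<omega>. \<forall>Khat.
           is_koopman_estimator X k HX ipX r m (\<lambda>i. xs i \<omega>) (\<lambda>i. ys i \<omega>) Khat \<longrightarrow>
           op_norm HY (h_norm ipY) (L2 \<mu>X) (l2_norm \<mu>X) (\<lambda>\<psi> x. koopman Y (\<rho> t) \<psi> x - Khat \<psi> x)
           \<le> ennreal (sqrt (lam (r + 1)))
               * op_norm HY (h_norm ipY) HX (h_norm ipX) (\<lambda>\<psi>. rep_in HX \<mu>X (koopman Y (\<rho> t) \<psi>))
             + ennreal (c\<^sub>r * \<epsilon>))"
      unfolding with_prob_at_least_def
    proof (intro bexI[OF _ E(1)] conjI E(2) ballI allI impI)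
      fix \<omega> Khat assume a: "\<omega> \<in> E"
        "is_koopman_estimator X k HX ipX r m (\<lambda>i. xs i \<omega>) (\<lambda>i. ys i \<omega>) Khat"
      let ?R = "\<lambda>\<psi>. rep_in HX \<mu>X (koopman Y (\<rho> t) \<psi>)"
      let ?N = "op_norm HY (h_norm ipY) (L2 \<mu>X) (l2_norm \<mu>X) (\<lambda>\<psi> x. koopman Y (\<rho> t) \<psi> x - Khat \<psi> x)"
      have "?N \<le> ennreal (sqrt (lam (r + 1))) * C + ennreal (c\<^sub>r * \<epsilon>)"
        if C: "C \<in> {ennreal c | c. 0 \<le> c \<and> (\<forall>\<psi>\<in>HY. ?R \<psi> \<in> HX \<and> h_norm ipX (?R \<psi>) \<le> c * h_norm ipY \<psi>)}" for C
      proof -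
        obtain c where c: "C = ennreal c" "0 \<le> c" "\<And>\<psi>. \<psi> \<in> HY \<Longrightarrow> h_norm ipX (?R \<psi>) \<le> c * h_norm ipY \<psi>"
          using C by blast
        have "?N \<le> ennreal (sqrt (lam (r + 1)) * c + c\<^sub>r * \<epsilon>)"
        proof (intro op_norm_le conjI)
          show "0 \<le> sqrt (lam (r + 1)) * c + c\<^sub>r * \<epsilon>" using c(2) c\<epsilon> lam_r by simp
          fix \<psi> assume \<psi>: "\<psi> \<in> HY"
          obtain h where h: "h \<in> HX" "AE z in \<mu>X. l2_proj \<mu>X e r (koopman Y (\<rho> t) \<psi>) z - Khat \<psi> z = h z"
            "l2_norm \<mu>X h \<le> c\<^sub>r * \<epsilon> * h_norm ipY \<psi>" and K: "Khat \<psi> \<in> HX" using error[OF a \<psi>] by blast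
          obtain h' where h': "h' \<in> HX"
            "AE x in \<mu>X. koopman Y (\<rho> t) \<psi> x - l2_proj \<mu>X e r (koopman Y (\<rho> t) \<psi>) x = h' x"
            "l2_norm \<mu>X h' \<le> sqrt (lam (r + 1)) * h_norm ipX (?R \<psi>)"
            using projection_error[OF r koopman_L2[OF \<psi>], of "?R \<psi>"] rep[OF \<psi>] by blast
          show L: "(\<lambda>x. koopman Y (\<rho> t) \<psi> x - Khat \<psi> x) \<in> L2 \<mu>X"
            by (intro L2_diff koopman_L2 \<psi> HX_L2 K)
          have hh: "(\<lambda>x. h' x + h x) \<in> HX" by (intro HX.add_mem h h')
          have "AE x in \<mu>X. koopman Y (\<rho> t) \<psi> x - Khat \<psi> x = h' x + h x"
            using h(2) h'(2) by eventually_elim simp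
          then have "l2_norm \<mu>X (\<lambda>x. koopman Y (\<rho> t) \<psi> x - Khat \<psi> x) = l2_norm \<mu>X (\<lambda>x. h' x + h x)"
            by (rule l2_norm_cong_AE[OF L HX_L2[OF hh]])
          also have "\<dots> \<le> l2_norm \<mu>X h' + l2_norm \<mu>X h" by (rule l2_norm_add_le[OF h'(1) h(1)])
          also have "\<dots> \<le> sqrt (lam (r + 1)) * (c * h_norm ipY \<psi>) + c\<^sub>r * \<epsilon> * h_norm ipY \<psi>"
            using lam_r by (intro add_mono h(3) order_trans[OF h'(3)] mult_left_mono c(3) \<psi>) auto
          finally show "l2_norm \<mu>X (\<lambda>x. koopman Y (\<rho> t) \<psi> x - Khat \<psi> x)
              \<le> (sqrt (lam (r + 1)) * c + c\<^sub>r * \<epsilon>) * h_norm ipY \<psi>"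
            by (simp add: distrib_right mult.assoc)
        qed
        then show ?thesis using c(1,2) c\<epsilon> lam_r by (simp add: ennreal_mult)
      qed
      then show "?N \<le> ennreal (sqrt (lam (r + 1))) * op_norm HY (h_norm ipY) HX (h_norm ipX) ?R + ennreal (c\<^sub>r * \<epsilon>)"
        unfolding op_norm_def[of HY _ HX] by (intro ennreal_le_affine_Inf) (use lam_r in auto)
    qed
  qed
qed

end
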